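(* Let $n \ge 2$, $q>1$, $1<p<\frac{2n}{n-1}$, and assume $$\Big(\frac{n-1}{2}p-1\Big)(pq-1) < p+2 .$$ Let $f,g,\tilde f,\tilde g$ be non-negative functions on $\mathbb{R}^n$. Assume $f+g$ does not vanish identically and $\tilde g$ does not vanish identically. Let $0<\varepsilon\le 1$. Suppose that, for some $T\in(0,\infty]$, the Cauchy problem $$\square u=|v|^q,\qquad \square v=|\partial_t u|^p,$$ $$(u,\partial_tu,v,\partial_tv)(0,x)=(\varepsilon f,\varepsilon g,\varepsilon\tilde f,\varepsilon\tilde g)(x)$$ has a solution $(u,v)$ on $[0,T)$ in the weak sense described in the context. Suppose moreover that this solution is localized inside the cone: $$\operatorname{supp}(u,v,\partial_tu,\partial_tv)\subset\{(t,x)\in[0,T)\times\mathbb{R}^n : |x|\le t+1\}.$$ Then there is a constant $C_1>0$, depending only on $n,p,q,f,g,\tilde f,\tilde g$ (and not on $\varepsilon$), such that $$T\le C_1\,\varepsilon^{-\frac{p(pq-1)}{p+2-\left(\frac{n-1}{2}p-1\right)(pq-1)}}.$$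
   Context: Here $\square=\partial_t^2-\Delta$ on $[0,T)\times\mathbb{R}^n$, and $\langle \phi,\psi\rangle=\int_{\mathbb{R}^n}\phi\psi\,dx$. A pair $(u,v)$ is a (weak) solution on $[0,T)$ of $\square u=|v|^q$, $\square v=|\partial_t u|^p$ if both of the following hold. (i) For every $\psi\in C_0^\infty((0,T)\times\mathbb{R}^n)$, $$\int_0^T\langle |v(s)|^q,\psi(s)\rangle ds=\int_0^T\langle u(s),(\partial_s^2\psi-\Delta\psi)(s)\rangle ds,$$ $$\int_0^T\langle |\partial_s u(s)|^p,\psi(s)\rangle ds=\int_0^T\langle v(s),(\partial_s^2\psi-\Delta\psi)(s)\rangle ds.$$ (ii) The regularity conditions $$u,v,\partial_tu,\partial_tv\in C([0,T);L^1(\mathbb{R}^n)),\qquad v\in C((0,T);L^q(\mathbb{R}^n)),\qquad \partial_tu\in C((0,T);L^p(\mathbb{R}^n))$$ hold. The initial conditions are understood in the sense of the $C([0,T);L^1)$ continuity in (ii). *)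

theory Defs
  imports "HOL-Analysis.Analysis"
begin

fun dd :: "'b::real_normed_vector list \<Rightarrow> ('b \<Rightarrow> real) \<Rightarrow> 'b \<Rightarrow> real" where
  "dd [] f = f"
| "dd (h # hs) f = (\<lambda>z. frechet_derivative (dd hs f) (at z) h)"

definition smooth_fun :: "('b::real_normed_vector \<Rightarrow> real) \<Rightarrow> bool" where
  "smooth_fun f \<longleftrightarrow> (\<forall>hs z. dd hs f differentiable (at z))"

definition test_fun :: "ereal \<Rightarrow> (real \<times> 'a::euclidean_space \<Rightarrow> real) \<Rightarrow> bool" where
  "test_fun T \<psi> \<longleftrightarrow> smooth_fun \<psi> \<and>
     (\<exists>K. compact K \<and> K \<subseteq> {s. 0 < s \<and> ereal s < T} \<times> UNIV \<and> (\<forall>z. z \<notin> K \<longrightarrow> \<psi> z = 0))"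

definition dt :: "(real \<times> 'a::euclidean_space \<Rightarrow> real) \<Rightarrow> real \<times> 'a \<Rightarrow> real" where
  "dt \<psi> = dd [(1, 0)] \<psi>"

definition box :: "(real \<times> 'a::euclidean_space \<Rightarrow> real) \<Rightarrow> real \<times> 'a \<Rightarrow> real" where
  "box \<psi> = (\<lambda>z. dd [(1, 0), (1, 0)] \<psi> z - (\<Sum>b\<in>Basis. dd [(0, b), (0, b)] \<psi> z))"

definition pairing :: "('a::euclidean_space \<Rightarrow> real) \<Rightarrow> ('a \<Rightarrow> real) \<Rightarrow> real" where
  "pairing \<phi> \<psi> = (LINT x|lebesgue. \<phi> x * \<psi> x)"

definition time_int :: "ereal \<Rightarrow> (real \<Rightarrow> real) \<Rightarrow> real" where
  "time_int T F = (LINT s:{s. 0 < s \<and> ereal s < T}|lborel. F s)"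

definition Ico_T :: "ereal \<Rightarrow> real set" where
  "Ico_T T = {t. 0 \<le> t \<and> ereal t < T}"

definition Ioo_T :: "ereal \<Rightarrow> real set" where
  "Ioo_T T = {t. 0 < t \<and> ereal t < T}"

definition cont_Lr :: "real \<Rightarrow> real set \<Rightarrow> (real \<Rightarrow> 'a::euclidean_space \<Rightarrow> real) \<Rightarrow> bool" where
  "cont_Lr r I w \<longleftrightarrow>
     (\<forall>t\<in>I. w t \<in> borel_measurable lebesgue \<and> integrable lebesgue (\<lambda>x. \<bar>w t x\<bar> powr r)) \<and>
     (\<forall>t0\<in>I. ((\<lambda>t. LINT x|lebesgue. \<bar>w t x - w t0 x\<bar> powr r) \<longlongrightarrow> 0) (at t0 within I))"

definition weak_dt :: "ereal \<Rightarrow> (real \<Rightarrow> 'a::euclidean_space \<Rightarrow> real) \<Rightarrow> (real \<Rightarrow> 'a \<Rightarrow> real) \<Rightarrow> bool" where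
  "weak_dt T w wt \<longleftrightarrow> (\<forall>\<psi>. test_fun T \<psi> \<longrightarrow>
     time_int T (\<lambda>s. pairing (wt s) (\<lambda>x. \<psi> (s, x))) =
     - time_int T (\<lambda>s. pairing (w s) (\<lambda>x. dt \<psi> (s, x))))"

definition weak_solution ::
  "real \<Rightarrow> real \<Rightarrow> ereal \<Rightarrow> (real \<Rightarrow> 'a::euclidean_space \<Rightarrow> real) \<Rightarrow> (real \<Rightarrow> 'a \<Rightarrow> real)
     \<Rightarrow> (real \<Rightarrow> 'a \<Rightarrow> real) \<Rightarrow> (real \<Rightarrow> 'a \<Rightarrow> real) \<Rightarrow> bool" where
  "weak_solution p q T u ut v vt \<longleftrightarrow>
     (\<forall>\<psi>. test_fun T \<psi> \<longrightarrow>
        time_int T (\<lambda>s. pairing (\<lambda>x. \<bar>v s x\<bar> powr q) (\<lambda>x. \<psi> (s, x))) =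
        time_int T (\<lambda>s. pairing (u s) (\<lambda>x. box \<psi> (s, x))) \<and>
        time_int T (\<lambda>s. pairing (\<lambda>x. \<bar>ut s x\<bar> powr p) (\<lambda>x. \<psi> (s, x))) =
        time_int T (\<lambda>s. pairing (v s) (\<lambda>x. box \<psi> (s, x)))) \<and>
     weak_dt T u ut \<and> weak_dt T v vt \<and>
     cont_Lr 1 (Ico_T T) u \<and> cont_Lr 1 (Ico_T T) v \<and>
     cont_Lr 1 (Ico_T T) ut \<and> cont_Lr 1 (Ico_T T) vt \<and>
     cont_Lr q (Ioo_T T) v \<and> cont_Lr p (Ioo_T T) ut"

end

theory Submission
  imports Defs "HOL-Probability.Distributions"
begin

text \<open>
  Testing the equations with \<open>\<eta>(t) \<chi>(x) e\<^bsup>\<omega>\<cdot>x\<^esup>\<close>, where \<open>\<chi> = 1\<close> on the light cone, turns them into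
  ordinary differential equations for exponential moments. For \<open>|\<omega>| = 1\<close> the moment
  \<open>e\<^bsup>-t\<^esup>\<langle>\<partial>\<^sub>t u, e\<^bsup>\<omega>\<cdot>x\<^esup>\<rangle>\<close> stays above a multiple of \<open>\<epsilon>\<close>. Instead of the usual radial eigenfunction of the
  Laplacian, each plane wave is used separately together with Hoelder's inequality with weight \<open>e\<^bsup>\<omega>\<cdot>x-t\<^esup>\<close>,
  and only the resulting inequalities are averaged over a cap of directions \<open>\<omega>\<close>: a plane wave has mass
  \<open>O(t\<^bsup>(n-1)/2\<^esup>)\<close> on the cone, while the average of all of them is \<open>O(t\<^bsup>-(n-1)/2\<^esup>)\<close> pointwise. This gives
  \<open>\<integral>|\<partial>\<^sub>t u|\<^sup>p \<ge> c \<epsilon>\<^sup>p t\<^bsup>(n-1)(1-p/2)\<^esup>\<close>. For \<open>\<omega> = 0\<close> the moments \<open>V = \<integral>v\<close> and \<open>W = \<integral>\<partial>\<^sub>t u\<close> satisfy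
  \<open>V'' \<ge> c t\<^bsup>-n(p-1)\<^esup> W\<^sup>p\<close> and \<open>W' \<ge> c t\<^bsup>-n(q-1)\<^esup> V\<^sup>q\<close>, and an iteration on \<open>[\<tau>, 2\<tau>]\<close> starting from
  \<open>V \<ge> c \<epsilon>\<^sup>p \<tau>\<^bsup>(n-1)(1-p/2)+2\<^esup>\<close> cannot be continued up to \<open>2\<tau>\<close> once \<open>\<tau>\<close> is large.
\<close>

section \<open>Smooth functions\<close>

text \<open>The radial eigenfunction would require its asymptotics up to the boundary of the cone. A
  plane wave needs only \<open>|x - R \<omega>|^2 <= 2 R (R - \<omega>.x)\<close> for
  \<open>|x| <= R\<close>, which makes it Gaussian in \<open>x\<close> for fixed
  \<open>\<omega>\<close> and Gaussian in \<open>\<omega>\<close> for fixed \<open>x\<close>. The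
  first reading bounds its mass, the second its average, and
  \<open>(p-1)(n-1)/2 - (n-1)/2 = -(n-1)(1-p/2)\<close> is the resulting power of \<open>t\<close>.

  The exponent of the lifespan arises as follows. On \<open>[\<tau>, 2\<tau>]\<close> one round of
  the two inequalities turns \<open>V >= M\<close> into a bound of order
  \<open>\<tau>^(p+2-n(pq-1)) M^(pq)\<close>, which improves on \<open>M\<close> once
  \<open>\<tau>^(p+2-n(pq-1)) M^(pq-1)\<close> is large. For \<open>M\<close> of order
  \<open>\<epsilon>^p \<tau>^((n-1)(1-p/2)+2)\<close> this quantity is
  \<open>\<epsilon>^(p(pq-1)) \<tau>^\<theta>\<close>, where \<open>\<theta>\<close> is the
  denominator of the exponent in the theorem and is positive by hypothesis.

  Solutions are only weak, so the moment equations hold at first as distributions in time. Both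
  sides are continuous, which makes them classical and allows elementary monotonicity
  arguments.\<close>

definition flat_exp :: "nat \<Rightarrow> real \<Rightarrow> real" where
  "flat_exp m x = (if 0 < x then (1 / x) ^ m * exp (- (1 / x)) else 0)"

lemma flat_exp_has_derivative_pos:
  assumes "0 < x"
  shows "(flat_exp m has_real_derivative flat_exp (m + 2) x - real m * flat_exp (m + 1) x) (at x)"
proof -
  have "((\<lambda>x. (1 / x) ^ m * exp (- (1 / x))) has_real_derivative
      flat_exp (m + 2) x - real m * flat_exp (m + 1) x) (at x)"
  proof (cases m)
    case 0
    show ?thesis
      using assms unfolding 0 flat_exp_def
      by (auto intro!: derivative_eq_intros simp: field_simps power2_eq_square)
  next
    case (Suc k)
    show ?thesis
      using assms unfolding Suc flat_exp_def
      by (auto intro!: derivative_eq_intros simp: field_simps power2_eq_square)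
        (metis One_nat_def power_eq_if)
  qed
  then show ?thesis
    by (rule has_field_derivative_transform_within_open[where S = "{0<..}"])
      (use assms in \<open>auto simp: flat_exp_def\<close>)
qed

lemma flat_exp_tendsto_at_right_0: "(flat_exp m \<longlongrightarrow> 0) (at_right 0)"
proof -
  have "((\<lambda>y::real. y ^ m / exp y) \<longlongrightarrow> 0) at_top"
    by (rule tendsto_power_div_exp_0)
  then have "((\<lambda>x::real. inverse x ^ m / exp (inverse x)) \<longlongrightarrow> 0) (at_right 0)"
    by (rule filterlim_compose) (rule filterlim_inverse_at_top_right)
  then show ?thesis
    by (rule Lim_transform_eventually)
      (auto simp: eventually_at_right_less flat_exp_def exp_minus field_simps
        intro: eventually_mono[OF eventually_at_right_less])
qed

text \<open>From the right the difference quotient is \<open>flat_exp (Suc m)\<close>, so the limit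
  known for all powers settles it; from the left it is constantly zero.\<close>

lemma flat_exp_has_derivative_0: "(flat_exp m has_real_derivative 0) (at 0)"
proof -
  have "((\<lambda>h. flat_exp m h / h) \<longlongrightarrow> 0) (at_right 0)"
    by (rule Lim_transform_eventually[OF flat_exp_tendsto_at_right_0[of "Suc m"]])
      (auto simp: flat_exp_def intro: eventually_mono[OF eventually_at_right_less])
  moreover have "((\<lambda>h. flat_exp m h / h) \<longlongrightarrow> 0) (at_left 0)"
    by (rule Lim_transform_eventually[OF tendsto_const])
      (auto simp: flat_exp_def eventually_at_filter)
  ultimately have "((\<lambda>h. flat_exp m h / h) \<longlongrightarrow> 0) (at 0)"
    by (simp add: filterlim_split_at)
  then show ?thesis
    by (simp add: DERIV_def flat_exp_def)
qed

text \<open>The derivative stays in the span of the family. This closure is the reason for carrying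
  the power \<open>(1 / x) ^ m\<close> in \<open>flat_exp\<close>.\<close>

lemma flat_exp_has_derivative:
  "(flat_exp m has_real_derivative flat_exp (m + 2) x - real m * flat_exp (m + 1) x) (at x)"
proof -
  consider "x > 0" | "x = 0" | "x < 0" by linarith
  then show ?thesis
  proof cases
    case 1
    then show ?thesis by (rule flat_exp_has_derivative_pos)
  next
    case 2
    then show ?thesis
      using flat_exp_has_derivative_0 by (simp add: flat_exp_def)
  next
    case 3
    have "((\<lambda>_. 0) has_real_derivative 0) (at x)" by simp
    then have "(flat_exp m has_real_derivative 0) (at x)"
      by (rule has_field_derivative_transform_within_open[where S = "{..<0}"])
        (use 3 in \<open>auto simp: flat_exp_def\<close>)
    then show ?thesis using 3 by (simp add: flat_exp_def)
  qed
qed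

text \<open>\<open>smooth_fun\<close> asks for differentiability of all iterated directional
  derivatives. A generated class that is closed under directional derivatives satisfies this by
  induction on the list of directions. It only has to contain the functions built here:
  \<open>flat\<close> and \<open>inverse\<close> serve the quotient \<open>smooth_step\<close>,
  \<open>exp\<close> serves the plane waves.\<close>

inductive_set smooth_class :: "('b::real_normed_vector \<Rightarrow> real) set" where
  const: "(\<lambda>_. c) \<in> smooth_class"
| linear: "bounded_linear l \<Longrightarrow> l \<in> smooth_class"
| add: "f \<in> smooth_class \<Longrightarrow> g \<in> smooth_class \<Longrightarrow> (\<lambda>z. f z + g z) \<in> smooth_class"
| mult: "f \<in> smooth_class \<Longrightarrow> g \<in> smooth_class \<Longrightarrow> (\<lambda>z. f z * g z) \<in> smooth_class"
| exp: "f \<in> smooth_class \<Longrightarrow> (\<lambda>z. exp (f z)) \<in> smooth_class"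
| flat: "f \<in> smooth_class \<Longrightarrow> (\<lambda>z. flat_exp m (f z)) \<in> smooth_class"
| inverse: "f \<in> smooth_class \<Longrightarrow> (\<And>z. f z \<noteq> 0) \<Longrightarrow> (\<lambda>z. inverse (f z)) \<in> smooth_class"

lemma smooth_class_derivative:
  assumes "f \<in> smooth_class"
  shows "\<exists>f'. (\<forall>z. (f has_derivative f' z) (at z)) \<and> (\<forall>h. (\<lambda>z. f' z h) \<in> smooth_class)"
  using assms
proof induction
  case (const c)
  show ?case
    by (rule exI[of _ "\<lambda>_ _. 0"]) (auto intro: smooth_class.const)
next
  case (linear l)
  then show ?case
    by (intro exI[of _ "\<lambda>_. l"])
      (auto intro: smooth_class.const bounded_linear_imp_has_derivative)
next
  case (add f g)
  then obtain f' g' where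
    f': "\<And>z. (f has_derivative f' z) (at z)" "\<And>h. (\<lambda>z. f' z h) \<in> smooth_class" and
    g': "\<And>z. (g has_derivative g' z) (at z)" "\<And>h. (\<lambda>z. g' z h) \<in> smooth_class"
    by blast
  show ?case
    by (rule exI[of _ "\<lambda>z h. f' z h + g' z h"])
      (auto intro!: f' g' smooth_class.add has_derivative_add)
next
  case (mult f g)
  then obtain f' g' where
    f': "\<And>z. (f has_derivative f' z) (at z)" "\<And>h. (\<lambda>z. f' z h) \<in> smooth_class" and
    g': "\<And>z. (g has_derivative g' z) (at z)" "\<And>h. (\<lambda>z. g' z h) \<in> smooth_class"
    by blast
  show ?case
    by (rule exI[of _ "\<lambda>z h. f z * g' z h + f' z h * g z"])
      (auto intro!: f' g' mult smooth_class.add smooth_class.mult has_derivative_mult)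
next
  case (exp f)
  then obtain f' where
    f': "\<And>z. (f has_derivative f' z) (at z)" "\<And>h. (\<lambda>z. f' z h) \<in> smooth_class"
    by blast
  have "((\<lambda>z. exp (f z)) has_derivative (\<lambda>h. exp (f z) * f' z h)) (at z)" for z
    by (rule has_derivative_exp[THEN has_derivative_eq_rhs, OF f'(1)]) (simp add: mult.commute)
  moreover have "(\<lambda>z. exp (f z) * f' z h) \<in> smooth_class" for h
    using exp f'(2) by (intro smooth_class.mult smooth_class.exp) auto
  ultimately show ?case
    by (intro exI[of _ "\<lambda>z h. exp (f z) * f' z h"]) auto
next
  case (flat f m)
  then obtain f' where
    f': "\<And>z. (f has_derivative f' z) (at z)" "\<And>h. (\<lambda>z. f' z h) \<in> smooth_class"
    by blast
  let ?k = "\<lambda>z. flat_exp (m + 2) (f z) + (- real m) * flat_exp (m + 1) (f z)"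
  have "((\<lambda>z. flat_exp m (f z)) has_derivative (\<lambda>h. ?k z * f' z h)) (at z)" for z
    using has_derivative_compose[OF f'(1)[of z] flat_exp_has_derivative[unfolded has_field_derivative_def, of m "f z"]]
    by simp
  moreover have "(\<lambda>z. ?k z * f' z h) \<in> smooth_class" for h
    by (intro smooth_class.mult smooth_class.add smooth_class.flat smooth_class.const flat f'(2))
  ultimately show ?case
    by (intro exI[of _ "\<lambda>z h. ?k z * f' z h"]) auto
next
  case (inverse f)
  then obtain f' where
    f': "\<And>z. (f has_derivative f' z) (at z)" "\<And>h. (\<lambda>z. f' z h) \<in> smooth_class"
    by blast
  let ?k = "\<lambda>z h. (- 1) * (inverse (f z) * f' z h * inverse (f z))"
  have "((\<lambda>z. inverse (f z)) has_derivative ?k z) (at z)" for z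
    by (rule Deriv.has_derivative_inverse[THEN has_derivative_eq_rhs, OF _ f'(1)])
      (auto simp: inverse.hyps)
  moreover have "(\<lambda>z. ?k z h) \<in> smooth_class" for h
    by (intro smooth_class.mult smooth_class.inverse smooth_class.const inverse f'(2))
  ultimately show ?case
    by (intro exI[of _ ?k]) blast
qed

lemma smooth_class_differentiable: "f \<in> smooth_class \<Longrightarrow> f differentiable (at z)"
  using smooth_class_derivative unfolding differentiable_def by blast

lemma smooth_class_frechet_derivative:
  assumes "f \<in> smooth_class"
  shows "(\<lambda>z. frechet_derivative f (at z) h) \<in> smooth_class"
proof -
  obtain f' where f': "\<And>z. (f has_derivative f' z) (at z)" "\<And>h. (\<lambda>z. f' z h) \<in> smooth_class"
    using smooth_class_derivative[OF assms] by blast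
  have "frechet_derivative f (at z) = f' z" for z
    using f'(1) by (rule frechet_derivative_at[symmetric])
  then show ?thesis using f'(2) by simp
qed

lemma smooth_class_dd: "f \<in> smooth_class \<Longrightarrow> dd hs f \<in> smooth_class"
  by (induction hs) (auto intro: smooth_class_frechet_derivative)

lemma smooth_class_smooth_fun: "f \<in> smooth_class \<Longrightarrow> smooth_fun f"
  unfolding smooth_fun_def by (blast intro: smooth_class_dd smooth_class_differentiable)

lemma smooth_class_diff:
  assumes "f \<in> smooth_class" "g \<in> smooth_class"
  shows "(\<lambda>z. f z - g z) \<in> smooth_class"
proof -
  have "(\<lambda>z. f z + (- 1) * g z) \<in> smooth_class"
    by (intro smooth_class.intros assms)
  then show ?thesis by simp
qed

lemma smooth_class_sum:
  "(\<And>i. i \<in> I \<Longrightarrow> f i \<in> smooth_class) \<Longrightarrow> (\<lambda>z. \<Sum>i\<in>I. f i z) \<in> smooth_class"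
  by (induction I rule: infinite_finite_induct) (auto intro: smooth_class.intros)

text \<open>Composition is not a constructor, but substituting \<open>f\<close> commutes with every
  constructor for the outer function except \<open>linear\<close>, and a linear map on the real line
  is multiplication by \<open>l 1\<close>.\<close>

lemma smooth_class_compose:
  fixes k :: "real \<Rightarrow> real"
  assumes "k \<in> smooth_class" and f: "f \<in> smooth_class"
  shows "(\<lambda>z. k (f z)) \<in> smooth_class"
  using assms(1)
proof induction
  case (linear l)
  then have "l x = x * l 1" for x
    using linear_cmul[of l x 1] by (simp add: bounded_linear.linear)
  then have "(\<lambda>z. l (f z)) = (\<lambda>z. f z * l 1)" by metis
  then show ?case by (auto intro: smooth_class.intros f)
qed (auto intro: smooth_class.intros)

lemma smooth_class_has_real_derivative:
  fixes k :: "real \<Rightarrow> real"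
  assumes "k \<in> smooth_class"
  shows "(k has_real_derivative deriv k x) (at x)"
  using smooth_class_differentiable[OF assms]
  by (simp add: DERIV_deriv_iff_real_differentiable)

lemma smooth_class_deriv:
  fixes k :: "real \<Rightarrow> real"
  assumes "k \<in> smooth_class"
  shows "deriv k \<in> smooth_class"
proof -
  have "frechet_derivative k (at x) 1 = deriv k x" for x
    using frechet_derivative_at[OF smooth_class_has_real_derivative[OF assms, of x, unfolded has_field_derivative_def], symmetric]
    by simp
  then show ?thesis
    using smooth_class_frechet_derivative[OF assms, of 1] by simp
qed

lemma smooth_class_continuous_on: "f \<in> smooth_class \<Longrightarrow> continuous_on A f"
  using smooth_class_differentiable differentiable_imp_continuous_within
  by (metis continuous_at_imp_continuous_on)

section \<open>A smooth step: cutoff in space, primitive of a mollifier in time\<close>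

definition smooth_step :: "real \<Rightarrow> real" where
  "smooth_step x = flat_exp 0 x / (flat_exp 0 x + flat_exp 0 (1 - x))"

lemma flat_exp_0_nonneg: "0 \<le> flat_exp 0 x"
  by (simp add: flat_exp_def)

lemma flat_exp_0_pos: "0 < x \<Longrightarrow> 0 < flat_exp 0 x"
  by (simp add: flat_exp_def)

lemma flat_exp_0_mono: "x \<le> y \<Longrightarrow> flat_exp 0 x \<le> flat_exp 0 y"
  by (auto simp: flat_exp_def divide_simps)

lemma smooth_step_denominator_pos: "0 < flat_exp 0 x + flat_exp 0 (1 - x)"
proof (cases "0 < x")
  case True
  then show ?thesis by (intro add_pos_nonneg flat_exp_0_pos flat_exp_0_nonneg)
next
  case False
  then show ?thesis by (intro add_nonneg_pos flat_exp_0_pos flat_exp_0_nonneg) auto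
qed

lemma smooth_step_smooth: "smooth_step \<in> smooth_class"
proof -
  have "(\<lambda>x::real. flat_exp 0 x) \<in> smooth_class"
    by (rule smooth_class.flat) (rule smooth_class.linear, simp)
  moreover have "(\<lambda>x::real. flat_exp 0 (1 - x)) \<in> smooth_class"
    by (intro smooth_class.flat smooth_class_diff smooth_class.const smooth_class.linear) simp
  ultimately have "(\<lambda>x. flat_exp 0 x * inverse (flat_exp 0 x + flat_exp 0 (1 - x))) \<in> smooth_class"
    using smooth_step_denominator_pos
    by (intro smooth_class.mult smooth_class.inverse smooth_class.add) (auto simp: less_le)
  then show ?thesis
    by (simp add: smooth_step_def[abs_def] divide_inverse)
qed

lemma smooth_step_eq_0: "x \<le> 0 \<Longrightarrow> smooth_step x = 0"
  by (simp add: smooth_step_def flat_exp_def)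

lemma smooth_step_eq_1: "1 \<le> x \<Longrightarrow> smooth_step x = 1"
  using smooth_step_denominator_pos[of x] by (simp add: smooth_step_def flat_exp_def)

lemma smooth_step_mono:
  assumes "x \<le> y"
  shows "smooth_step x \<le> smooth_step y"
proof -
  have "flat_exp 0 x * flat_exp 0 (1 - y) \<le> flat_exp 0 y * flat_exp 0 (1 - x)"
    using assms by (intro mult_mono flat_exp_0_mono flat_exp_0_nonneg) auto
  then show ?thesis
    using smooth_step_denominator_pos[of x] smooth_step_denominator_pos[of y]
    by (simp add: smooth_step_def divide_simps algebra_simps)
qed

lemma smooth_step_deriv_nonneg: "0 \<le> deriv smooth_step x"
  by (rule mono_on_imp_deriv_nonneg[of UNIV, OF _ smooth_class_has_real_derivative[OF smooth_step_smooth]])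
    (auto intro!: monoI smooth_step_mono)

lemma smooth_step_deriv_eq_0:
  assumes "x \<notin> {0..1}"
  shows "deriv smooth_step x = 0"
proof -
  consider "x < 0" | "1 < x" using assms by fastforce
  then have "(smooth_step has_real_derivative 0) (at x)"
  proof cases
    case 1
    show ?thesis
      by (rule has_field_derivative_transform_within_open[of "\<lambda>_. 0" 0 x "{..<0}"])
        (use 1 in \<open>auto simp: smooth_step_eq_0\<close>)
  next
    case 2
    show ?thesis
      by (rule has_field_derivative_transform_within_open[of "\<lambda>_. 1" 0 x "{1<..}"])
        (use 2 in \<open>auto simp: smooth_step_eq_1\<close>)
  qed
  then show ?thesis by (rule DERIV_imp_deriv)
qed

lemma smooth_step_scaled_derivative:
  assumes "0 < \<delta>"
  shows "((\<lambda>r. smooth_step ((r - s) / \<delta>)) has_real_derivative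
    deriv smooth_step ((r - s) / \<delta>) / \<delta>) (at r)"
proof -
  have "((\<lambda>r. (r - s) / \<delta>) has_real_derivative 1 / \<delta>) (at r)"
    using assms by (auto intro!: derivative_eq_intros)
  from DERIV_chain2[of smooth_step, OF smooth_class_has_real_derivative[OF smooth_step_smooth] this]
  show ?thesis by simp
qed

section \<open>Weak derivatives in one variable\<close>

text \<open>Passes from the Lebesgue integral over \<open>(0, T)\<close> in the weak formulation to
  the integral over a compact interval, for which the fundamental theorem of calculus is
  available.\<close>

lemma time_int_eq_integral:
  assumes "0 < a" "ereal b < T" "continuous_on {a..b} F" "\<And>s. s \<notin> {a..b} \<Longrightarrow> F s = 0"
  shows "time_int T F = integral {a..b} F"
proof -
  have "ereal s < T" if "s \<in> {a..b}" for s
    using that assms(2) by (meson atLeastAtMost_iff ereal_less_eq(3) order_le_less_trans)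
  then have "time_int T F = (LINT s:{a..b}|lborel. F s)"
    unfolding time_int_def set_lebesgue_integral_def
    using assms(1,4) by (intro Bochner_Integration.integral_cong) (auto simp: indicator_def)
  also have "\<dots> = integral {a..b} F"
    using assms(3) by (intro set_borel_integral_eq_integral borel_integrable_atLeastAtMost')
  finally show ?thesis .
qed

text \<open>\<open>deriv smooth_step ((r - s) / \<delta>) / \<delta>\<close> is a non-negative
  kernel of mass one supported in \<open>[s, s + \<delta>]\<close>. The mollifier is one-sided,
  hence the condition \<open>s + \<delta> < d\<close>.\<close>

lemma mollified_value:
  assumes D: "continuous_on {c..d} D" and s: "c < s" "s < d" and "0 < e"
  shows "\<exists>\<delta>0>0. \<forall>\<delta>. 0 < \<delta> \<longrightarrow> \<delta> < \<delta>0 \<longrightarrow> s + \<delta> < d \<and>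
    \<bar>integral {c..d} (\<lambda>r. deriv smooth_step ((r - s) / \<delta>) / \<delta> * D r) - D s\<bar> \<le> e"
proof -
  obtain \<delta>1 where \<delta>1: "\<delta>1 > 0" "\<And>r. r \<in> {c..d} \<Longrightarrow> \<bar>r - s\<bar> < \<delta>1 \<Longrightarrow> \<bar>D r - D s\<bar> < e"
    using D s \<open>0 < e\<close> by (force simp: continuous_on_iff dist_real_def)
  show ?thesis
  proof (intro exI[of _ "min \<delta>1 (d - s)"] conjI allI impI)
    show "min \<delta>1 (d - s) > 0" using \<delta>1 s by simp
  next
    fix \<delta> :: real assume \<delta>: "0 < \<delta>" "\<delta> < min \<delta>1 (d - s)"
    then show "s + \<delta> < d" by simp
    let ?\<rho> = "\<lambda>r. deriv smooth_step ((r - s) / \<delta>) / \<delta>"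
    have "continuous_on UNIV (deriv smooth_step)"
      by (intro smooth_class_continuous_on smooth_class_deriv smooth_step_smooth)
    then have \<rho>_cont: "continuous_on {c..d} ?\<rho>"
      using \<delta> by (intro continuous_intros continuous_on_compose2[where f = "\<lambda>r. (r - s) / \<delta>"]) auto
    have "(?\<rho> has_integral (smooth_step ((d - s) / \<delta>) - smooth_step ((c - s) / \<delta>))) {c..d}"
    proof (rule fundamental_theorem_of_calculus)
      show "c \<le> d" using s by simp
      fix r
      have "((\<lambda>r. smooth_step ((r - s) / \<delta>)) has_real_derivative ?\<rho> r) (at r)"
        by (rule smooth_step_scaled_derivative[OF \<delta>(1)])
      then show "((\<lambda>r. smooth_step ((r - s) / \<delta>)) has_vector_derivative ?\<rho> r) (at r within {c..d})"
        by (simp add: has_real_derivative_iff_has_vector_derivative has_vector_derivative_at_within)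
    qed
    then have \<rho>_int: "(?\<rho> has_integral 1) {c..d}"
      using \<delta> s by (simp add: smooth_step_eq_0 smooth_step_eq_1 divide_nonpos_pos)
    have int: "(\<lambda>r. ?\<rho> r * D r) integrable_on {c..d}"
      by (intro integrable_continuous_real continuous_on_mult \<rho>_cont D)
    have 1: "((\<lambda>r. ?\<rho> r * D r - ?\<rho> r * D s) has_integral
        (integral {c..d} (\<lambda>r. ?\<rho> r * D r) - 1 * D s)) {c..d}"
      by (intro has_integral_diff integrable_integral int has_integral_mult_left \<rho>_int)
    have 2: "((\<lambda>r. ?\<rho> r * e) has_integral 1 * e) {c..d}"
      by (intro has_integral_mult_left \<rho>_int)
    have 3: "norm (?\<rho> r * D r - ?\<rho> r * D s) \<le> ?\<rho> r * e" if "r \<in> {c..d}" for r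
    proof (cases "(r - s) / \<delta> \<in> {0..1}")
      case True
      then have "\<bar>r - s\<bar> < \<delta>1" using \<delta> by (auto simp: divide_simps split: if_splits)
      then have "\<bar>D r - D s\<bar> \<le> e" using \<delta>1(2)[OF that] by simp
      moreover have "0 \<le> ?\<rho> r" using smooth_step_deriv_nonneg \<delta> by simp
      ultimately have "\<bar>?\<rho> r\<bar> * \<bar>D r - D s\<bar> \<le> ?\<rho> r * e" by (intro mult_mono) auto
      then show ?thesis by (simp only: real_norm_def abs_mult[symmetric] right_diff_distrib)
    next
      case False
      then show ?thesis by (simp add: smooth_step_deriv_eq_0 del: atLeastAtMost_iff)
    qed
    have "norm (integral {c..d} (\<lambda>r. ?\<rho> r * D r) - 1 * D s) \<le> 1 * e"
      using integral_norm_bound_integral[OF has_integral_integrable[OF 1] has_integral_integrable[OF 2] 3]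
      unfolding integral_unique[OF 1] integral_unique[OF 2] .
    then show "\<bar>integral {c..d} (\<lambda>r. ?\<rho> r * D r) - D s\<bar> \<le> e" by simp
  qed
qed

text \<open>The du Bois-Reymond lemma. A plateau rising just after \<open>s1\<close> and falling
  just after \<open>s2\<close> has as derivative the difference of two mollifiers, so the weak
  hypothesis compares the mollified values at the two points.\<close>

lemma constant_if_weak_derivative_zero:
  assumes D: "continuous_on {c..d} D"
    and weak: "\<And>\<eta>. \<eta> \<in> smooth_class \<Longrightarrow> (\<And>s. s \<notin> {c<..<d} \<Longrightarrow> \<eta> s = 0) \<Longrightarrow>
      integral {c..d} (\<lambda>r. deriv \<eta> r * D r) = 0"
    and s: "c < s1" "s1 < s2" "s2 < d"
  shows "D s1 = D s2"
proof (rule ccontr)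
  assume "D s1 \<noteq> D s2"
  \<comment> \<open>Each mollified value errs by at most \<open>e\<close>, so the values would
    differ by at most \<open>2 * e\<close>, less than the assumed \<open>3 * e\<close>.\<close>
  define e where "e = \<bar>D s1 - D s2\<bar> / 3"
  have e: "0 < e" using \<open>D s1 \<noteq> D s2\<close> by (simp add: e_def)
  let ?I = "\<lambda>s \<delta>. integral {c..d} (\<lambda>r. deriv smooth_step ((r - s) / \<delta>) / \<delta> * D r)"
  obtain \<delta>1 where \<delta>1: "\<delta>1 > 0" "\<And>\<delta>. 0 < \<delta> \<Longrightarrow> \<delta> < \<delta>1 \<Longrightarrow> \<bar>?I s1 \<delta> - D s1\<bar> \<le> e"
    using mollified_value[OF D _ _ e, of s1] s by auto
  obtain \<delta>2 where \<delta>2: "\<delta>2 > 0" "\<And>\<delta>. 0 < \<delta> \<Longrightarrow> \<delta> < \<delta>2 \<Longrightarrow> s2 + \<delta> < d \<and> \<bar>?I s2 \<delta> - D s2\<bar> \<le> e"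
    using mollified_value[OF D _ _ e, of s2] s by auto
  define \<delta> where "\<delta> = min \<delta>1 \<delta>2 / 2"
  have \<delta>: "0 < \<delta>" "\<delta> < \<delta>1" "\<delta> < \<delta>2" using \<delta>1 \<delta>2 by (auto simp: \<delta>_def)
  define \<eta> where "\<eta> r = smooth_step ((r - s1) / \<delta>) - smooth_step ((r - s2) / \<delta>)" for r
  have "(\<lambda>r. smooth_step ((r - s) / \<delta>)) \<in> smooth_class" for s
  proof (rule smooth_class_compose[OF smooth_step_smooth])
    have "(\<lambda>r. (r - s) * (1 / \<delta>)) \<in> smooth_class"
      by (intro smooth_class.mult smooth_class_diff smooth_class.const smooth_class.linear) simp
    then show "(\<lambda>r. (r - s) / \<delta>) \<in> smooth_class" by simp
  qed
  then have \<eta>_smooth: "\<eta> \<in> smooth_class"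
    unfolding \<eta>_def[abs_def] by (intro smooth_class_diff)
  have "\<eta> r = 0" if r: "r \<notin> {c<..<d}" for r
  proof -
    consider "r \<le> c" | "d \<le> r" using r by (metis greaterThanLessThan_iff not_less)
    then show ?thesis
    proof cases
      case 1
      then have "(r - s1) / \<delta> \<le> 0" "(r - s2) / \<delta> \<le> 0"
        using s \<delta> by (auto simp: divide_nonpos_pos)
      then show ?thesis by (simp add: \<eta>_def smooth_step_eq_0)
    next
      case 2
      then have "1 \<le> (r - s1) / \<delta>" "1 \<le> (r - s2) / \<delta>"
        using s \<delta> \<delta>2(2)[OF \<delta>(1,3)] by auto
      then show ?thesis by (simp add: \<eta>_def smooth_step_eq_1)
    qed
  qed
  then have 0: "integral {c..d} (\<lambda>r. deriv \<eta> r * D r) = 0"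
    by (intro weak \<eta>_smooth)
  have "deriv \<eta> r = deriv smooth_step ((r - s1) / \<delta>) / \<delta> - deriv smooth_step ((r - s2) / \<delta>) / \<delta>" for r
    unfolding \<eta>_def[abs_def] by (rule DERIV_imp_deriv) (intro DERIV_diff smooth_step_scaled_derivative \<delta>)
  then have *: "deriv \<eta> r * D r = deriv smooth_step ((r - s1) / \<delta>) / \<delta> * D r -
      deriv smooth_step ((r - s2) / \<delta>) / \<delta> * D r" for r
    by (simp add: left_diff_distrib)
  have "continuous_on UNIV (deriv smooth_step)"
    by (intro smooth_class_continuous_on smooth_class_deriv smooth_step_smooth)
  then have "(\<lambda>r. deriv smooth_step ((r - s) / \<delta>) / \<delta> * D r) integrable_on {c..d}" for s
    using \<delta> D
    by (intro integrable_continuous_real continuous_intros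
        continuous_on_compose2[where f = "\<lambda>r. (r - s) / \<delta>"]) auto
  then have "?I s1 \<delta> - ?I s2 \<delta> = 0"
    using 0 unfolding * by (simp add: Henstock_Kurzweil_Integration.integral_diff)
  then have "\<bar>D s1 - D s2\<bar> \<le> 2 * e"
    using \<delta>1(2)[OF \<delta>(1,2)] \<delta>2(2)[OF \<delta>(1,3)] by linarith
  then show False using e by (simp add: e_def)
qed

text \<open>Subtracting a primitive \<open>P\<close> of \<open>G\<close> leaves a continuous
  function with weak derivative zero, which is constant. Hence \<open>F\<close> inherits the
  classical derivative of \<open>P\<close>.\<close>

lemma weak_derivative_imp_derivative:
  assumes F: "continuous_on (Ioo_T T) F" and G: "continuous_on (Ioo_T T) G"
    and weak: "\<And>\<eta> a b. \<eta> \<in> smooth_class \<Longrightarrow> 0 < a \<Longrightarrow> a \<le> b \<Longrightarrow> ereal b < T \<Longrightarrow>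
      (\<And>s. s \<notin> {a<..<b} \<Longrightarrow> \<eta> s = 0) \<Longrightarrow>
      time_int T (\<lambda>s. \<eta> s * G s) = - time_int T (\<lambda>s. deriv \<eta> s * F s)"
    and t: "t \<in> Ioo_T T"
  shows "(F has_real_derivative G t) (at t)"
proof -
  obtain d where d: "t < d" "ereal d < T"
    using t ereal_dense2[of "ereal t" T] by (auto simp: Ioo_T_def)
  \<comment> \<open>Any window \<open>[c, d]\<close> around \<open>t\<close> inside
    \<open>(0, T)\<close> would do; this choice keeps its left end positive.\<close>
  define c where "c = t / 2"
  have c: "0 < c" "c < t" using t by (auto simp: c_def Ioo_T_def)
  have sub: "{c..d} \<subseteq> Ioo_T T"
    using c d by (auto simp: Ioo_T_def) (metis ereal_less_eq(3) order_le_less_trans)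
  have F': "continuous_on {c..d} F" and G': "continuous_on {c..d} G"
    using F G sub continuous_on_subset by blast+
  define P where "P s = integral {c..s} G" for s
  have P_deriv: "(P has_real_derivative G s) (at s within {c..d})" if "s \<in> {c..d}" for s
    unfolding P_def[abs_def] by (rule integral_has_real_derivative[OF G' that])
  have P': "continuous_on {c..d} P"
    using P_deriv by (meson DERIV_continuous continuous_on_eq_continuous_within)
  define D where "D s = F s - P s" for s
  have D': "continuous_on {c..d} D"
    unfolding D_def by (intro continuous_intros F' P')
  have "integral {c..d} (\<lambda>r. deriv \<eta> r * D r) = 0"
    if \<eta>: "\<eta> \<in> smooth_class" and supp: "\<And>s. s \<notin> {c<..<d} \<Longrightarrow> \<eta> s = 0" for \<eta>
  proof -
    have \<eta>': "continuous_on A \<eta>" "continuous_on A (deriv \<eta>)" for A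
      by (intro smooth_class_continuous_on smooth_class_deriv \<eta>)+
    have supp': "deriv \<eta> s = 0" if "s \<notin> {c..d}" for s
    proof (rule DERIV_imp_deriv)
      show "(\<eta> has_real_derivative 0) (at s)"
        by (rule has_field_derivative_transform_within_open[of "\<lambda>_. 0" 0 s "- {c..d}"])
          (use that supp in \<open>auto simp: open_Compl\<close>)
    qed
    \<comment> \<open>Integration by parts; the boundary terms vanish because \<open>\<eta>\<close>
      is zero outside the open interval, in particular at \<open>c\<close> and
      \<open>d\<close>.\<close>
    have "((\<lambda>s. deriv \<eta> s * P s + \<eta> s * G s) has_integral (\<eta> d * P d - \<eta> c * P c)) {c..d}"
    proof (rule fundamental_theorem_of_calculus)
      show "c \<le> d" using c d by simp
      fix s assume "s \<in> {c..d}"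
      then have "((\<lambda>s. \<eta> s * P s) has_real_derivative deriv \<eta> s * P s + \<eta> s * G s) (at s within {c..d})"
        by (auto intro!: derivative_eq_intros P_deriv
            has_field_derivative_at_within[OF smooth_class_has_real_derivative[OF \<eta>]])
      then show "((\<lambda>s. \<eta> s * P s) has_vector_derivative deriv \<eta> s * P s + \<eta> s * G s) (at s within {c..d})"
        by (simp add: has_real_derivative_iff_has_vector_derivative)
    qed
    then have 1: "integral {c..d} (\<lambda>s. deriv \<eta> s * P s + \<eta> s * G s) = 0"
      using supp by (simp add: has_integral_iff)
    have "time_int T (\<lambda>s. \<eta> s * G s) = - time_int T (\<lambda>s. deriv \<eta> s * F s)"
      using c d supp by (intro weak[OF \<eta>, of c d]) auto
    moreover have "time_int T (\<lambda>s. \<eta> s * G s) = integral {c..d} (\<lambda>s. \<eta> s * G s)"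
      using c d supp G' \<eta>' by (intro time_int_eq_integral continuous_intros) auto
    moreover have "time_int T (\<lambda>s. deriv \<eta> s * F s) = integral {c..d} (\<lambda>s. deriv \<eta> s * F s)"
      using c d supp' F' \<eta>' by (intro time_int_eq_integral continuous_intros) auto
    moreover have "integral {c..d} (\<lambda>s. deriv \<eta> s * P s + \<eta> s * G s) =
        integral {c..d} (\<lambda>s. deriv \<eta> s * P s) + integral {c..d} (\<lambda>s. \<eta> s * G s)"
      using P' G' \<eta>'
      by (intro Henstock_Kurzweil_Integration.integral_add integrable_continuous_real continuous_intros)
    moreover have "integral {c..d} (\<lambda>s. deriv \<eta> s * F s - deriv \<eta> s * P s) =
        integral {c..d} (\<lambda>s. deriv \<eta> s * F s) - integral {c..d} (\<lambda>s. deriv \<eta> s * P s)"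
      using P' F' \<eta>'
      by (intro Henstock_Kurzweil_Integration.integral_diff integrable_continuous_real continuous_intros)
    ultimately show ?thesis
      using 1 by (simp add: D_def right_diff_distrib)
  qed
  then have const: "D s1 = D s2" if "c < s1" "s1 < s2" "s2 < d" for s1 s2
    using constant_if_weak_derivative_zero[OF D'] that by blast
  then have "D s = D t" if "s \<in> {c<..<d}" for s
    using that c d by (cases s t rule: linorder_cases) auto
  then have F_eq: "P s + D t = F s" if "s \<in> {c<..<d}" for s
    using that by (fastforce simp: D_def)
  have "(P has_real_derivative G t) (at t)"
    using P_deriv[of t] c d by (simp add: at_within_Icc_at)
  then have "((\<lambda>s. P s + D t) has_real_derivative G t) (at t)"
    by (auto intro!: derivative_eq_intros)
  then show ?thesis
    by (rule has_field_derivative_transform_within_open[where S = "{c<..<d}"])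
      (use F_eq c d in auto)
qed

section \<open>Separated test functions\<close>

lemma smooth_class_compose_linear:
  assumes "X \<in> smooth_class" and l: "bounded_linear l"
  shows "(\<lambda>z. X (l z)) \<in> smooth_class"
  using assms(1)
proof induction
  case (linear k)
  then show ?case by (intro smooth_class.linear bounded_linear_compose[OF _ l])
qed (auto intro: smooth_class.intros)

lemma frechet_derivative_product:
  assumes \<eta>: "\<eta> \<in> smooth_class" and X: "X \<in> smooth_class"
  shows "frechet_derivative (\<lambda>z. \<eta> (fst z) * X (snd z)) (at z) (h, k) =
    deriv \<eta> (fst z) * h * X (snd z) + \<eta> (fst z) * frechet_derivative X (at (snd z)) k"
proof -
  have "((\<lambda>z. \<eta> (fst z)) has_derivative (\<lambda>v. deriv \<eta> (fst z) * fst v)) (at z)"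
    using has_derivative_compose[OF has_derivative_fst[OF has_derivative_ident]
        smooth_class_has_real_derivative[OF \<eta>, unfolded has_field_derivative_def, of "fst z"]]
    by simp
  moreover have "((\<lambda>z. X (snd z)) has_derivative
      (\<lambda>v. frechet_derivative X (at (snd z)) (snd v))) (at z)"
    using smooth_class_differentiable[OF X, unfolded frechet_derivative_works]
    by (intro has_derivative_compose[OF has_derivative_snd[OF has_derivative_ident]])
  ultimately have "((\<lambda>z. \<eta> (fst z) * X (snd z)) has_derivative
      (\<lambda>v. \<eta> (fst z) * frechet_derivative X (at (snd z)) (snd v) +
        deriv \<eta> (fst z) * fst v * X (snd z))) (at z)"
    by (rule has_derivative_mult)
  from frechet_derivative_at[OF this, symmetric] show ?thesis by simp
qed

lemma frechet_derivative_0: "X \<in> smooth_class \<Longrightarrow> frechet_derivative X (at x) 0 = 0"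
  using linear_0[OF linear_frechet_derivative[OF smooth_class_differentiable]] by blast

lemma dt_product:
  assumes "\<eta> \<in> smooth_class" "X \<in> smooth_class"
  shows "dt (\<lambda>z. \<eta> (fst z) * X (snd z)) = (\<lambda>z. deriv \<eta> (fst z) * X (snd z))"
  by (simp add: dt_def frechet_derivative_product frechet_derivative_0 assms)

lemma box_product:
  assumes \<eta>: "\<eta> \<in> smooth_class" and X: "X \<in> smooth_class"
  shows "box (\<lambda>z. \<eta> (fst z) * X (snd z)) (s, x) =
    deriv (deriv \<eta>) s * X x - \<eta> s * (\<Sum>b\<in>Basis. dd [b, b] X x)"
proof -
  have "dd [(1, 0), (1, 0)] (\<lambda>z. \<eta> (fst z) * X (snd z)) (s, x) = deriv (deriv \<eta>) s * X x"
    by (simp add: frechet_derivative_product frechet_derivative_0 \<eta> X smooth_class_deriv)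
  moreover have "dd [(0, b), (0, b)] (\<lambda>z. \<eta> (fst z) * X (snd z)) (s, x) = \<eta> s * dd [b, b] X x" for b
    using frechet_derivative_product[OF \<eta> smooth_class_frechet_derivative[OF X, of b]]
    by (simp add: frechet_derivative_product \<eta> X)
  ultimately show ?thesis
    by (simp add: box_def sum_distrib_left)
qed

text \<open>Iterated derivatives are local. This allows the cutoff to be ignored wherever it equals
  one on a neighbourhood.\<close>

lemma dd_cong_open:
  assumes "open U" "\<And>z. z \<in> U \<Longrightarrow> f z = g z" "z \<in> U"
  shows "dd hs f z = dd hs g z"
  using assms(3)
proof (induction hs arbitrary: z)
  case Nil
  then show ?case using assms(2) by simp
next
  case (Cons h hs)
  have "(dd hs f has_derivative f') (at z) \<longleftrightarrow> (dd hs g has_derivative f') (at z)" for f'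
    using has_derivative_transform_within_open[of "dd hs f" f' z UNIV U "dd hs g"]
      has_derivative_transform_within_open[of "dd hs g" f' z UNIV U "dd hs f"] Cons assms(1)
    by auto
  then show ?case by (simp add: frechet_derivative_def)
qed

section \<open>Plane waves cut off in space\<close>

lemma frechet_derivative_exp_inner:
  "frechet_derivative (\<lambda>x. c * exp (\<omega> \<bullet> x)) (at x) b = c * (\<omega> \<bullet> b) * exp (\<omega> \<bullet> x)"
proof -
  have "((\<lambda>x. c * exp (\<omega> \<bullet> x)) has_derivative (\<lambda>b. c * (\<omega> \<bullet> b) * exp (\<omega> \<bullet> x))) (at x)"
    by (auto intro!: derivative_eq_intros)
  from frechet_derivative_at[OF this, symmetric] show ?thesis by simp
qed

lemma dd_exp_inner: "dd [b, b] (\<lambda>x. exp (\<omega> \<bullet> x)) x = (\<omega> \<bullet> b)\<^sup>2 * exp (\<omega> \<bullet> x)"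
  using frechet_derivative_exp_inner[of 1 \<omega>] frechet_derivative_exp_inner[of "\<omega> \<bullet> b" \<omega>]
  by (simp add: power2_eq_square)

text \<open>The cutoff depends on \<open>x \<bullet> x\<close> and not on \<open>norm x\<close>,
  which would not be smooth at the origin. It equals one for \<open>norm x <= \<rho>\<close> and
  vanishes once \<open>x \<bullet> x >= \<rho>^2 + 1\<close>.\<close>

definition cut_exp :: "real \<Rightarrow> 'a::euclidean_space \<Rightarrow> 'a \<Rightarrow> real" where
  "cut_exp \<rho> \<omega> x = smooth_step (\<rho>\<^sup>2 + 1 - x \<bullet> x) * exp (\<omega> \<bullet> x)"

lemma cut_exp_smooth: "cut_exp \<rho> \<omega> \<in> smooth_class"
proof -
  have "(\<lambda>x::'a. \<Sum>b\<in>Basis. (x \<bullet> b) * (x \<bullet> b)) \<in> smooth_class"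
    by (intro smooth_class_sum smooth_class.mult smooth_class.linear bounded_linear_inner_left)
  then have "(\<lambda>x::'a. x \<bullet> x) \<in> smooth_class"
    by (simp add: euclidean_inner[symmetric])
  then have "(\<lambda>x::'a. smooth_step (\<rho>\<^sup>2 + 1 - x \<bullet> x)) \<in> smooth_class"
    by (intro smooth_class_compose[OF smooth_step_smooth] smooth_class_diff smooth_class.const)
  moreover have "(\<lambda>x::'a. exp (\<omega> \<bullet> x)) \<in> smooth_class"
    by (intro smooth_class.exp smooth_class.linear bounded_linear_inner_right)
  ultimately show ?thesis
    unfolding cut_exp_def[abs_def] by (rule smooth_class.mult)
qed

lemma cut_exp_eq_exp:
  assumes "norm x < \<rho>"
  shows "cut_exp \<rho> \<omega> x = exp (\<omega> \<bullet> x)"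
proof -
  have "x \<bullet> x \<le> \<rho>\<^sup>2"
    using assms power_mono[of "norm x" \<rho> 2] by (simp add: dot_square_norm)
  then show ?thesis by (simp add: cut_exp_def smooth_step_eq_1)
qed

lemma cut_exp_eq_0:
  assumes "\<rho> + 1 < norm x" "0 \<le> \<rho>"
  shows "cut_exp \<rho> \<omega> x = 0"
proof -
  have "(\<rho> + 1)\<^sup>2 \<le> (norm x)\<^sup>2" using assms by (intro power_mono) auto
  then have "\<rho>\<^sup>2 + 1 \<le> x \<bullet> x" using assms by (simp add: dot_square_norm power2_sum)
  then show ?thesis by (simp add: cut_exp_def smooth_step_eq_0)
qed

lemma laplacian_cut_exp:
  assumes "norm x < \<rho>"
  shows "(\<Sum>b\<in>Basis. dd [b, b] (cut_exp \<rho> \<omega>) x) = (\<omega> \<bullet> \<omega>) * exp (\<omega> \<bullet> x)"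
proof -
  have "dd [b, b] (cut_exp \<rho> \<omega>) x = dd [b, b] (\<lambda>x. exp (\<omega> \<bullet> x)) x" for b
    by (rule dd_cong_open[of "ball 0 \<rho>"]) (use assms in \<open>auto simp: cut_exp_eq_exp\<close>)
  also have "dd [b, b] (\<lambda>x. exp (\<omega> \<bullet> x)) x = (\<omega> \<bullet> b)\<^sup>2 * exp (\<omega> \<bullet> x)" for b
    by (rule dd_exp_inner)
  finally show ?thesis
    by (simp add: euclidean_inner[of \<omega> \<omega>] power2_eq_square sum_distrib_right)
qed

lemma test_fun_product:
  fixes \<omega> :: "'a::euclidean_space"
  assumes "\<eta> \<in> smooth_class" "0 < a" "ereal b < T" "\<And>s. s \<notin> {a..b} \<Longrightarrow> \<eta> s = 0" "0 \<le> \<rho>"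
  shows "test_fun T (\<lambda>z. \<eta> (fst z) * cut_exp \<rho> \<omega> (snd z))"
  unfolding test_fun_def
proof (intro conjI exI[of _ "{a..b} \<times> cball (0::'a) (\<rho> + 1)"])
  have "(\<lambda>z. \<eta> (fst z) * cut_exp \<rho> \<omega> (snd z)) \<in> smooth_class"
    by (intro smooth_class.mult smooth_class_compose_linear[OF assms(1)]
        smooth_class_compose_linear[OF cut_exp_smooth] bounded_linear_fst bounded_linear_snd)
  then show "smooth_fun (\<lambda>z. \<eta> (fst z) * cut_exp \<rho> \<omega> (snd z))"
    by (rule smooth_class_smooth_fun)
  show "compact ({a..b} \<times> cball (0::'a) (\<rho> + 1))"
    by (intro compact_Times) auto
  show "{a..b} \<times> cball (0::'a) (\<rho> + 1) \<subseteq> {s. 0 < s \<and> ereal s < T} \<times> UNIV"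
    using assms(2,3) by auto (metis ereal_less_eq(3) order_le_less_trans)
  show "\<forall>z. z \<notin> {a..b} \<times> cball (0::'a) (\<rho> + 1) \<longrightarrow> \<eta> (fst z) * cut_exp \<rho> \<omega> (snd z) = 0"
    using assms(4,5) cut_exp_eq_0[of \<rho>] by fastforce
qed

section \<open>Moments against plane waves, and support in the cone\<close>

definition exp_moment :: "'a::euclidean_space \<Rightarrow> ('a \<Rightarrow> real) \<Rightarrow> real" where
  "exp_moment \<omega> w = (LINT x|lebesgue. w x * exp (\<omega> \<bullet> x))"

text \<open>The support condition is imposed at each time and for almost every \<open>x\<close>, as
  befits curves in \<open>L^1\<close>.\<close>

definition in_cone :: "real set \<Rightarrow> (real \<Rightarrow> 'a::euclidean_space \<Rightarrow> real) \<Rightarrow> bool" where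
  "in_cone I w \<longleftrightarrow> (\<forall>t\<in>I. AE x in lebesgue. norm x > t + 1 \<longrightarrow> w t x = 0)"

lemma in_cone_subset: "in_cone I w \<Longrightarrow> J \<subseteq> I \<Longrightarrow> in_cone J w"
  by (auto simp: in_cone_def)

lemma cont_Lr_measurable: "cont_Lr r I w \<Longrightarrow> t \<in> I \<Longrightarrow> w t \<in> borel_measurable lebesgue"
  by (simp add: cont_Lr_def)

lemma continuous_on_imp_lebesgue_measurable:
  "continuous_on UNIV (f :: 'a::euclidean_space \<Rightarrow> real) \<Longrightarrow> f \<in> borel_measurable lebesgue"
  by (intro measurable_completion) (simp add: borel_measurable_continuous_onI)

text \<open>Only the values of \<open>K\<close> on the ball matter, since \<open>w\<close> vanishes
  outside; global continuity of \<open>K\<close> supplies measurability. \<open>K\<close> will be a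
  time slice of a test function or of its \<open>box\<close>.\<close>

lemma pairing_eq_exp_moment:
  fixes w K :: "'a::euclidean_space \<Rightarrow> real"
  assumes w: "w \<in> borel_measurable lebesgue" "AE x in lebesgue. norm x > r \<longrightarrow> w x = 0"
    and K: "continuous_on UNIV K" "\<And>x. norm x \<le> r \<Longrightarrow> K x = c * exp (\<omega> \<bullet> x)"
  shows "pairing w K = c * exp_moment \<omega> w"
proof -
  have K': "K \<in> borel_measurable lebesgue"
    by (rule continuous_on_imp_lebesgue_measurable[OF K(1)])
  have e: "(\<lambda>x::'a. exp (\<omega> \<bullet> x)) \<in> borel_measurable lebesgue"
    by (intro continuous_on_imp_lebesgue_measurable continuous_intros)
  have "pairing w K = (LINT x|lebesgue. c * (w x * exp (\<omega> \<bullet> x)))"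
    unfolding pairing_def
  proof (rule integral_cong_AE)
    show "AE x in lebesgue. w x * K x = c * (w x * exp (\<omega> \<bullet> x))"
      using w(2)
    proof eventually_elim
      case (elim x)
      then show ?case using K(2)[of x] by (cases "norm x \<le> r") auto
    qed
  qed (use w K' e in measurable)
  then show ?thesis by (simp add: exp_moment_def)
qed

lemma time_int_cong: "(\<And>s. s \<in> Ioo_T T \<Longrightarrow> F s = G s) \<Longrightarrow> time_int T F = time_int T G"
  unfolding time_int_def set_lebesgue_integral_def
  by (intro Bochner_Integration.integral_cong) (auto simp: Ioo_T_def indicator_def)

lemma Ioo_T_subset_Ico_T: "Ioo_T T \<subseteq> Ico_T T"
  by (auto simp: Ioo_T_def Ico_T_def)

text \<open>At times \<open>s <= b\<close> the function lives in \<open>norm x <= b + 1\<close>, so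
  the cutoff radius \<open>b + 2\<close> is strictly larger. The margin puts the support in an open
  ball on which the test function is an exact plane wave, so derivatives agree there as
  well.\<close>

lemma time_int_pairing_product:
  assumes w: "\<And>t. t \<in> Ioo_T T \<Longrightarrow> w t \<in> borel_measurable lebesgue" "in_cone (Ioo_T T) w"
    and supp: "\<And>s. s \<notin> {a..b} \<Longrightarrow> \<eta> s = 0"
  shows "time_int T (\<lambda>s. pairing (w s) (\<lambda>x. \<eta> s * cut_exp (b + 2) \<omega> x)) =
    time_int T (\<lambda>s. \<eta> s * exp_moment \<omega> (w s))"
proof (rule time_int_cong)
  fix s assume s: "s \<in> Ioo_T T"
  show "pairing (w s) (\<lambda>x. \<eta> s * cut_exp (b + 2) \<omega> x) = \<eta> s * exp_moment \<omega> (w s)"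
  proof (cases "s \<in> {a..b}")
    case True
    show ?thesis
    proof (rule pairing_eq_exp_moment)
      show "continuous_on UNIV (\<lambda>x. \<eta> s * cut_exp (b + 2) \<omega> x)"
        by (intro continuous_intros smooth_class_continuous_on cut_exp_smooth)
    qed (use w s True in \<open>auto simp: in_cone_def intro!: cut_exp_eq_exp\<close>)
  next
    case False
    then show ?thesis using supp by (simp add: pairing_def)
  qed
qed

lemma deriv_eq_0_outside:
  assumes "\<And>s. s \<notin> {a..b::real} \<Longrightarrow> \<eta> s = (0::real)" "s \<notin> {a..b}"
  shows "deriv \<eta> s = 0"
proof (rule DERIV_imp_deriv)
  show "(\<eta> has_real_derivative 0) (at s)"
    by (rule has_field_derivative_transform_within_open[of "\<lambda>_. 0" 0 s "- {a..b}"])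
      (use assms in \<open>auto simp: open_Compl\<close>)
qed

text \<open>On the support of \<open>w s\<close> the plane wave is an eigenfunction of the Laplacian
  with eigenvalue \<open>\<omega> \<bullet> \<omega>\<close>; the region where the cutoff varies is
  multiplied by zero.\<close>

lemma time_int_pairing_box:
  assumes w: "\<And>t. t \<in> Ioo_T T \<Longrightarrow> w t \<in> borel_measurable lebesgue" "in_cone (Ioo_T T) w"
    and \<eta>: "\<eta> \<in> smooth_class" "\<And>s. s \<notin> {a..b} \<Longrightarrow> \<eta> s = 0"
  shows "time_int T (\<lambda>s. pairing (w s) (\<lambda>x. box (\<lambda>z. \<eta> (fst z) * cut_exp (b + 2) \<omega> (snd z)) (s, x))) =
    time_int T (\<lambda>s. (deriv (deriv \<eta>) s - (\<omega> \<bullet> \<omega>) * \<eta> s) * exp_moment \<omega> (w s))"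
proof (rule time_int_cong)
  fix s assume s: "s \<in> Ioo_T T"
  let ?K = "\<lambda>x. deriv (deriv \<eta>) s * cut_exp (b + 2) \<omega> x -
    \<eta> s * (\<Sum>b'\<in>Basis. dd [b', b'] (cut_exp (b + 2) \<omega>) x)"
  have "pairing (w s) ?K = (deriv (deriv \<eta>) s - (\<omega> \<bullet> \<omega>) * \<eta> s) * exp_moment \<omega> (w s)"
  proof (cases "s \<in> {a..b}")
    case True
    show ?thesis
    proof (rule pairing_eq_exp_moment)
      show "continuous_on UNIV ?K"
        by (intro continuous_intros smooth_class_continuous_on smooth_class_dd cut_exp_smooth)
      fix x :: 'a assume "norm x \<le> s + 1"
      then have "norm x < b + 2" using True by auto
      then show "?K x = (deriv (deriv \<eta>) s - (\<omega> \<bullet> \<omega>) * \<eta> s) * exp (\<omega> \<bullet> x)"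
        by (simp only: cut_exp_eq_exp laplacian_cut_exp) (simp add: algebra_simps)
    qed (use w s in \<open>auto simp: in_cone_def\<close>)
  next
    case False
    then have "deriv (deriv \<eta>) s = 0"
      by (intro deriv_eq_0_outside[of a b] \<eta>(2))
    then show ?thesis using \<eta>(2)[OF False] by (simp add: pairing_def)
  qed
  then show "pairing (w s) (\<lambda>x. box (\<lambda>z. \<eta> (fst z) * cut_exp (b + 2) \<omega> (snd z)) (s, x)) =
      (deriv (deriv \<eta>) s - (\<omega> \<bullet> \<omega>) * \<eta> s) * exp_moment \<omega> (w s)"
    by (simp only: box_product[OF \<eta>(1) cut_exp_smooth])
qed

section \<open>Exponential moments\<close>

text \<open>Either \<open>\<bar>a - b\<bar>\<close> is at most the fraction \<open>l\<close> of
  \<open>\<bar>a\<bar>\<close>, and then \<open>\<bar>a\<bar> <= \<bar>b\<bar> / (1 - l)\<close>, or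
  it dominates. The point is that the factor of \<open>\<bar>b\<bar> powr r\<close> tends to one as
  \<open>l\<close> tends to zero, which replaces Minkowski's inequality below.\<close>

lemma abs_powr_le_split:
  fixes a b r l :: real
  assumes "0 \<le> r" "0 < l" "l < 1"
  shows "\<bar>a\<bar> powr r \<le> (1 - l) powr (- r) * \<bar>b\<bar> powr r + l powr (- r) * \<bar>a - b\<bar> powr r"
proof (cases "\<bar>a - b\<bar> \<le> l * \<bar>a\<bar>")
  case True
  then have "\<bar>a\<bar> \<le> \<bar>b\<bar> / (1 - l)"
    using assms by (simp add: field_simps)
  then have "\<bar>a\<bar> powr r \<le> (\<bar>b\<bar> / (1 - l)) powr r"
    using assms by (intro powr_mono2) auto
  also have "\<dots> = (1 - l) powr (- r) * \<bar>b\<bar> powr r"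
    using assms by (simp add: powr_divide powr_minus_divide)
  finally show ?thesis by (simp add: add_increasing2)
next
  case False
  then have "\<bar>a\<bar> \<le> \<bar>a - b\<bar> / l"
    using assms by (simp add: field_simps)
  then have "\<bar>a\<bar> powr r \<le> (\<bar>a - b\<bar> / l) powr r"
    using assms by (intro powr_mono2) auto
  also have "\<dots> = l powr (- r) * \<bar>a - b\<bar> powr r"
    using assms by (simp add: powr_divide powr_minus_divide)
  finally show ?thesis by (simp add: add_increasing)
qed

lemma integrable_mult_bounded:
  fixes f k :: "'b \<Rightarrow> real"
  assumes "integrable M f" "k \<in> borel_measurable M" "\<And>x. \<bar>k x\<bar> \<le> C"
  shows "integrable M (\<lambda>x. f x * k x)"
proof (rule Bochner_Integration.integrable_bound[OF integrable_mult_right[OF assms(1), of C]])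
  show "(\<lambda>x. f x * k x) \<in> borel_measurable M"
    using assms(1,2) by measurable
  show "AE x in M. norm (f x * k x) \<le> norm (C * f x)"
  proof (rule AE_I2)
    fix x
    have "\<bar>f x\<bar> * \<bar>k x\<bar> \<le> \<bar>f x\<bar> * \<bar>C\<bar>"
      using assms(3)[of x] by (intro mult_left_mono) auto
    then show "norm (f x * k x) \<le> norm (C * f x)" by (simp add: abs_mult mult.commute)
  qed
qed

text \<open>The regularity condition gives convergence of
  \<open>\<bar>w t - w t0\<bar> powr r\<close> in the mean, whereas the equations contain the
  integral of \<open>\<bar>w t\<bar> powr r\<close> itself. The splitting inequality, used with the
  roles of \<open>t\<close> and \<open>t0\<close> exchanged, connects them.\<close>

lemma weighted_powr_integral_tendsto:
  fixes w :: "real \<Rightarrow> 'a::euclidean_space \<Rightarrow> real"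
  assumes w: "cont_Lr r I w" and r: "0 \<le> r" and t0: "t0 \<in> I"
    and k: "k \<in> borel_measurable lebesgue" "\<And>x. 0 \<le> k x" "\<And>x. k x \<le> C"
  shows "((\<lambda>t. LINT x|lebesgue. \<bar>w t x\<bar> powr r * k x) \<longlongrightarrow>
    (LINT x|lebesgue. \<bar>w t0 x\<bar> powr r * k x)) (at t0 within I)"
proof (rule tendstoI)
  fix e :: real assume "0 < e"
  define N where "N t = (LINT x|lebesgue. \<bar>w t x\<bar> powr r * k x)" for t
  define \<Delta> where "\<Delta> t = (LINT x|lebesgue. \<bar>w t x - w t0 x\<bar> powr r)" for t
  have C: "0 \<le> C" using k(2,3) order_trans by blast
  have k_abs: "\<bar>k x\<bar> \<le> C" for x using k by simp
  have meas: "w t \<in> borel_measurable lebesgue" and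
    int: "integrable lebesgue (\<lambda>x. \<bar>w t x\<bar> powr r)" if "t \<in> I" for t
    using w that by (auto simp: cont_Lr_def)
  have int_k: "integrable lebesgue (\<lambda>x. \<bar>w t x\<bar> powr r * k x)" if "t \<in> I" for t
    by (rule integrable_mult_bounded[OF int[OF that] k(1) k_abs])
  have int_d: "integrable lebesgue (\<lambda>x. \<bar>w t x - w t0 x\<bar> powr r)" if "t \<in> I" for t
  proof (rule Bochner_Integration.integrable_bound)
    show "integrable lebesgue (\<lambda>x. (1 - 1/2) powr (- r) * \<bar>w t x\<bar> powr r + (1/2) powr (- r) * \<bar>w t0 x\<bar> powr r)"
      by (intro Bochner_Integration.integrable_add integrable_mult_right int that t0)
    show "(\<lambda>x. \<bar>w t x - w t0 x\<bar> powr r) \<in> borel_measurable lebesgue"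
      using meas[OF that] meas[OF t0] by measurable
    show "AE x in lebesgue. norm (\<bar>w t x - w t0 x\<bar> powr r) \<le>
        norm ((1 - 1/2) powr (- r) * \<bar>w t x\<bar> powr r + (1/2) powr (- r) * \<bar>w t0 x\<bar> powr r)"
    proof (rule AE_I2)
      fix x
      have "\<bar>w t x - w t0 x\<bar> powr r \<le>
          (1 - 1/2) powr (- r) * \<bar>w t x\<bar> powr r + (1/2) powr (- r) * \<bar>w t0 x\<bar> powr r"
        using abs_powr_le_split[OF r, of "1/2" "w t x - w t0 x" "w t x"] by simp
      then show "norm (\<bar>w t x - w t0 x\<bar> powr r) \<le>
        norm ((1 - 1/2) powr (- r) * \<bar>w t x\<bar> powr r + (1/2) powr (- r) * \<bar>w t0 x\<bar> powr r)"
        by simp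
    qed
  qed
  have N0: "0 \<le> N t0" unfolding N_def using k(2) by (intro integral_nonneg_AE) auto
  have split: "(LINT x|lebesgue. \<bar>f x\<bar> powr r * k x) \<le>
      (1 - l) powr (- r) * (LINT x|lebesgue. \<bar>g x\<bar> powr r * k x) + l powr (- r) * (C * \<Delta> t)"
    if l: "0 < l" "l < 1" and t: "t \<in> I"
      and f: "integrable lebesgue (\<lambda>x. \<bar>f x\<bar> powr r * k x)"
      and g: "integrable lebesgue (\<lambda>x. \<bar>g x\<bar> powr r * k x)"
      and fg: "\<And>x. \<bar>f x - g x\<bar> = \<bar>w t x - w t0 x\<bar>" for f g l t
  proof -
    have "(LINT x|lebesgue. \<bar>f x\<bar> powr r * k x) \<le> (LINT x|lebesgue.
        (1 - l) powr (- r) * (\<bar>g x\<bar> powr r * k x) + l powr (- r) * (C * \<bar>w t x - w t0 x\<bar> powr r))"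
    proof (rule integral_mono)
      show "integrable lebesgue (\<lambda>x. (1 - l) powr (- r) * (\<bar>g x\<bar> powr r * k x) +
          l powr (- r) * (C * \<bar>w t x - w t0 x\<bar> powr r))"
        by (intro Bochner_Integration.integrable_add integrable_mult_right g int_d t)
      fix x
      have "\<bar>f x\<bar> powr r * k x \<le>
          ((1 - l) powr (- r) * \<bar>g x\<bar> powr r + l powr (- r) * \<bar>f x - g x\<bar> powr r) * k x"
        by (intro mult_right_mono abs_powr_le_split r l k(2))
      also have "\<dots> = (1 - l) powr (- r) * (\<bar>g x\<bar> powr r * k x) +
          l powr (- r) * (k x * \<bar>w t x - w t0 x\<bar> powr r)"
        by (simp add: fg algebra_simps)
      also have "\<dots> \<le> (1 - l) powr (- r) * (\<bar>g x\<bar> powr r * k x) +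
          l powr (- r) * (C * \<bar>w t x - w t0 x\<bar> powr r)"
        using k by (intro add_left_mono mult_left_mono mult_right_mono) auto
      finally show "\<bar>f x\<bar> powr r * k x \<le> \<dots>" .
    qed (rule f)
    also have "\<dots> = (1 - l) powr (- r) * (LINT x|lebesgue. \<bar>g x\<bar> powr r * k x) + l powr (- r) * (C * \<Delta> t)"
      using g int_d[OF t] by (simp add: \<Delta>_def)
    finally show ?thesis .
  qed
  \<comment> \<open>The parameter \<open>l\<close> is fixed before \<open>t\<close> approaches
    \<open>t0\<close>: the coefficient of the error term blows up as \<open>l\<close> tends to
    zero.\<close>
  have "((\<lambda>l::real. ((1 - l) powr (- r) - 1) * N t0) \<longlongrightarrow> ((1 - 0) powr (- r) - 1) * N t0) (at_right 0)"
    by (intro tendsto_intros) auto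
  then have "\<forall>\<^sub>F l in at_right 0. ((1 - l) powr (- r) - 1) * N t0 < e / 2"
    using \<open>0 < e\<close> by (intro order_tendstoD(2)) auto
  moreover have "\<forall>\<^sub>F l in at_right 0. 0 < l \<and> l < (1::real)"
    using eventually_at_right_real[of 0 1] by (auto elim: eventually_mono)
  ultimately obtain l :: real where l: "((1 - l) powr (- r) - 1) * N t0 < e / 2" "0 < l" "l < 1"
    using eventually_happens[OF eventually_conj] trivial_limit_at_right_real by blast
  define \<kappa> where "\<kappa> = (1 - l) powr (- r)"
  have "(1 - l) powr r \<le> 1 powr r" using l r by (intro powr_mono2) auto
  then have \<kappa>: "1 \<le> \<kappa>" using l by (simp add: \<kappa>_def powr_minus one_le_inverse_iff)
  have "((\<lambda>t. l powr (- r) * (C * \<Delta> t)) \<longlongrightarrow> l powr (- r) * (C * 0)) (at t0 within I)"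
    unfolding \<Delta>_def using w t0 by (intro tendsto_intros) (auto simp: cont_Lr_def)
  then have "\<forall>\<^sub>F t in at t0 within I. l powr (- r) * (C * \<Delta> t) < e / 2"
    using \<open>0 < e\<close> by (intro order_tendstoD(2)) auto
  moreover have "\<forall>\<^sub>F t in at t0 within I. t \<in> I"
    by (simp add: eventually_at_filter)
  ultimately have "\<forall>\<^sub>F t in at t0 within I. dist (N t) (N t0) < e"
  proof eventually_elim
    case (elim t)
    have 1: "N t \<le> \<kappa> * N t0 + l powr (- r) * (C * \<Delta> t)"
      unfolding N_def \<kappa>_def using elim l t0 by (intro split int_k) auto
    have 2: "N t0 \<le> \<kappa> * N t + l powr (- r) * (C * \<Delta> t)"
      unfolding N_def \<kappa>_def using elim l t0 by (intro split int_k) (auto simp: abs_minus_commute)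
    have 3: "(\<kappa> - 1) * N t0 < e / 2" using l by (simp add: \<kappa>_def)
    have "N t < N t0 + e" using 1 3 elim by (simp add: algebra_simps)
    \<comment> \<open>In this direction the factor \<open>\<kappa>\<close> multiplies
      \<open>N t\<close>, for which no bound is known yet. If the claim fails, \<open>N t\<close> is
      below \<open>N t0\<close>, and the choice of \<open>l\<close> applies again.\<close>
    moreover have "N t0 < N t + e"
    proof (rule ccontr)
      assume "\<not> ?thesis"
      then have "N t \<le> N t0 - e" by simp
      then have "(\<kappa> - 1) * N t \<le> (\<kappa> - 1) * N t0"
        using \<kappa> \<open>0 < e\<close> by (intro mult_left_mono) auto
      then show False using 2 3 elim \<open>N t \<le> N t0 - e\<close> by (simp add: algebra_simps)
    qed
    ultimately show ?case by (simp add: dist_real_def abs_less_iff)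
  qed
  then show "\<forall>\<^sub>F t in at t0 within I. dist (LINT x|lebesgue. \<bar>w t x\<bar> powr r * k x)
      (LINT x|lebesgue. \<bar>w t0 x\<bar> powr r * k x) < e"
    by (simp add: N_def)
qed

lemma weighted_integral_tendsto:
  fixes w :: "real \<Rightarrow> 'a::euclidean_space \<Rightarrow> real"
  assumes w: "cont_Lr 1 I w" and t0: "t0 \<in> I"
    and k: "k \<in> borel_measurable lebesgue" "\<And>x. \<bar>k x\<bar> \<le> C"
  shows "((\<lambda>t. LINT x|lebesgue. w t x * k x) \<longlongrightarrow> (LINT x|lebesgue. w t0 x * k x)) (at t0 within I)"
proof -
  have int: "integrable lebesgue (w t)" if "t \<in> I" for t
  proof -
    have "integrable lebesgue (\<lambda>x. \<bar>w t x\<bar>)" "w t \<in> borel_measurable lebesgue"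
      using w that by (auto simp: cont_Lr_def)
    then show ?thesis by (simp add: integrable_abs_iff)
  qed
  have C: "0 \<le> C" using k(2)[of undefined] by linarith
  have "((\<lambda>t. C * (LINT x|lebesgue. \<bar>w t x - w t0 x\<bar> powr 1)) \<longlongrightarrow> C * 0) (at t0 within I)"
    using w t0 by (intro tendsto_intros) (auto simp: cont_Lr_def)
  then have "((\<lambda>t. C * (LINT x|lebesgue. \<bar>w t x - w t0 x\<bar>)) \<longlongrightarrow> 0) (at t0 within I)"
    by simp
  moreover have "\<forall>\<^sub>F t in at t0 within I. norm ((LINT x|lebesgue. w t x * k x) - (LINT x|lebesgue. w t0 x * k x))
      \<le> C * (LINT x|lebesgue. \<bar>w t x - w t0 x\<bar>)"
  proof (rule eventually_mono[of "\<lambda>t. t \<in> I"])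
    show "\<forall>\<^sub>F t in at t0 within I. t \<in> I" by (simp add: eventually_at_filter)
    fix t assume t: "t \<in> I"
    have d: "integrable lebesgue (\<lambda>x. w t x - w t0 x)"
      by (intro Bochner_Integration.integrable_diff int t t0)
    have "(LINT x|lebesgue. w t x * k x) - (LINT x|lebesgue. w t0 x * k x) =
        (LINT x|lebesgue. (w t x - w t0 x) * k x)"
      using integrable_mult_bounded[OF int[OF t] k] integrable_mult_bounded[OF int[OF t0] k]
      by (simp add: left_diff_distrib)
    also have "norm \<dots> \<le> (LINT x|lebesgue. norm ((w t x - w t0 x) * k x))"
      by (rule integral_norm_bound)
    also have "\<dots> \<le> (LINT x|lebesgue. C * \<bar>w t x - w t0 x\<bar>)"
    proof (rule integral_mono)
      show "integrable lebesgue (\<lambda>x. norm ((w t x - w t0 x) * k x))"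
        by (intro integrable_norm integrable_mult_bounded[OF d k])
      show "integrable lebesgue (\<lambda>x. C * \<bar>w t x - w t0 x\<bar>)"
        using d by simp
      show "norm ((w t x - w t0 x) * k x) \<le> C * \<bar>w t x - w t0 x\<bar>" for x
        using mult_left_mono[OF k(2)[of x], of "\<bar>w t x - w t0 x\<bar>"] by (simp add: abs_mult mult.commute)
    qed
    finally show "norm ((LINT x|lebesgue. w t x * k x) - (LINT x|lebesgue. w t0 x * k x))
      \<le> C * (LINT x|lebesgue. \<bar>w t x - w t0 x\<bar>)" by simp
  qed
  ultimately have "((\<lambda>t. (LINT x|lebesgue. w t x * k x) - (LINT x|lebesgue. w t0 x * k x)) \<longlongrightarrow> 0) (at t0 within I)"
    by (rule Lim_null_comparison[rotated])
  then show ?thesis by (rule LIM_zero_cancel)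
qed

text \<open>The weight \<open>exp (\<omega> \<bullet> x)\<close> is unbounded, but the support of
  \<open>w\<close> allows it to be cut to a ball, and the limit theorems above need a bounded
  weight.\<close>

lemma exp_moment_truncate:
  fixes w :: "'a::euclidean_space \<Rightarrow> real"
  assumes "w \<in> borel_measurable lebesgue" "AE x in lebesgue. norm x > r \<longrightarrow> w x = 0"
  shows "exp_moment \<omega> w = (LINT x|lebesgue. w x * (exp (\<omega> \<bullet> x) * indicator (cball 0 r) x))"
  unfolding exp_moment_def
proof (rule integral_cong_AE)
  have i: "indicator (cball (0::'a) r) \<in> borel_measurable lebesgue"
    by (intro borel_measurable_indicator fmeasurableD lmeasurable_cball)
  have e: "(\<lambda>x::'a. exp (\<omega> \<bullet> x)) \<in> borel_measurable lebesgue"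
    by (intro continuous_on_imp_lebesgue_measurable continuous_intros)
  show "(\<lambda>x. w x * exp (\<omega> \<bullet> x)) \<in> borel_measurable lebesgue"
    using assms(1) e by measurable
  show "(\<lambda>x. w x * (exp (\<omega> \<bullet> x) * indicator (cball 0 r) x)) \<in> borel_measurable lebesgue"
    by (intro borel_measurable_times assms(1) e i)
  show "AE x in lebesgue. w x * exp (\<omega> \<bullet> x) = w x * (exp (\<omega> \<bullet> x) * indicator (cball 0 r) x)"
    using assms(2) by eventually_elim (auto simp: indicator_def)
qed

lemma truncated_exp_bounds:
  fixes \<omega> :: "'a::euclidean_space"
  shows "(\<lambda>x. exp (\<omega> \<bullet> x) * indicator (cball 0 r) x) \<in> borel_measurable lebesgue"
    and "\<bar>exp (\<omega> \<bullet> x) * indicator (cball 0 r) x\<bar> \<le> exp (norm \<omega> * r)"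
proof -
  have e: "(\<lambda>x::'a. exp (\<omega> \<bullet> x)) \<in> borel_measurable lebesgue"
    by (intro continuous_on_imp_lebesgue_measurable continuous_intros)
  have i: "indicator (cball (0::'a) r) \<in> borel_measurable lebesgue"
    by (intro borel_measurable_indicator fmeasurableD lmeasurable_cball)
  show "(\<lambda>x. exp (\<omega> \<bullet> x) * indicator (cball 0 r) x) \<in> borel_measurable lebesgue"
    by (intro borel_measurable_times e i)
  have "\<omega> \<bullet> x \<le> norm \<omega> * r" if "norm x \<le> r"
    using norm_cauchy_schwarz[of \<omega> x] mult_left_mono[OF that, of "norm \<omega>"] by simp
  then show "\<bar>exp (\<omega> \<bullet> x) * indicator (cball 0 r) x\<bar> \<le> exp (norm \<omega> * r)"
    by (auto simp: indicator_def)
qed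

text \<open>The truncation radius must not vary with \<open>t\<close> in a limit;
  \<open>t0 + 2\<close> serves all times below \<open>t0 + 1\<close> at once.\<close>

lemma in_cone_eventually:
  assumes "in_cone I w"
  shows "\<forall>\<^sub>F t in at t0 within I. t \<in> I \<and> (AE x in lebesgue. norm x > t0 + 2 \<longrightarrow> w t x = 0)"
proof -
  have "\<forall>\<^sub>F t in at t0 within I. t < t0 + 1"
    by (intro order_tendstoD(2)[OF tendsto_ident_at]) simp
  moreover have "\<forall>\<^sub>F t in at t0 within I. t \<in> I"
    by (simp add: eventually_at_filter)
  ultimately show ?thesis
  proof eventually_elim
    case (elim t)
    then have "AE x in lebesgue. norm x > t + 1 \<longrightarrow> w t x = 0"
      using assms by (simp add: in_cone_def)
    then show ?case using elim by auto
  qed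
qed

lemma exp_moment_continuous_on:
  assumes w: "cont_Lr 1 I w" and cone: "in_cone I w"
  shows "continuous_on I (\<lambda>t. exp_moment \<omega> (w t))"
  unfolding continuous_on_def
proof
  fix t0 assume t0: "t0 \<in> I"
  let ?k = "\<lambda>x. exp (\<omega> \<bullet> x) * indicator (cball 0 (t0 + 2)) x"
  have eq: "exp_moment \<omega> (w t) = (LINT x|lebesgue. w t x * ?k x)"
    if "t \<in> I" "AE x in lebesgue. norm x > t0 + 2 \<longrightarrow> w t x = 0" for t
    using cont_Lr_measurable[OF w that(1)] that(2) by (rule exp_moment_truncate)
  have "AE x in lebesgue. norm x > t0 + 2 \<longrightarrow> w t0 x = 0"
    using cone t0 by (auto simp: in_cone_def elim: eventually_mono)
  note eq0 = eq[OF t0 this]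
  show "((\<lambda>t. exp_moment \<omega> (w t)) \<longlongrightarrow> exp_moment \<omega> (w t0)) (at t0 within I)"
    unfolding eq0
  proof (rule Lim_transform_eventually)
    show "((\<lambda>t. LINT x|lebesgue. w t x * ?k x) \<longlongrightarrow> (LINT x|lebesgue. w t0 x * ?k x)) (at t0 within I)"
      by (rule weighted_integral_tendsto[OF w t0 truncated_exp_bounds])
    show "\<forall>\<^sub>F t in at t0 within I. (LINT x|lebesgue. w t x * ?k x) = exp_moment \<omega> (w t)"
      using in_cone_eventually[OF cone, of t0] by eventually_elim (simp add: eq)
  qed
qed

lemma exp_moment_powr_continuous_on:
  assumes w: "cont_Lr r I w" and cone: "in_cone I w" and r: "0 < r"
  shows "continuous_on I (\<lambda>t. exp_moment \<omega> (\<lambda>x. \<bar>w t x\<bar> powr r))"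
  unfolding continuous_on_def
proof
  fix t0 assume t0: "t0 \<in> I"
  let ?k = "\<lambda>x. exp (\<omega> \<bullet> x) * indicator (cball 0 (t0 + 2)) x"
  have eq: "exp_moment \<omega> (\<lambda>x. \<bar>w t x\<bar> powr r) = (LINT x|lebesgue. \<bar>w t x\<bar> powr r * ?k x)"
    if "t \<in> I" "AE x in lebesgue. norm x > t0 + 2 \<longrightarrow> w t x = 0" for t
  proof (rule exp_moment_truncate)
    show "(\<lambda>x. \<bar>w t x\<bar> powr r) \<in> borel_measurable lebesgue"
      using cont_Lr_measurable[OF w that(1)] by measurable
    show "AE x in lebesgue. norm x > t0 + 2 \<longrightarrow> \<bar>w t x\<bar> powr r = 0"
      using that(2) by eventually_elim (use r in auto)
  qed
  have "AE x in lebesgue. norm x > t0 + 2 \<longrightarrow> w t0 x = 0"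
    using cone t0 by (auto simp: in_cone_def elim: eventually_mono)
  note eq0 = eq[OF t0 this]
  show "((\<lambda>t. exp_moment \<omega> (\<lambda>x. \<bar>w t x\<bar> powr r)) \<longlongrightarrow> exp_moment \<omega> (\<lambda>x. \<bar>w t0 x\<bar> powr r)) (at t0 within I)"
    unfolding eq0
  proof (rule Lim_transform_eventually)
    show "((\<lambda>t. LINT x|lebesgue. \<bar>w t x\<bar> powr r * ?k x) \<longlongrightarrow> (LINT x|lebesgue. \<bar>w t0 x\<bar> powr r * ?k x)) (at t0 within I)"
      using truncated_exp_bounds(2)[of \<omega> _ "t0 + 2"] r
      by (intro weighted_powr_integral_tendsto[OF w _ t0 truncated_exp_bounds(1)]) (auto simp: abs_le_iff)
    show "\<forall>\<^sub>F t in at t0 within I. (LINT x|lebesgue. \<bar>w t x\<bar> powr r * ?k x) = exp_moment \<omega> (\<lambda>x. \<bar>w t x\<bar> powr r)"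
      using in_cone_eventually[OF cone, of t0] by eventually_elim (simp add: eq)
  qed
qed

text \<open>The weak identity is exported next to the classical derivative because the second-order
  equation needs it for \<open>deriv \<eta>\<close> in place of \<open>\<eta>\<close>.\<close>

lemma exp_moment_has_derivative:
  fixes w wt :: "real \<Rightarrow> 'a::euclidean_space \<Rightarrow> real"
  assumes weak: "weak_dt T w wt"
    and w: "cont_Lr 1 (Ico_T T) w" "in_cone (Ico_T T) w"
    and wt: "cont_Lr 1 (Ico_T T) wt" "in_cone (Ico_T T) wt"
  shows weak_exp_moment: "\<And>\<eta> a b. \<eta> \<in> smooth_class \<Longrightarrow> 0 < a \<Longrightarrow> a \<le> b \<Longrightarrow> ereal b < T \<Longrightarrow>
      (\<And>s. s \<notin> {a..b} \<Longrightarrow> \<eta> s = 0) \<Longrightarrow>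
      time_int T (\<lambda>s. \<eta> s * exp_moment \<omega> (wt s)) = - time_int T (\<lambda>s. deriv \<eta> s * exp_moment \<omega> (w s))"
    and "t \<in> Ioo_T T \<Longrightarrow> ((\<lambda>t. exp_moment \<omega> (w t)) has_real_derivative exp_moment \<omega> (wt t)) (at t)"
proof -
  note sub = Ioo_T_subset_Ico_T[of T]
  show *: "time_int T (\<lambda>s. \<eta> s * exp_moment \<omega> (wt s)) = - time_int T (\<lambda>s. deriv \<eta> s * exp_moment \<omega> (w s))"
    if \<eta>: "\<eta> \<in> smooth_class" "0 < a" "a \<le> b" "ereal b < T" "\<And>s. s \<notin> {a..b} \<Longrightarrow> \<eta> s = 0" for \<eta> a b
  proof -
    let ?\<psi> = "\<lambda>z. \<eta> (fst z) * cut_exp (b + 2) \<omega> (snd z)"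
    have "test_fun T ?\<psi>" using \<eta> by (intro test_fun_product) auto
    then have "time_int T (\<lambda>s. pairing (wt s) (\<lambda>x. \<eta> s * cut_exp (b + 2) \<omega> x)) =
        - time_int T (\<lambda>s. pairing (w s) (\<lambda>x. deriv \<eta> s * cut_exp (b + 2) \<omega> x))"
      using weak unfolding weak_dt_def by (auto simp: dt_product[OF \<eta>(1) cut_exp_smooth])
    moreover have "time_int T (\<lambda>s. pairing (wt s) (\<lambda>x. \<eta> s * cut_exp (b + 2) \<omega> x)) =
        time_int T (\<lambda>s. \<eta> s * exp_moment \<omega> (wt s))"
      using sub wt \<eta> by (intro time_int_pairing_product cont_Lr_measurable[OF wt(1)] in_cone_subset[OF wt(2)]) auto
    moreover have "time_int T (\<lambda>s. pairing (w s) (\<lambda>x. deriv \<eta> s * cut_exp (b + 2) \<omega> x)) =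
        time_int T (\<lambda>s. deriv \<eta> s * exp_moment \<omega> (w s))"
      using sub w \<eta>
      by (intro time_int_pairing_product cont_Lr_measurable[OF w(1)] in_cone_subset[OF w(2)] deriv_eq_0_outside[of a b \<eta>]) auto
    ultimately show ?thesis by simp
  qed
  show "((\<lambda>t. exp_moment \<omega> (w t)) has_real_derivative exp_moment \<omega> (wt t)) (at t)" if "t \<in> Ioo_T T"
  proof (rule weak_derivative_imp_derivative[OF _ _ _ that])
    show "continuous_on (Ioo_T T) (\<lambda>t. exp_moment \<omega> (w t))"
      "continuous_on (Ioo_T T) (\<lambda>t. exp_moment \<omega> (wt t))"
      using exp_moment_continuous_on[OF w] exp_moment_continuous_on[OF wt] sub continuous_on_subset by blast+
  next
    fix \<eta> a b
    assume "\<eta> \<in> smooth_class" "0 < a" "a \<le> b" "ereal b < T" "\<And>s. s \<notin> {a<..<b} \<Longrightarrow> \<eta> s = 0"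
    then show "time_int T (\<lambda>s. \<eta> s * exp_moment \<omega> (wt s)) = - time_int T (\<lambda>s. deriv \<eta> s * exp_moment \<omega> (w s))"
      by (intro *[of \<eta> a b]) auto
  qed
qed

text \<open>With \<open>A\<close>, \<open>B\<close>, \<open>N\<close> the moments of
  \<open>w\<close>, \<open>wt\<close>, \<open>\<bar>z\<bar> powr r\<close>, the equation tested with
  \<open>\<eta>\<close> gives \<open>\<integral>\<eta> N = \<integral>(\<eta>'' - |\<omega>|^2
  \<eta>) A\<close>, and the weak time derivative tested with \<open>\<eta>'\<close> gives
  \<open>\<integral>\<eta>'' A = - \<integral>\<eta>' B\<close>. Together they say that
  \<open>B\<close> has weak derivative \<open>N + |\<omega>|^2 A\<close>. The function
  \<open>z\<close> and the exponent \<open>r\<close> are kept general so that both equations of the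
  system are covered.\<close>

lemma exp_moment_has_second_derivative:
  fixes w wt z :: "real \<Rightarrow> 'a::euclidean_space \<Rightarrow> real"
  assumes weak: "weak_dt T w wt"
    and w: "cont_Lr 1 (Ico_T T) w" "in_cone (Ico_T T) w"
    and wt: "cont_Lr 1 (Ico_T T) wt" "in_cone (Ico_T T) wt"
    and z: "cont_Lr r (Ioo_T T) z" "in_cone (Ico_T T) z" "0 < r"
    and eq: "\<And>\<psi>. test_fun T \<psi> \<Longrightarrow>
      time_int T (\<lambda>s. pairing (\<lambda>x. \<bar>z s x\<bar> powr r) (\<lambda>x. \<psi> (s, x))) =
      time_int T (\<lambda>s. pairing (w s) (\<lambda>x. box \<psi> (s, x)))"
    and t: "t \<in> Ioo_T T"
  shows "((\<lambda>t. exp_moment \<omega> (wt t)) has_real_derivative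
    exp_moment \<omega> (\<lambda>x. \<bar>z t x\<bar> powr r) + (\<omega> \<bullet> \<omega>) * exp_moment \<omega> (w t)) (at t)"
proof -
  note sub = Ioo_T_subset_Ico_T[of T]
  define N where "N t = exp_moment \<omega> (\<lambda>x. \<bar>z t x\<bar> powr r)" for t
  define A where "A t = exp_moment \<omega> (w t)" for t
  define B where "B t = exp_moment \<omega> (wt t)" for t
  have A: "continuous_on (Ioo_T T) A" and B: "continuous_on (Ioo_T T) B"
    unfolding A_def B_def
    using exp_moment_continuous_on[OF w] exp_moment_continuous_on[OF wt] sub continuous_on_subset by blast+
  have N: "continuous_on (Ioo_T T) N"
    unfolding N_def by (rule exp_moment_powr_continuous_on[OF z(1) in_cone_subset[OF z(2) sub] z(3)])
  have "(B has_real_derivative N t + (\<omega> \<bullet> \<omega>) * A t) (at t)"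
  proof (rule weak_derivative_imp_derivative[OF B _ _ t])
    show "continuous_on (Ioo_T T) (\<lambda>t. N t + (\<omega> \<bullet> \<omega>) * A t)"
      by (intro continuous_intros N A)
  next
    fix \<eta> a b
    assume \<eta>: "\<eta> \<in> smooth_class" and ab: "0 < a" "a \<le> b" "ereal b < T"
      and supp: "\<And>s. s \<notin> {a<..<b} \<Longrightarrow> \<eta> s = 0"
    let ?\<psi> = "\<lambda>z. \<eta> (fst z) * cut_exp (b + 2) \<omega> (snd z)"
    have supp0: "\<And>s. s \<notin> {a..b} \<Longrightarrow> \<eta> s = 0" using supp by auto
    have supp1: "\<And>s. s \<notin> {a..b} \<Longrightarrow> deriv \<eta> s = 0"
      by (rule deriv_eq_0_outside[OF supp0])
    have supp2: "\<And>s. s \<notin> {a..b} \<Longrightarrow> deriv (deriv \<eta>) s = 0"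
      by (rule deriv_eq_0_outside[OF supp1])
    have z_meas: "(\<lambda>x. \<bar>z t x\<bar> powr r) \<in> borel_measurable lebesgue" if "t \<in> Ioo_T T" for t
      using cont_Lr_measurable[OF z(1) that] by measurable
    have z_cone: "in_cone (Ioo_T T) (\<lambda>t x. \<bar>z t x\<bar> powr r)"
      using z(2,3) sub unfolding in_cone_def by (fastforce elim: eventually_mono)
    have "test_fun T ?\<psi>" using \<eta> ab supp0 by (intro test_fun_product) auto
    from eq[OF this]
    have "time_int T (\<lambda>s. pairing (\<lambda>x. \<bar>z s x\<bar> powr r) (\<lambda>x. \<eta> s * cut_exp (b + 2) \<omega> x)) =
        time_int T (\<lambda>s. pairing (w s) (\<lambda>x. box ?\<psi> (s, x)))"
      by simp
    moreover have "time_int T (\<lambda>s. pairing (\<lambda>x. \<bar>z s x\<bar> powr r) (\<lambda>x. \<eta> s * cut_exp (b + 2) \<omega> x)) =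
        time_int T (\<lambda>s. \<eta> s * N s)"
      unfolding N_def by (rule time_int_pairing_product[OF z_meas z_cone supp0])
    moreover have "time_int T (\<lambda>s. pairing (w s) (\<lambda>x. box ?\<psi> (s, x))) =
        time_int T (\<lambda>s. (deriv (deriv \<eta>) s - (\<omega> \<bullet> \<omega>) * \<eta> s) * A s)"
      unfolding A_def using sub
      by (intro time_int_pairing_box[OF _ _ \<eta> supp0] cont_Lr_measurable[OF w(1)] in_cone_subset[OF w(2)]) auto
    moreover have "time_int T (\<lambda>s. deriv \<eta> s * B s) = - time_int T (\<lambda>s. deriv (deriv \<eta>) s * A s)"
      unfolding A_def B_def
      by (rule weak_exp_moment[OF weak w wt smooth_class_deriv[OF \<eta>] ab supp1])
    moreover have sub': "{a..b} \<subseteq> Ioo_T T"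
      using ab by (auto simp: Ioo_T_def) (metis ereal_less_eq(3) order_le_less_trans)
    note cont = continuous_on_subset[OF A sub'] continuous_on_subset[OF N sub']
      smooth_class_continuous_on[OF \<eta>, of "{a..b}"]
      smooth_class_continuous_on[OF smooth_class_deriv[OF smooth_class_deriv[OF \<eta>]], of "{a..b}"]
    have "time_int T (\<lambda>s. \<eta> s * N s) = integral {a..b} (\<lambda>s. \<eta> s * N s)"
      using ab supp0 by (intro time_int_eq_integral continuous_intros cont) auto
    moreover have "time_int T (\<lambda>s. (deriv (deriv \<eta>) s - (\<omega> \<bullet> \<omega>) * \<eta> s) * A s) =
        integral {a..b} (\<lambda>s. (deriv (deriv \<eta>) s - (\<omega> \<bullet> \<omega>) * \<eta> s) * A s)"
      using ab supp0 supp2 by (intro time_int_eq_integral continuous_intros cont) auto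
    moreover have "time_int T (\<lambda>s. \<eta> s * (N s + (\<omega> \<bullet> \<omega>) * A s)) =
        integral {a..b} (\<lambda>s. \<eta> s * (N s + (\<omega> \<bullet> \<omega>) * A s))"
      using ab supp0 by (intro time_int_eq_integral continuous_intros cont) auto
    moreover have "time_int T (\<lambda>s. deriv (deriv \<eta>) s * A s) =
        integral {a..b} (\<lambda>s. deriv (deriv \<eta>) s * A s)"
      using ab supp2 by (intro time_int_eq_integral continuous_intros cont) auto
    moreover have "integral {a..b} (\<lambda>s. \<eta> s * (N s + (\<omega> \<bullet> \<omega>) * A s)) -
        integral {a..b} (\<lambda>s. \<eta> s * N s) +
        integral {a..b} (\<lambda>s. (deriv (deriv \<eta>) s - (\<omega> \<bullet> \<omega>) * \<eta> s) * A s) =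
        integral {a..b} (\<lambda>s. \<eta> s * (N s + (\<omega> \<bullet> \<omega>) * A s) - \<eta> s * N s +
          (deriv (deriv \<eta>) s - (\<omega> \<bullet> \<omega>) * \<eta> s) * A s)"
      by (subst Henstock_Kurzweil_Integration.integral_add, (intro integrable_continuous_real continuous_intros cont)+,
          subst Henstock_Kurzweil_Integration.integral_diff, (intro integrable_continuous_real continuous_intros cont)+, simp)
    moreover have "(\<lambda>s. \<eta> s * (N s + (\<omega> \<bullet> \<omega>) * A s) - \<eta> s * N s +
          (deriv (deriv \<eta>) s - (\<omega> \<bullet> \<omega>) * \<eta> s) * A s) = (\<lambda>s. deriv (deriv \<eta>) s * A s)"
      by (simp add: fun_eq_iff algebra_simps)
    ultimately show "time_int T (\<lambda>s. \<eta> s * (N s + (\<omega> \<bullet> \<omega>) * A s)) = - time_int T (\<lambda>s. deriv \<eta> s * B s)"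
      by simp
  qed
  then show ?thesis unfolding A_def N_def B_def[abs_def] .
qed

section \<open>Plane waves on the light cone\<close>

text \<open>Hoelder's inequality for the measure with density \<open>k\<close>, at the price of the
  factor \<open>2 powr p\<close>.\<close>

lemma weighted_integral_powr_bound:
  fixes h k :: "'b \<Rightarrow> real"
  assumes "1 < p" "0 < C" and X: "0 \<le> X" "X \<le> (LINT x|M. h x * k x)"
    and k: "integrable M k" "\<And>x. 0 \<le> k x" "(LINT x|M. k x) \<le> C"
    and hk: "integrable M (\<lambda>x. \<bar>h x\<bar> powr p * k x)"
  shows "X powr p \<le> 2 powr p * C powr (p - 1) * (LINT x|M. \<bar>h x\<bar> powr p * k x)"
proof (cases "X = 0")
  case True
  have "0 \<le> (LINT x|M. \<bar>h x\<bar> powr p * k x)"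
    using k(2) by (intro integral_nonneg_AE) auto
  then show ?thesis using True by simp
next
  case False
  define I where "I = (LINT x|M. \<bar>h x\<bar> powr p * k x)"
  \<comment> \<open>Chosen so that the second term of the Young inequality integrates to at most
    \<open>C / \<mu> = X / 2\<close>, which the left side absorbs.\<close>
  define \<mu> where "\<mu> = 2 * C / X"
  have X0: "0 < X" using X False by simp
  have \<mu>: "0 < \<mu>" using assms X0 by (simp add: \<mu>_def)
  \<comment> \<open>Young's inequality in its crudest form: either \<open>a \<mu> \<le> 1\<close>, or \<open>1 \<le> (a \<mu>) powr (p - 1)\<close>.\<close>
  have young: "a \<le> \<mu> powr (p - 1) * \<bar>a\<bar> powr p + 1 / \<mu>" for a
  proof (cases "a * \<mu> \<le> 1")
    case True
    then have "a \<le> 1 / \<mu>" using \<mu> by (simp add: field_simps)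
    then show ?thesis by (simp add: add_increasing)
  next
    case False
    then have a: "0 < a" using \<mu> by (smt (verit) mult_nonpos_nonneg)
    have "a * 1 \<le> a * (a * \<mu>) powr (p - 1)"
      using False a assms by (intro mult_left_mono ge_one_powr_ge_zero) auto
    also have "\<dots> = \<mu> powr (p - 1) * (a powr 1 * a powr (p - 1))"
      using a \<mu> by (simp add: powr_mult)
    also have "a powr 1 * a powr (p - 1) = \<bar>a\<bar> powr p"
      using a by (simp only: powr_add[symmetric]) simp
    finally show ?thesis using \<mu> by (simp add: add_increasing2)
  qed
  \<comment> \<open>A non-integrable function has integral zero by convention, which contradicts
    \<open>0 < X\<close>.\<close>
  have "integrable M (\<lambda>x. h x * k x)"
    using X X0 not_integrable_integral_eq by fastforce
  then have "(LINT x|M. h x * k x) \<le> (LINT x|M. \<mu> powr (p - 1) * (\<bar>h x\<bar> powr p * k x) + k x / \<mu>)"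
  proof (rule integral_mono)
    show "integrable M (\<lambda>x. \<mu> powr (p - 1) * (\<bar>h x\<bar> powr p * k x) + k x / \<mu>)"
      using k hk by simp
    show "h x * k x \<le> \<mu> powr (p - 1) * (\<bar>h x\<bar> powr p * k x) + k x / \<mu>" for x
      using mult_right_mono[OF young[of "h x"] k(2)[of x]] by (simp add: algebra_simps)
  qed
  also have "\<dots> = \<mu> powr (p - 1) * I + (LINT x|M. k x) / \<mu>"
    using k hk by (simp add: I_def)
  also have "\<dots> \<le> \<mu> powr (p - 1) * I + C / \<mu>"
    using k(3) \<mu> by (simp add: divide_right_mono)
  also have "C / \<mu> = X / 2" using assms X0 by (simp add: \<mu>_def)
  finally have "X \<le> 2 * (\<mu> powr (p - 1) * I)" using X by simp
  then have "X * X powr (p - 1) \<le> 2 * (\<mu> powr (p - 1) * I) * X powr (p - 1)"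
    by (intro mult_right_mono) auto
  also have "X * X powr (p - 1) = X powr 1 * X powr (p - 1)" using X0 by simp
  also have "\<dots> = X powr p" by (simp only: powr_add[symmetric]) simp
  also have "2 * (\<mu> powr (p - 1) * I) * X powr (p - 1) = 2 * (\<mu> * X) powr (p - 1) * I"
    using \<mu> X0 by (simp add: powr_mult)
  also have "\<mu> * X = 2 * C" using X0 by (simp add: \<mu>_def)
  also have "2 * (2 * C) powr (p - 1) * I = (2 powr 1 * 2 powr (p - 1)) * C powr (p - 1) * I"
    using assms by (simp add: powr_mult)
  also have "\<dots> = 2 powr p * C powr (p - 1) * I" by (simp only: powr_add[symmetric]) simp
  finally show ?thesis by (simp add: I_def)
qed

section \<open>Gaussian bound for the mass of one plane wave\<close>

lemma nn_integral_gaussian: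
  assumes "0 < v"
  shows "(\<integral>\<^sup>+y. ennreal (exp (- (y - m)\<^sup>2 / (2 * v))) \<partial>lborel) = ennreal (sqrt (2 * pi * v))"
proof -
  have "ennreal (exp (- (y - m)\<^sup>2 / (2 * v))) =
      ennreal (sqrt (2 * pi * v)) * ennreal (normal_density m (sqrt v) y)" for y
    using assms by (subst ennreal_mult[symmetric]) (auto simp: normal_density_def)
  moreover have "(\<integral>\<^sup>+y. ennreal (normal_density m (sqrt v) y) \<partial>lborel) = 1"
    using assms by (subst nn_integral_eq_integral) auto
  ultimately show ?thesis
    by (simp add: nn_integral_cmult)
qed

text \<open>Along one coordinate the phase is an affine function \<open>d - c * y\<close>. The
  indicator records that it is non-negative on the ball, which makes the half-line integral
  finite.\<close>

lemma nn_integral_exp_affine: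
  assumes "0 < c"
  shows "(\<integral>\<^sup>+y. ennreal (exp (- (d - c * y) / 2)) * indicator {0..} (d - c * y) \<partial>lborel) = ennreal (2 / c)"
proof -
  have "(\<integral>\<^sup>+y. ennreal (exp (- (d - c * y) / 2)) * indicator {0..} (d - c * y) \<partial>lborel) =
      ennreal \<bar>- 1 / c\<bar> * (\<integral>\<^sup>+y. ennreal (exp (- (d - c * (d / c + (- 1 / c) * y)) / 2)) *
        indicator {0..} (d - c * (d / c + (- 1 / c) * y)) \<partial>lborel)"
    using assms by (intro nn_integral_real_affine) auto
  also have "\<dots> = ennreal (1 / c) * (\<integral>\<^sup>+y. ennreal (exp (- y / 2)) * indicator {0..} y \<partial>lborel)"
    using assms by (simp add: field_simps)
  also have "(\<integral>\<^sup>+y. ennreal (exp (- y / 2)) * indicator {0..} y \<partial>lborel) =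
      (\<integral>\<^sup>+y. ennreal 2 * ennreal (exponential_density (1 / 2) y) \<partial>lborel)"
    by (intro nn_integral_cong)
      (auto simp: exponential_density_def indicator_def ennreal_mult[symmetric] simp del: ennreal_numeral)
  also have "\<dots> = ennreal 2 * (\<integral>\<^sup>+y. ennreal (exponential_density (1 / 2) y) \<partial>lborel)"
    by (rule nn_integral_cmult) simp
  also have "(\<integral>\<^sup>+y. ennreal (exponential_density (1 / 2) y) \<partial>lborel) = 1"
    using nn_integral_erlang_ith_moment[of "1 / 2" 0 0] by simp
  finally show ?thesis
    using assms by (simp add: ennreal_mult[symmetric] del: ennreal_numeral)
qed

text \<open>On the ball of radius \<open>R\<close> the phase \<open>R - \<omega> \<bullet> x\<close> controls the square distance to \<open>R \<omega>\<close>;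
  one coordinate is discarded because it is not Gaussian but exponentially localised.\<close>

lemma phase_lower_bound:
  fixes x \<omega> :: "'a::euclidean_space"
  assumes "norm \<omega> = 1" "norm x \<le> R"
  shows "(\<Sum>b\<in>Basis - {b0}. (x \<bullet> b - R * (\<omega> \<bullet> b))\<^sup>2) \<le> 2 * R * (R - \<omega> \<bullet> x)"
proof -
  have "(\<Sum>b\<in>Basis - {b0}. (x \<bullet> b - R * (\<omega> \<bullet> b))\<^sup>2) \<le> (\<Sum>b\<in>Basis. (x \<bullet> b - R * (\<omega> \<bullet> b))\<^sup>2)"
    by (intro sum_mono2) auto
  also have "\<dots> = (x - R *\<^sub>R \<omega>) \<bullet> (x - R *\<^sub>R \<omega>)"
    by (subst euclidean_inner) (simp add: inner_diff_left power2_eq_square)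
  also have "\<dots> = x \<bullet> x + R * R * (\<omega> \<bullet> \<omega>) - 2 * R * (\<omega> \<bullet> x)"
    by (simp add: inner_diff_left inner_diff_right inner_commute algebra_simps)
  also have "x \<bullet> x \<le> R * R"
    using mult_mono[OF assms(2,2)] norm_ge_zero[of x] assms(2)
    by (simp add: dot_square_norm power2_eq_square)
  also have "\<omega> \<bullet> \<omega> = 1" using assms(1) by (simp add: dot_square_norm)
  finally show ?thesis by (simp add: algebra_simps)
qed

lemma inner_le_radius:
  fixes x \<omega> :: "'a::euclidean_space"
  assumes "norm \<omega> = 1" "norm x \<le> R"
  shows "\<omega> \<bullet> x \<le> R"
  using norm_cauchy_schwarz[of \<omega> x] assms by simp

text \<open>Half of the phase \<open>R - \<omega> \<bullet> x\<close> pays for Gaussians of variance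
  \<open>2 * R\<close> in the coordinates other than \<open>b0\<close>, and the other half for
  exponential decay along \<open>b0\<close>, where the slope is at least \<open>1 / 2\<close>. A
  Gaussian in all coordinates would cost one factor \<open>sqrt R\<close> too many.\<close>

lemma nn_integral_plane_wave_le:
  fixes \<omega> b0 :: "'a::euclidean_space"
  assumes \<omega>: "norm \<omega> = 1" and b0: "b0 \<in> Basis" "1 / 2 \<le> \<omega> \<bullet> b0" and R: "1 \<le> R"
  shows "(\<integral>\<^sup>+x. ennreal (exp (\<omega> \<bullet> x - (R - 1))) * indicator (cball 0 R) x \<partial>lborel)
    \<le> ennreal (4 * exp 1 * sqrt (4 * pi * R) ^ (DIM('a) - 1))"
proof -
  interpret product_sigma_finite "\<lambda>_::'a. lborel :: real measure"
    by standard
  let ?B = "Basis - {b0}"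
  let ?x = "\<lambda>f::'a \<Rightarrow> real. \<Sum>b\<in>Basis. f b *\<^sub>R b"
  let ?F = "\<lambda>x::'a. ennreal (exp (\<omega> \<bullet> x - (R - 1))) * indicator (cball 0 R) x"
  let ?g = "\<lambda>s::real. ennreal (exp (- s / 2)) * indicator {0..} s"
  let ?\<gamma> = "\<lambda>b y. ennreal (exp (- (y - R * (\<omega> \<bullet> b))\<^sup>2 / (2 * (2 * R))))"
  have Basis: "insert b0 ?B = Basis" using b0 by auto
  have [measurable]: "cball (0::'a) R \<in> sets borel" by simp
  have F_meas[measurable]: "?F \<in> borel_measurable borel"
    by measurable
  have le: "?F x \<le> ennreal (exp 1) * ?g (R - \<omega> \<bullet> x) * (\<Prod>b\<in>?B. ?\<gamma> b (x \<bullet> b))" for x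
  proof (cases "norm x \<le> R")
    case True
    have "(\<Sum>b\<in>?B. (x \<bullet> b - R * (\<omega> \<bullet> b))\<^sup>2) / (4 * R) \<le> (R - \<omega> \<bullet> x) / 2"
      using phase_lower_bound[OF \<omega> True, of b0] R by (simp add: field_simps)
    then have "exp (\<omega> \<bullet> x - (R - 1)) \<le>
        exp (1 + (- (R - \<omega> \<bullet> x) / 2) + - ((\<Sum>b\<in>?B. (x \<bullet> b - R * (\<omega> \<bullet> b))\<^sup>2) / (4 * R)))"
      by (subst exp_le_cancel_iff) (simp add: field_simps)
    also have "\<dots> = exp 1 * exp (- (R - \<omega> \<bullet> x) / 2) *
        (\<Prod>b\<in>?B. exp (- (x \<bullet> b - R * (\<omega> \<bullet> b))\<^sup>2 / (2 * (2 * R))))"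
      by (simp only: exp_add exp_sum[OF finite_Diff[OF finite_Basis], symmetric] sum_divide_distrib sum_negf[symmetric]
          minus_divide_left) simp
    finally have "ennreal (exp (\<omega> \<bullet> x - (R - 1))) \<le> ennreal (exp 1 * exp (- (R - \<omega> \<bullet> x) / 2) *
        (\<Prod>b\<in>?B. exp (- (x \<bullet> b - R * (\<omega> \<bullet> b))\<^sup>2 / (2 * (2 * R)))))"
      by (intro ennreal_leI)
    also have "\<dots> = ennreal (exp 1) * ennreal (exp (- (R - \<omega> \<bullet> x) / 2)) * (\<Prod>b\<in>?B. ?\<gamma> b (x \<bullet> b))"
      by (simp add: ennreal_mult prod_ennreal prod_nonneg)
    finally show ?thesis
      using True inner_le_radius[OF \<omega> True] by simp
  qed simp
  have "(\<integral>\<^sup>+x. ?F x \<partial>lborel) = (\<integral>\<^sup>+f. ?F (?x f) \<partial>(\<Pi>\<^sub>M b\<in>Basis. lborel))"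
    by (subst lborel_eq, subst nn_integral_distr[where f = ?F])
      (auto intro: F_meas)
  also have "\<dots> = (\<integral>\<^sup>+f. ?F (?x f) \<partial>(\<Pi>\<^sub>M b\<in>insert b0 ?B. lborel))"
    by (simp only: Basis)
  \<comment> \<open>The coordinate \<open>b0\<close> is integrated innermost: for fixed other
    coordinates the Gaussians are constants and the phase is affine in \<open>y\<close>.\<close>
  also have "\<dots> = (\<integral>\<^sup>+f. (\<integral>\<^sup>+y. ?F (?x (f(b0 := y))) \<partial>lborel) \<partial>(\<Pi>\<^sub>M b\<in>?B. lborel))"
  proof (rule product_nn_integral_insert)
    show "(\<lambda>f. ?F (?x f)) \<in> borel_measurable (\<Pi>\<^sub>M b\<in>insert b0 ?B. lborel)"
      unfolding Basis by measurable
  qed auto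
  also have "\<dots> \<le> (\<integral>\<^sup>+f. ennreal (4 * exp 1) * (\<Prod>b\<in>?B. ?\<gamma> b (f b)) \<partial>(\<Pi>\<^sub>M b\<in>?B. lborel))"
  proof (rule nn_integral_mono)
    fix f :: "'a \<Rightarrow> real"
    define d where "d = R - (\<Sum>b\<in>?B. f b * (\<omega> \<bullet> b))"
    have coord: "?x (f(b0 := y)) \<bullet> b = f b" if "b \<in> ?B" for b y
      using that by (subst inner_sum_left_Basis) auto
    have inner: "R - \<omega> \<bullet> ?x (f(b0 := y)) = d - (\<omega> \<bullet> b0) * y" for y
    proof -
      have "\<omega> \<bullet> ?x (f(b0 := y)) = (\<Sum>b\<in>insert b0 ?B. (f(b0 := y)) b * (\<omega> \<bullet> b))"
        unfolding Basis by (simp add: inner_sum_right)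
      also have "\<dots> = y * (\<omega> \<bullet> b0) + (\<Sum>b\<in>?B. f b * (\<omega> \<bullet> b))"
        by (subst sum.insert) (auto intro!: sum.cong)
      finally show ?thesis by (simp add: d_def)
    qed
    have "(\<integral>\<^sup>+y. ?F (?x (f(b0 := y))) \<partial>lborel) \<le>
        (\<integral>\<^sup>+y. (ennreal (exp 1) * (\<Prod>b\<in>?B. ?\<gamma> b (f b))) * ?g (d - (\<omega> \<bullet> b0) * y) \<partial>lborel)"
    proof (rule nn_integral_mono)
      fix y
      have "?F (?x (f(b0 := y))) \<le> ennreal (exp 1) * ?g (d - (\<omega> \<bullet> b0) * y) *
          (\<Prod>b\<in>?B. ?\<gamma> b (?x (f(b0 := y)) \<bullet> b))"
        using le[of "?x (f(b0 := y))"] unfolding inner .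
      also have "(\<Prod>b\<in>?B. ?\<gamma> b (?x (f(b0 := y)) \<bullet> b)) = (\<Prod>b\<in>?B. ?\<gamma> b (f b))"
        by (intro prod.cong refl, subst coord) auto
      finally show "?F (?x (f(b0 := y))) \<le>
          (ennreal (exp 1) * (\<Prod>b\<in>?B. ?\<gamma> b (f b))) * ?g (d - (\<omega> \<bullet> b0) * y)"
        by (simp only: mult_ac)
    qed
    also have "\<dots> = (ennreal (exp 1) * (\<Prod>b\<in>?B. ?\<gamma> b (f b))) *
        (\<integral>\<^sup>+y. ?g (d - (\<omega> \<bullet> b0) * y) \<partial>lborel)"
      by (rule nn_integral_cmult) measurable
    also have "(\<integral>\<^sup>+y. ?g (d - (\<omega> \<bullet> b0) * y) \<partial>lborel) = ennreal (2 / (\<omega> \<bullet> b0))"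
      using b0 by (intro nn_integral_exp_affine) auto
    also have "\<dots> \<le> ennreal 4"
      using b0 by (intro ennreal_leI) (auto simp: field_simps)
    finally have "(\<integral>\<^sup>+y. ?F (?x (f(b0 := y))) \<partial>lborel) \<le>
        ennreal (exp 1) * (\<Prod>b\<in>?B. ?\<gamma> b (f b)) * ennreal 4"
      by (simp add: mult_left_mono)
    also have "\<dots> = (ennreal 4 * ennreal (exp 1)) * (\<Prod>b\<in>?B. ?\<gamma> b (f b))"
      by (simp only: mult_ac)
    also have "ennreal 4 * ennreal (exp 1) = ennreal (4 * exp 1)"
      by (rule ennreal_mult[symmetric]) auto
    finally show "(\<integral>\<^sup>+y. ?F (?x (f(b0 := y))) \<partial>lborel) \<le> ennreal (4 * exp 1) * (\<Prod>b\<in>?B. ?\<gamma> b (f b))" .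
  qed
  also have "\<dots> = ennreal (4 * exp 1) * (\<integral>\<^sup>+f. (\<Prod>b\<in>?B. ?\<gamma> b (f b)) \<partial>(\<Pi>\<^sub>M b\<in>?B. lborel))"
    by (rule nn_integral_cmult) measurable
  also have "(\<integral>\<^sup>+f. (\<Prod>b\<in>?B. ?\<gamma> b (f b)) \<partial>(\<Pi>\<^sub>M b\<in>?B. lborel)) = (\<Prod>b\<in>?B. \<integral>\<^sup>+y. ?\<gamma> b y \<partial>lborel)"
    by (rule product_nn_integral_prod) auto
  also have "\<dots> = (\<Prod>b\<in>?B. ennreal (sqrt (4 * pi * R)))"
    using R by (subst nn_integral_gaussian) (auto simp: mult_ac)
  also have "\<dots> = ennreal (sqrt (4 * pi * R) ^ (DIM('a) - 1))"
    using R b0 by (simp add: ennreal_power)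
  also have "ennreal (4 * exp 1) * \<dots> = ennreal (4 * exp 1 * sqrt (4 * pi * R) ^ (DIM('a) - 1))"
    using R by (intro ennreal_mult[symmetric]) auto
  finally show ?thesis .
qed

text \<open>The cap of directions around \<open>b0\<close> is a graph over the hyperplane orthogonal
  to \<open>b0\<close>, and this is its parametrisation. The component of \<open>z\<close> along
  \<open>b0\<close> is ignored, so that the cap can be averaged with Lebesgue measure on a full ball
  and no surface measure is needed.\<close>

definition lift_direction :: "'a::euclidean_space \<Rightarrow> 'a \<Rightarrow> 'a" where
  "lift_direction b0 z = (z - (z \<bullet> b0) *\<^sub>R b0) + sqrt (1 - (norm (z - (z \<bullet> b0) *\<^sub>R b0))\<^sup>2) *\<^sub>R b0"

lemma lift_direction_measurable: "lift_direction b0 \<in> borel_measurable borel"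
  unfolding lift_direction_def[abs_def] by measurable

lemma lift_direction:
  fixes b0 z :: "'a::euclidean_space"
  assumes b0: "b0 \<in> Basis" and z: "norm z < 1 / 2"
  shows "norm (lift_direction b0 z) = 1" "1 / 2 \<le> lift_direction b0 z \<bullet> b0"
    "b \<in> Basis - {b0} \<Longrightarrow> lift_direction b0 z \<bullet> b = z \<bullet> b"
proof -
  define y where "y = z - (z \<bullet> b0) *\<^sub>R b0"
  have b00: "b0 \<bullet> b0 = 1" using b0 by simp
  have y0: "y \<bullet> b0 = 0" using b00 by (simp add: y_def inner_diff_left)
  have "(norm y)\<^sup>2 = (norm z)\<^sup>2 - (z \<bullet> b0)\<^sup>2"
    unfolding power2_norm_eq_inner y_def
    using b00 by (simp add: inner_diff_left inner_diff_right inner_commute power2_eq_square)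
  also have "\<dots> \<le> (norm z)\<^sup>2" by simp
  also have "\<dots> \<le> (1 / 2)\<^sup>2" using z by (intro power_mono) auto
  finally have y_le: "(norm y)\<^sup>2 \<le> 1 / 4" by (simp add: power2_eq_square)
  define s where "s = sqrt (1 - (norm y)\<^sup>2)"
  have s2: "s * s = 1 - (norm y)\<^sup>2" using y_le by (simp add: s_def)
  have "sqrt (1 / 4) \<le> s" unfolding s_def using y_le by (intro real_sqrt_le_mono) simp
  moreover have "sqrt (1 / 4) = (1 / 2 :: real)" by (simp add: real_sqrt_divide)
  ultimately have s: "1 / 2 \<le> s" by simp
  have eq: "lift_direction b0 z = y + s *\<^sub>R b0" by (simp add: lift_direction_def s_def y_def)
  have "(norm (lift_direction b0 z))\<^sup>2 = 1"
    using y0 b00 s2 unfolding eq power2_norm_eq_inner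
    by (simp add: inner_add_left inner_add_right inner_commute)
  then show "norm (lift_direction b0 z) = 1"
    using norm_ge_zero[of "lift_direction b0 z"] by (simp add: power2_eq_1_iff)
  show "1 / 2 \<le> lift_direction b0 z \<bullet> b0"
    unfolding eq using y0 b00 s by (simp add: inner_add_left)
  show "lift_direction b0 z \<bullet> b = z \<bullet> b" if "b \<in> Basis - {b0}"
    using that b0 inner_not_same_Basis[of b0 b]
    by (auto simp: lift_direction_def inner_add_left inner_diff_left)
qed

text \<open>The same phase inequality, read for fixed \<open>x\<close>: each coordinate of the
  direction other than \<open>b0\<close> is concentrated near \<open>(x \<bullet> b) / R\<close>
  with variance \<open>1 / R\<close>. The idle coordinate of \<open>z\<close> contributes only the
  length one of \<open>{-1/2..1/2}\<close>.\<close>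

lemma nn_integral_direction_average_le:
  fixes x b0 :: "'a::euclidean_space"
  assumes b0: "b0 \<in> Basis" and R: "1 \<le> R" and x: "norm x \<le> R"
  shows "(\<integral>\<^sup>+z. indicator (ball 0 (1 / 2)) z * ennreal (exp (lift_direction b0 z \<bullet> x - (R - 1))) \<partial>lborel)
    \<le> ennreal (exp 1 * sqrt (2 * pi / R) ^ (DIM('a) - 1))"
proof -
  let ?B = "Basis - {b0}"
  define \<phi> :: "'a \<Rightarrow> real \<Rightarrow> ennreal" where
    "\<phi> b y = (if b = b0 then indicator {-1/2..1/2} y
      else ennreal (exp (- (y - (x \<bullet> b) / R)\<^sup>2 / (2 * (1 / R)))))" for b y
  have [measurable]: "\<phi> b \<in> borel_measurable borel" for b
    by (cases "b = b0") (auto simp: \<phi>_def[abs_def])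
  have Basis: "insert b0 ?B = Basis" using b0 by auto
  have "indicator (ball 0 (1 / 2)) z * ennreal (exp (lift_direction b0 z \<bullet> x - (R - 1))) \<le>
      ennreal (exp 1) * (\<Prod>b\<in>Basis. \<phi> b (z \<bullet> b))" for z
  proof (cases "norm z < 1 / 2")
    case True
    let ?\<omega> = "lift_direction b0 z"
    note \<omega> = lift_direction[OF b0 True]
    have "(\<Sum>b\<in>?B. (z \<bullet> b - (x \<bullet> b) / R)\<^sup>2 / (2 * (1 / R))) =
        (\<Sum>b\<in>?B. (x \<bullet> b - R * (?\<omega> \<bullet> b))\<^sup>2) / (2 * R)"
      unfolding sum_divide_distrib
      using R by (intro sum.cong refl) (simp add: \<omega>(3) field_simps power2_eq_square)
    also have "\<dots> \<le> R - ?\<omega> \<bullet> x"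
      using phase_lower_bound[OF \<omega>(1) x, of b0] R by (simp add: field_simps)
    finally have "exp (?\<omega> \<bullet> x - (R - 1)) \<le> exp (1 + - (\<Sum>b\<in>?B. (z \<bullet> b - (x \<bullet> b) / R)\<^sup>2 / (2 * (1 / R))))"
      by (subst exp_le_cancel_iff) simp
    also have "\<dots> = exp 1 * (\<Prod>b\<in>?B. exp (- (z \<bullet> b - (x \<bullet> b) / R)\<^sup>2 / (2 * (1 / R))))"
      by (simp only: exp_add exp_sum[OF finite_Diff[OF finite_Basis], symmetric] sum_negf[symmetric]
          minus_divide_left)
    finally have "ennreal (exp (?\<omega> \<bullet> x - (R - 1))) \<le>
        ennreal (exp 1 * (\<Prod>b\<in>?B. exp (- (z \<bullet> b - (x \<bullet> b) / R)\<^sup>2 / (2 * (1 / R)))))"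
      by (intro ennreal_leI)
    also have "\<dots> = ennreal (exp 1) * (\<Prod>b\<in>?B. \<phi> b (z \<bullet> b))"
      by (simp add: ennreal_mult prod_ennreal[symmetric] prod_nonneg \<phi>_def)
    also have "(\<Prod>b\<in>?B. \<phi> b (z \<bullet> b)) = (\<Prod>b\<in>insert b0 ?B. \<phi> b (z \<bullet> b))"
    proof -
      have "\<bar>z \<bullet> b0\<bar> \<le> 1 / 2" using Basis_le_norm[OF b0, of z] True by simp
      then have "\<phi> b0 (z \<bullet> b0) = 1" by (auto simp: \<phi>_def abs_le_iff indicator_def)
      then show ?thesis by (subst prod.insert) auto
    qed
    finally show ?thesis using True unfolding Basis by simp
  qed simp
  then have "(\<integral>\<^sup>+z. indicator (ball 0 (1 / 2)) z * ennreal (exp (lift_direction b0 z \<bullet> x - (R - 1))) \<partial>lborel)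
      \<le> (\<integral>\<^sup>+z. ennreal (exp 1) * (\<Prod>b\<in>Basis. \<phi> b (z \<bullet> b)) \<partial>lborel)"
    by (intro nn_integral_mono)
  also have "\<dots> = ennreal (exp 1) * (\<integral>\<^sup>+z. (\<Prod>b\<in>Basis. \<phi> b (z \<bullet> b)) \<partial>lborel)"
    by (rule nn_integral_cmult) measurable
  also have "(\<integral>\<^sup>+z. (\<Prod>b\<in>Basis. \<phi> b (z \<bullet> b)) \<partial>lborel) = (\<Prod>b\<in>insert b0 ?B. \<integral>\<^sup>+y. \<phi> b y \<partial>lborel)"
    unfolding Basis by (rule nn_integral_lborel_prod) auto
  also have "\<dots> = (\<integral>\<^sup>+y. \<phi> b0 y \<partial>lborel) * (\<Prod>b\<in>?B. \<integral>\<^sup>+y. \<phi> b y \<partial>lborel)"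
    by (rule prod.insert) auto
  also have "(\<integral>\<^sup>+y. \<phi> b0 y \<partial>lborel) = 1"
    by (simp add: \<phi>_def)
  also have "(\<Prod>b\<in>?B. \<integral>\<^sup>+y. \<phi> b y \<partial>lborel) = (\<Prod>b\<in>?B. ennreal (sqrt (2 * pi / R)))"
  proof (rule prod.cong[OF refl])
    fix b assume "b \<in> ?B"
    then have "(\<integral>\<^sup>+y. \<phi> b y \<partial>lborel) =
        (\<integral>\<^sup>+y. ennreal (exp (- (y - (x \<bullet> b) / R)\<^sup>2 / (2 * (1 / R)))) \<partial>lborel)"
      unfolding \<phi>_def by (intro nn_integral_cong) simp
    also have "\<dots> = ennreal (sqrt (2 * pi * (1 / R)))"
      using R by (intro nn_integral_gaussian) auto
    finally show "(\<integral>\<^sup>+y. \<phi> b y \<partial>lborel) = ennreal (sqrt (2 * pi / R))" by simp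
  qed
  also have "\<dots> = ennreal (sqrt (2 * pi / R) ^ (DIM('a) - 1))"
    using R b0 by (simp add: ennreal_power)
  also have "ennreal (exp 1) * (1 * \<dots>) = ennreal (exp 1 * sqrt (2 * pi / R) ^ (DIM('a) - 1))"
    using R by (simp add: ennreal_mult)
  finally show ?thesis .
qed

text \<open>Hoelder with the weight of each plane wave yields the mass to the power
  \<open>p - 1\<close>; integrating the resulting inequalities over the cap and exchanging the
  integrals replaces the weight by its average, which is small uniformly in
  \<open>x\<close>.\<close>

lemma plane_wave_average_bound:
  fixes h :: "'a::euclidean_space \<Rightarrow> real"
  assumes p: "1 < p" and t: "0 \<le> t"
    and h: "h \<in> borel_measurable lebesgue" "AE x in lebesgue. norm x > t + 1 \<longrightarrow> h x = 0"
      "integrable lebesgue (\<lambda>x. \<bar>h x\<bar> powr p)"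
    and X: "0 \<le> X" "\<And>\<omega>. norm \<omega> = 1 \<Longrightarrow> X \<le> exp (- t) * exp_moment \<omega> h"
  shows "measure lborel (ball (0::'a) (1 / 2)) * X powr p \<le>
    2 powr p * (4 * exp 1 * sqrt (4 * pi * (t + 1)) ^ (DIM('a) - 1)) powr (p - 1) *
    ((exp 1 * sqrt (2 * pi / (t + 1)) ^ (DIM('a) - 1)) * (LINT x|lebesgue. \<bar>h x\<bar> powr p))"
proof -
  define R where "R = t + 1"
  have R: "1 \<le> R" using t by (simp add: R_def)
  obtain b0 :: 'a where b0: "b0 \<in> Basis" using nonempty_Basis by blast
  define M where "M = 4 * exp 1 * sqrt (4 * pi * R) ^ (DIM('a) - 1)"
  have M: "0 < M" using R by (simp add: M_def)
  define A where "A = exp 1 * sqrt (2 * pi / R) ^ (DIM('a) - 1)"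
  have A: "0 \<le> A" using R by (simp add: A_def)
  define K where "K = 2 powr p * M powr (p - 1)"
  have K: "0 \<le> K" by (simp add: K_def)
  define H where "H = (LINT x|lebesgue. \<bar>h x\<bar> powr p)"
  have H: "0 \<le> H" unfolding H_def by (intro integral_nonneg_AE) auto
  have hp: "(\<lambda>x. ennreal (\<bar>h x\<bar> powr p)) \<in> borel_measurable lebesgue"
    using h(1) by measurable
  \<comment> \<open>\<open>h\<close> is only Lebesgue measurable, while exchanging the two integrals
    needs a jointly Borel measurable integrand; \<open>Q\<close> is a Borel representative.\<close>
  then obtain Q where Q[measurable]: "Q \<in> borel_measurable lborel"
    and hQ: "AE x in lborel. ennreal (\<bar>h x\<bar> powr p) = Q x"
    using completion_ex_borel_measurable[OF hp] by auto
  have "(\<integral>\<^sup>+x. Q x \<partial>lborel) = (\<integral>\<^sup>+x. ennreal (\<bar>h x\<bar> powr p) \<partial>lborel)"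
    using hQ by (intro nn_integral_cong_AE) auto
  also have "\<dots> = (\<integral>\<^sup>+x. ennreal (\<bar>h x\<bar> powr p) \<partial>lebesgue)"
    by (rule nn_integral_completion[symmetric])
  also have "\<dots> = ennreal H"
    unfolding H_def by (rule nn_integral_eq_integral[OF h(3)]) auto
  finally have QH: "(\<integral>\<^sup>+x. Q x \<partial>lborel) = ennreal H" .
  let ?\<omega> = "lift_direction b0"
  let ?k = "\<lambda>z x. exp (?\<omega> z \<bullet> x - (R - 1)) * indicator (cball 0 R) x"
  have pointwise: "ennreal (X powr p) \<le> ennreal K * (\<integral>\<^sup>+x. Q x * ennreal (?k z x) \<partial>lborel)"
    if z: "norm z < 1 / 2" for z
  proof -
    note \<omega> = lift_direction(1,2)[OF b0 z]
    have k_eq: "?k z x = exp (- t) * (exp (?\<omega> z \<bullet> x) * indicator (cball 0 R) x)" for x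
      by (simp add: R_def exp_diff exp_minus field_simps)
    have k_meas: "?k z \<in> borel_measurable lebesgue"
      unfolding k_eq by (intro borel_measurable_times borel_measurable_const truncated_exp_bounds(1))
    have k_bd: "\<bar>?k z x\<bar> \<le> exp (- t) * exp (norm (?\<omega> z) * R)" for x
      using truncated_exp_bounds(2)[of "?\<omega> z" x R] unfolding k_eq by (simp add: abs_mult)
    have "(\<integral>\<^sup>+x. ennreal (?k z x) \<partial>lebesgue) = (\<integral>\<^sup>+x. ennreal (exp (?\<omega> z \<bullet> x - (R - 1))) * indicator (cball 0 R) x \<partial>lborel)"
      unfolding nn_integral_completion by (intro nn_integral_cong) (auto simp: indicator_def)
    also have "\<dots> \<le> ennreal M"
      unfolding M_def by (rule nn_integral_plane_wave_le[OF \<omega>(1) b0 \<omega>(2) R])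
    finally have nn: "(\<integral>\<^sup>+x. ennreal (?k z x) \<partial>lebesgue) \<le> ennreal M" .
    then have k_int: "integrable lebesgue (?k z)"
      using k_meas by (intro integrableI_nonneg) (auto intro: order_le_less_trans[OF nn])
    have "ennreal (LINT x|lebesgue. ?k z x) \<le> ennreal M"
      using nn nn_integral_eq_integral[OF k_int] by simp
    then have k_le: "(LINT x|lebesgue. ?k z x) \<le> M" using M by simp
    have "X \<le> exp (- t) * exp_moment (?\<omega> z) h" by (rule X(2)[OF \<omega>(1)])
    also have "\<dots> = (LINT x|lebesgue. h x * ?k z x)"
      unfolding k_eq using exp_moment_truncate[OF h(1,2), of "?\<omega> z"]
      by (simp add: R_def mult.left_commute[of _ "exp (- t)"])
    finally have X_le: "X \<le> (LINT x|lebesgue. h x * ?k z x)" .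
    have hk: "integrable lebesgue (\<lambda>x. \<bar>h x\<bar> powr p * ?k z x)"
      by (rule integrable_mult_bounded[OF h(3) k_meas k_bd])
    have "X powr p \<le> K * (LINT x|lebesgue. \<bar>h x\<bar> powr p * ?k z x)"
      unfolding K_def
      by (rule weighted_integral_powr_bound[OF p M X(1) X_le k_int _ k_le hk]) simp
    then have "ennreal (X powr p) \<le> ennreal (K * (LINT x|lebesgue. \<bar>h x\<bar> powr p * ?k z x))"
      by (rule ennreal_leI)
    also have "\<dots> = ennreal K * ennreal (LINT x|lebesgue. \<bar>h x\<bar> powr p * ?k z x)"
      using K by (rule ennreal_mult')
    also have "ennreal (LINT x|lebesgue. \<bar>h x\<bar> powr p * ?k z x) =
        (\<integral>\<^sup>+x. ennreal (\<bar>h x\<bar> powr p * ?k z x) \<partial>lebesgue)"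
      by (rule nn_integral_eq_integral[OF hk, symmetric]) auto
    also have "\<dots> = (\<integral>\<^sup>+x. Q x * ennreal (?k z x) \<partial>lborel)"
      unfolding nn_integral_completion
      using hQ by (intro nn_integral_cong_AE) (auto simp: ennreal_mult elim: eventually_mono)
    finally show ?thesis .
  qed
  have [measurable]: "cball (0::'a) R \<in> sets borel" "ball (0::'a) (1 / 2) \<in> sets borel" by auto
  note lift_direction_measurable[measurable]
  let ?i = "indicator (ball (0::'a) (1 / 2)) :: 'a \<Rightarrow> ennreal"
  have "ennreal (X powr p) * emeasure lborel (ball (0::'a) (1 / 2)) = (\<integral>\<^sup>+z. ennreal (X powr p) * ?i z \<partial>lborel)"
    by (subst nn_integral_cmult_indicator) auto
  also have "\<dots> \<le> (\<integral>\<^sup>+z. ennreal K * (\<integral>\<^sup>+x. ?i z * (Q x * ennreal (?k z x)) \<partial>lborel) \<partial>lborel)"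
    using pointwise by (intro nn_integral_mono) (auto simp: indicator_def)
  also have "\<dots> = ennreal K * (\<integral>\<^sup>+z. (\<integral>\<^sup>+x. ?i z * (Q x * ennreal (?k z x)) \<partial>lborel) \<partial>lborel)"
    by (rule nn_integral_cmult) measurable
  also have "(\<integral>\<^sup>+z. (\<integral>\<^sup>+x. ?i z * (Q x * ennreal (?k z x)) \<partial>lborel) \<partial>lborel) =
      (\<integral>\<^sup>+x. (\<integral>\<^sup>+z. ?i z * (Q x * ennreal (?k z x)) \<partial>lborel) \<partial>lborel)"
    by (rule lborel_pair.Fubini') measurable
  \<comment> \<open>For fixed \<open>x\<close> the factor \<open>Q x\<close> leaves the integral
    over \<open>z\<close>, and what remains is the average of the waves at \<open>x\<close>.\<close>
  also have "\<dots> \<le> (\<integral>\<^sup>+x. ennreal A * Q x \<partial>lborel)"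
  proof (rule nn_integral_mono)
    fix x
    show "(\<integral>\<^sup>+z. ?i z * (Q x * ennreal (?k z x)) \<partial>lborel) \<le> ennreal A * Q x"
    proof (cases "norm x \<le> R")
      case True
      have "(\<integral>\<^sup>+z. ?i z * (Q x * ennreal (?k z x)) \<partial>lborel) =
          (\<integral>\<^sup>+z. Q x * (?i z * ennreal (exp (?\<omega> z \<bullet> x - (R - 1)))) \<partial>lborel)"
        using True by (intro nn_integral_cong) (auto simp: mult_ac)
      also have "\<dots> = Q x * (\<integral>\<^sup>+z. ?i z * ennreal (exp (?\<omega> z \<bullet> x - (R - 1))) \<partial>lborel)"
        by (rule nn_integral_cmult) measurable
      also have "\<dots> \<le> Q x * ennreal A"
        unfolding A_def by (intro mult_left_mono nn_integral_direction_average_le b0 R True) simp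
      finally show ?thesis by (simp add: mult.commute)
    qed simp
  qed
  also have "\<dots> = ennreal A * ennreal H"
    by (subst nn_integral_cmult) (auto simp: QH)
  finally have "ennreal (X powr p) * emeasure lborel (ball (0::'a) (1 / 2)) \<le> ennreal K * (ennreal A * ennreal H)"
    by (simp add: mult_left_mono)
  also have "\<dots> = ennreal (K * (A * H))"
    using K A H by (simp add: ennreal_mult)
  also have "emeasure lborel (ball (0::'a) (1 / 2)) = ennreal (measure lborel (ball (0::'a) (1 / 2)))"
    using emeasure_bounded_finite[OF bounded_ball, of "0::'a" "1 / 2"]
    by (intro emeasure_eq_ennreal_measure) auto
  also have "ennreal (X powr p) * \<dots> = ennreal (measure lborel (ball (0::'a) (1 / 2)) * X powr p)"
    by (simp add: ennreal_mult mult.commute)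
  finally have "measure lborel (ball (0::'a) (1 / 2)) * X powr p \<le> K * (A * H)"
    using K A H by (simp add: ennreal_le_iff)
  then show ?thesis by (simp add: K_def A_def H_def M_def R_def)
qed

lemma sqrt_power_eq_powr: "0 < y \<Longrightarrow> sqrt y ^ m = y powr (real m / 2)"
  by (simp add: powr_half_sqrt[symmetric] powr_realpow[symmetric] powr_powr)

text \<open>Collects the powers of \<open>t + 1\<close>. The constant is chosen before
  \<open>t\<close>, \<open>h\<close> and \<open>X\<close>, so it depends only on \<open>p\<close>
  and the dimension and not on the size of the data.\<close>

lemma powr_integral_lower_bound:
  assumes p: "1 < p"
  shows "\<exists>c>0. \<forall>t (h :: 'a::euclidean_space \<Rightarrow> real) X. 0 \<le> t \<longrightarrow> h \<in> borel_measurable lebesgue \<longrightarrow>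
    (AE x in lebesgue. norm x > t + 1 \<longrightarrow> h x = 0) \<longrightarrow> integrable lebesgue (\<lambda>x. \<bar>h x\<bar> powr p) \<longrightarrow>
    0 \<le> X \<longrightarrow> (\<forall>\<omega>. norm \<omega> = 1 \<longrightarrow> X \<le> exp (- t) * exp_moment \<omega> h) \<longrightarrow>
    c * X powr p * (t + 1) powr ((real DIM('a) - 1) * (1 - p / 2)) \<le> (LINT x|lebesgue. \<bar>h x\<bar> powr p)"
proof -
  define m where "m = real DIM('a) - 1"
  define vol where "vol = measure lborel (ball (0::'a) (1 / 2))"
  have vol: "0 < vol" unfolding vol_def using content_ball_pos[of "1 / 2" "0::'a"] by simp
  define K where "K = 2 powr p * (4 * exp 1) powr (p - 1) * (4 * pi) powr (m / 2 * (p - 1)) * exp 1 * (2 * pi) powr (m / 2)"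
  have K: "0 < K" by (simp add: K_def)
  have "vol / K * X powr p * (t + 1) powr (m * (1 - p / 2)) \<le> (LINT x|lebesgue. \<bar>h x\<bar> powr p)"
    if t: "0 \<le> t" and h: "h \<in> borel_measurable lebesgue" "AE x in lebesgue. norm x > t + 1 \<longrightarrow> h x = 0"
      "integrable lebesgue (\<lambda>x. \<bar>h x\<bar> powr p)"
    and X: "0 \<le> X" "\<And>\<omega>. norm \<omega> = 1 \<Longrightarrow> X \<le> exp (- t) * exp_moment \<omega> h" for t X and h :: "'a \<Rightarrow> real"
  proof -
    define H where "H = (LINT x|lebesgue. \<bar>h x\<bar> powr p)"
    define R where "R = t + 1"
    have R: "0 < R" using t by (simp add: R_def)
    have 1: "(4 * exp 1 * sqrt (4 * pi * R) ^ (DIM('a) - 1)) powr (p - 1) =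
        (4 * exp 1) powr (p - 1) * (4 * pi) powr (m / 2 * (p - 1)) * R powr (m / 2 * (p - 1))"
      using R by (simp add: sqrt_power_eq_powr m_def powr_mult powr_powr)
    have 2: "sqrt (2 * pi / R) ^ (DIM('a) - 1) = (2 * pi) powr (m / 2) * R powr (- (m / 2))"
      using R by (simp add: sqrt_power_eq_powr m_def powr_divide powr_minus_divide)
    have "vol * X powr p \<le> 2 powr p * (4 * exp 1 * sqrt (4 * pi * R) ^ (DIM('a) - 1)) powr (p - 1) *
        ((exp 1 * sqrt (2 * pi / R) ^ (DIM('a) - 1)) * H)"
      unfolding vol_def H_def R_def by (rule plane_wave_average_bound[OF p t h X])
    also have "\<dots> = K * (R powr (m / 2 * (p - 1)) * R powr (- (m / 2))) * H"
      unfolding 1 2 K_def by (simp add: mult_ac)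
    also have "R powr (m / 2 * (p - 1)) * R powr (- (m / 2)) = R powr (- (m * (1 - p / 2)))"
      unfolding powr_add[symmetric] by (rule arg_cong[where f = "\<lambda>e. R powr e"]) (simp add: field_simps)
    finally have "vol * X powr p * R powr (m * (1 - p / 2)) \<le>
        K * R powr (- (m * (1 - p / 2))) * H * R powr (m * (1 - p / 2))"
      by (intro mult_right_mono) auto
    also have "\<dots> = K * H * (R powr (- (m * (1 - p / 2))) * R powr (m * (1 - p / 2)))"
      by (simp only: mult_ac)
    also have "R powr (- (m * (1 - p / 2))) * R powr (m * (1 - p / 2)) = 1"
      using R by (simp only: powr_add[symmetric]) simp
    finally show ?thesis using K by (simp add: field_simps H_def R_def)
  qed
  then show ?thesis
    using vol K by (intro exI[of _ "vol / K"]) (auto simp: m_def)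
qed

section \<open>Blow-up for the moment inequalities\<close>

text \<open>Derivatives are required only in the open interval because at time zero the moments are
  merely known to be continuous.\<close>

lemma has_derivative_lower_bound:
  fixes F :: "real \<Rightarrow> real"
  assumes "a \<le> t" "continuous_on {a..t} F"
    and "\<And>s. a < s \<Longrightarrow> s < t \<Longrightarrow> (F has_real_derivative G s) (at s)"
    and "\<And>s. a < s \<Longrightarrow> s < t \<Longrightarrow> k \<le> G s"
  shows "F a + k * (t - a) \<le> F t"
proof -
  have "F a - k * a \<le> F t - k * t"
  proof (rule DERIV_nonneg_imp_increasing_open[of a t "\<lambda>s. F s - k * s"])
    show "a \<le> t" by fact
    show "continuous_on {a..t} (\<lambda>s. F s - k * s)"
      by (intro continuous_intros assms)
    fix s assume s: "a < s" "s < t"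
    have "((\<lambda>s. F s - k * s) has_real_derivative G s - k) (at s)"
      using assms(3)[OF s] by (auto intro!: derivative_eq_intros)
    then show "\<exists>y. ((\<lambda>s. F s - k * s) has_real_derivative y) (at s) \<and> 0 \<le> y"
      using assms(4)[OF s] by (intro exI[of _ "G s - k"]) auto
  qed
  then show ?thesis by (simp add: algebra_simps)
qed

text \<open>The moment system detached from its origin. The window \<open>[a, b]\<close> is a
  parameter because it is used twice: on \<open>[\<tau> / 3, \<tau>]\<close> to build up
  \<open>V\<close>, and on \<open>[\<tau>, 2 * \<tau>]\<close> to blow it up.\<close>

locale moment_odes =
  fixes V V1 W G H :: "real \<Rightarrow> real" and a b :: real
  assumes V: "\<And>s. a \<le> s \<Longrightarrow> s \<le> b \<Longrightarrow> (V has_real_derivative V1 s) (at s)"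
    and V1: "\<And>s. a \<le> s \<Longrightarrow> s \<le> b \<Longrightarrow> (V1 has_real_derivative H s) (at s)"
    and W: "\<And>s. a \<le> s \<Longrightarrow> s \<le> b \<Longrightarrow> (W has_real_derivative G s) (at s)"
    and V_nonneg: "\<And>s. a \<le> s \<Longrightarrow> s \<le> b \<Longrightarrow> 0 \<le> V s"
    and V1_nonneg: "\<And>s. a \<le> s \<Longrightarrow> s \<le> b \<Longrightarrow> 0 \<le> V1 s"
    and W_nonneg: "\<And>s. a \<le> s \<Longrightarrow> s \<le> b \<Longrightarrow> 0 \<le> W s"
begin

lemma continuous: "a \<le> s \<Longrightarrow> t \<le> b \<Longrightarrow> continuous_on {s..t} V"
  "a \<le> s \<Longrightarrow> t \<le> b \<Longrightarrow> continuous_on {s..t} V1" "a \<le> s \<Longrightarrow> t \<le> b \<Longrightarrow> continuous_on {s..t} W"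
  using V V1 W by (meson DERIV_isCont atLeastAtMost_iff continuous_at_imp_continuous_on order_trans)+

lemma V_mono:
  assumes "a \<le> s" "s \<le> t" "t \<le> b"
  shows "V s \<le> V t"
  using has_derivative_lower_bound[of s t V V1 0] continuous(1)[of s t] V V1_nonneg assms
  by simp

text \<open>Two integrations, each granted a time \<open>d\<close>: after the first
  \<open>V1\<close> is at least \<open>h * d\<close>, after the second \<open>V\<close> is at least
  \<open>h * d * d\<close>.\<close>

lemma V_lower_bound:
  assumes s: "a \<le> s" and d: "0 \<le> d" and t: "s + 2 * d \<le> t" "t \<le> b"
    and h: "0 \<le> h" "\<And>r. s \<le> r \<Longrightarrow> r \<le> b \<Longrightarrow> h \<le> H r"
  shows "h * d\<^sup>2 \<le> V t"
proof -
  have V1_ge: "h * d \<le> V1 r" if r: "s + d \<le> r" "r \<le> b" for r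
  proof -
    have "h * d \<le> h * (r - s)" using h r by (intro mult_left_mono) auto
    also have "\<dots> \<le> V1 s + h * (r - s)" using V1_nonneg[of s] s r d by simp
    also have "\<dots> \<le> V1 r"
      using s d r h continuous(2)[of s r] by (intro has_derivative_lower_bound[where G = H] V1) auto
    finally show ?thesis .
  qed
  have "h * d\<^sup>2 = h * d * d" by (simp add: power2_eq_square)
  also have "\<dots> \<le> h * d * (t - (s + d))" using h d t by (intro mult_left_mono) auto
  also have "\<dots> \<le> V (s + d) + h * d * (t - (s + d))" using V_nonneg[of "s + d"] s t d by simp
  also have "\<dots> \<le> V t"
    using s d t V1_ge continuous(1)[of "s + d" t] by (intro has_derivative_lower_bound[where G = V1] V) auto
  finally show ?thesis .
qed

text \<open>Of the three stretches of length \<open>d\<close>, one lets \<open>W\<close> grow and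
  two let \<open>V\<close> grow. The lower bound \<open>M\<close> is assumed on all of
  \<open>[s, b]\<close> so that the growth rates persist.\<close>

lemma blow_up_step:
  assumes p: "0 < p" and q: "0 < q" and g0: "0 \<le> g0" and h0: "0 \<le> h0"
    and G: "\<And>s. a \<le> s \<Longrightarrow> s \<le> b \<Longrightarrow> g0 * V s powr q \<le> G s"
    and H: "\<And>s. a \<le> s \<Longrightarrow> s \<le> b \<Longrightarrow> h0 * W s powr p \<le> H s"
    and s: "a \<le> s" and d: "0 \<le> d" and t: "s + 3 * d \<le> t" "t \<le> b"
    and M: "0 \<le> M" "\<And>r. s \<le> r \<Longrightarrow> r \<le> b \<Longrightarrow> M \<le> V r"
  shows "h0 * (g0 * M powr q * d) powr p * d\<^sup>2 \<le> V t"
proof (rule V_lower_bound[of "s + d"])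
  fix r assume r: "s + d \<le> r" "r \<le> b"
  have "g0 * M powr q * d \<le> g0 * M powr q * (r - s)"
    using g0 r by (intro mult_left_mono) auto
  also have "\<dots> \<le> W s + g0 * M powr q * (r - s)" using W_nonneg[of s] s r d by simp
  also have "\<dots> \<le> W r"
  proof (rule has_derivative_lower_bound[where G = G])
    fix x assume x: "s < x" "x < r"
    have "g0 * M powr q \<le> g0 * V x powr q"
      using M x r q g0 by (intro mult_left_mono powr_mono2) auto
    also have "\<dots> \<le> G x" using G x s r by simp
    finally show "g0 * M powr q \<le> G x" .
  qed (use s d r W continuous(3)[of s r] in auto)
  finally have "h0 * (g0 * M powr q * d) powr p \<le> h0 * W r powr p"
    using g0 d h0 p by (intro mult_left_mono powr_mono2) auto
  also have "\<dots> \<le> H r" using H r s d by simp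
  finally show "h0 * (g0 * M powr q * d) powr p \<le> H r" .
qed (use s d t h0 in auto)

end

text \<open>Doubling the lower bound of \<open>V\<close> geometrically on the times \<open>\<tau> (2 - 2 ^ (- k))\<close> shows that
  too large an initial bound is incompatible with existence up to \<open>2 \<tau>\<close>.\<close>

lemma (in moment_odes) blow_up:
  assumes \<tau>: "0 < \<tau>" "a = \<tau>" "b = 2 * \<tau>"
    and p: "1 < p" and q: "1 < q" and g0: "0 < g0" and h0: "0 < h0" and V0: "0 < V0"
    and V_ge: "\<And>s. a \<le> s \<Longrightarrow> s \<le> b \<Longrightarrow> V0 \<le> V s"
    and G: "\<And>s. a \<le> s \<Longrightarrow> s \<le> b \<Longrightarrow> g0 * V s powr q \<le> G s"
    and H: "\<And>s. a \<le> s \<Longrightarrow> s \<le> b \<Longrightarrow> h0 * W s powr p \<le> H s"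
  shows "h0 * g0 powr p * V0 powr (p * q - 1) * \<tau> powr (p + 2) < 2 powr ((p + 2) / (p * q - 1)) * 6 powr (p + 2)"
proof (rule ccontr)
  assume contra: "\<not> ?thesis"
  have pq: "1 < p * q" using p q by (metis less_1_mult)
  \<comment> \<open>The base is fixed by \<open>B powr (p * q - 1) = 2 powr (p + 2)\<close>: the
    gain from a larger \<open>V\<close> then exactly compensates the loss from halving the step
    length.\<close>
  define B :: real where "B = 2 powr ((p + 2) / (p * q - 1))"
  have B: "1 < B" using p pq by (simp add: B_def)
  have B_powr: "B powr (p * q - 1) = 2 powr (p + 2)" using pq by (simp add: B_def powr_powr)
  have large: "B \<le> h0 * g0 powr p * V0 powr (p * q - 1) * (\<tau> / 6) powr (p + 2)"
    using contra \<tau> by (simp add: B_def powr_divide field_simps)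
  have iterate: "V0 * B ^ k \<le> V t" if "\<tau> * (2 - (1 / 2) ^ k) \<le> t" "t \<le> b" for k t
    using that
  proof (induction k arbitrary: t)
    case 0
    then show ?case using V_ge[of t] \<tau> by simp
  next
    case (Suc k)
    \<comment> \<open>Three steps of this length fill exactly the gap
      \<open>\<tau> * (1 / 2) ^ Suc k\<close> between consecutive times.\<close>
    define d where "d = \<tau> / 6 * (1 / 2) ^ k"
    define M where "M = V0 * B ^ k"
    have d: "0 < d" using \<tau> by (simp add: d_def)
    have M: "0 < M" using V0 B by (simp add: M_def)
    have half: "(1 / 2 :: real) ^ k \<le> 1" by (rule power_le_one) auto
    have "h0 * (g0 * M powr q * d) powr p * d\<^sup>2 \<le> V t"
    proof (rule blow_up_step[of p q g0 h0 "\<tau> * (2 - (1 / 2) ^ k)"])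
      show "a \<le> \<tau> * (2 - (1 / 2) ^ k)" using \<tau> half by simp
      show "\<tau> * (2 - (1 / 2) ^ k) + 3 * d \<le> t" using Suc.prems by (simp add: d_def algebra_simps)
      show "M \<le> V r" if "\<tau> * (2 - (1 / 2) ^ k) \<le> r" "r \<le> b" for r
        unfolding M_def by (rule Suc.IH[OF that])
    qed (use p q g0 h0 G H d M Suc.prems in auto)
    moreover have "V0 * B ^ Suc k \<le> h0 * (g0 * M powr q * d) powr p * d\<^sup>2"
    proof -
      have B_pow: "B ^ k = B powr (real k)" using B by (simp add: powr_realpow)
      have half_pow: "(1 / 2 :: real) ^ k = 2 powr (- real k)"
        by (simp add: powr_minus_divide powr_realpow power_one_over)
      have "d\<^sup>2 = d powr 2" using d by (simp add: powr_numeral)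
      then have "h0 * (g0 * M powr q * d) powr p * d\<^sup>2 = h0 * g0 powr p * M powr (p * q) * (d powr p * d powr 2)"
        using g0 d by (simp add: powr_mult powr_powr mult_ac)
      also have "d powr p * d powr 2 = d powr (p + 2)" by (simp add: powr_add)
      also have "d powr (p + 2) = (\<tau> / 6) powr (p + 2) * 2 powr (- (real k * (p + 2)))"
        unfolding d_def half_pow using \<tau> by (simp only: powr_mult powr_powr) simp
      also have "M powr (p * q) = M powr (p * q - 1) * M"
        using M by (simp add: powr_diff)
      also have "M powr (p * q - 1) = V0 powr (p * q - 1) * 2 powr (real k * (p + 2))"
      proof -
        have "M powr (p * q - 1) = V0 powr (p * q - 1) * (B powr real k) powr (p * q - 1)"
          unfolding M_def B_pow using V0 by (simp add: powr_mult)
        also have "(B powr real k) powr (p * q - 1) = (B powr (p * q - 1)) powr real k"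
          by (simp add: powr_powr mult.commute)
        also have "\<dots> = 2 powr (real k * (p + 2))" by (simp add: B_powr powr_powr mult.commute)
        finally show ?thesis .
      qed
      finally have "h0 * (g0 * M powr q * d) powr p * d\<^sup>2 =
          (h0 * g0 powr p * V0 powr (p * q - 1) * (\<tau> / 6) powr (p + 2)) * M *
          (2 powr (real k * (p + 2)) * 2 powr (- (real k * (p + 2))))"
        by (simp only: mult_ac)
      also have "2 powr (real k * (p + 2)) * 2 powr (- (real k * (p + 2))) = (1::real)"
        by (simp only: powr_add[symmetric]) simp
      also have "(h0 * g0 powr p * V0 powr (p * q - 1) * (\<tau> / 6) powr (p + 2)) * M * 1 \<ge> B * M"
        using large M by (simp add: mult_right_mono)
      finally show ?thesis by (simp add: M_def mult_ac)
    qed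
    ultimately show ?case by linarith
  qed
  \<comment> \<open>All iteration times lie below \<open>b = 2 * \<tau>\<close>, so the finite
    number \<open>V b\<close> would have to exceed every \<open>V0 * B ^ k\<close>.\<close>
  obtain k where "V b / V0 < B ^ k"
    using real_arch_pow[OF B] by blast
  then have "V b < V0 * B ^ k" using V0 by (simp add: field_simps)
  moreover have "V0 * B ^ k \<le> V b"
    using \<tau> by (intro iterate) (auto simp: algebra_simps)
  ultimately show False by simp
qed

section \<open>Solutions in the cone\<close>

text \<open>Hoelder with constant weight on the ball: its volume, of order \<open>R ^ n\<close>,
  enters with the power \<open>r - 1\<close>.\<close>

lemma mean_powr_bound:
  fixes w :: "'a::euclidean_space \<Rightarrow> real"
  assumes r: "1 < r" and R: "0 < R" and w: "w \<in> borel_measurable lebesgue"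
      "AE x in lebesgue. norm x > R \<longrightarrow> w x = 0" "integrable lebesgue (\<lambda>x. \<bar>w x\<bar> powr r)"
    and X: "0 \<le> X" "X \<le> exp_moment 0 w"
  shows "1 / (2 powr r * unit_ball_vol (real DIM('a)) powr (r - 1)) * R powr (- (real DIM('a) * (r - 1))) * X powr r
    \<le> exp_moment 0 (\<lambda>x. \<bar>w x\<bar> powr r)"
proof -
  define \<kappa> where "\<kappa> = unit_ball_vol (real DIM('a))"
  have \<kappa>: "0 < \<kappa>" by (simp add: \<kappa>_def)
  define E where "E = real DIM('a) * (r - 1)"
  let ?k = "indicator (cball (0::'a) R) :: 'a \<Rightarrow> real"
  have k_meas: "?k \<in> borel_measurable lebesgue"
    by (intro borel_measurable_indicator fmeasurableD lmeasurable_cball)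
  have k_int: "integrable lebesgue ?k"
    using lmeasurable_cball[of "0::'a" R] by (simp add: integrable_indicator_iff fmeasurable_def)
  have k_val: "(LINT x|lebesgue. ?k x) = \<kappa> * R ^ DIM('a)"
    using R by (simp add: \<kappa>_def content_cball)
  have X_le: "X \<le> (LINT x|lebesgue. w x * ?k x)"
    using X(2) exp_moment_truncate[OF w(1,2), of 0] by simp
  have wk: "integrable lebesgue (\<lambda>x. \<bar>w x\<bar> powr r * ?k x)"
    by (rule integrable_mult_bounded[OF w(3) k_meas, of 1]) (auto simp: indicator_def)
  have "X powr r \<le> 2 powr r * (\<kappa> * R ^ DIM('a)) powr (r - 1) * (LINT x|lebesgue. \<bar>w x\<bar> powr r * ?k x)"
    by (rule weighted_integral_powr_bound[OF r _ X(1) X_le k_int _ _ wk]) (use \<kappa> R k_val in auto)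
  also have "(LINT x|lebesgue. \<bar>w x\<bar> powr r * ?k x) \<le> (LINT x|lebesgue. \<bar>w x\<bar> powr r)"
    by (rule integral_mono[OF wk w(3)]) (auto simp: indicator_def)
  also have "(LINT x|lebesgue. \<bar>w x\<bar> powr r) = exp_moment 0 (\<lambda>x. \<bar>w x\<bar> powr r)"
    by (simp add: exp_moment_def)
  finally have "X powr r \<le> 2 powr r * (\<kappa> * R ^ DIM('a)) powr (r - 1) * exp_moment 0 (\<lambda>x. \<bar>w x\<bar> powr r)"
    by (simp add: mult_left_mono)
  also have "(\<kappa> * R ^ DIM('a)) powr (r - 1) = \<kappa> powr (r - 1) * R powr E"
    using \<kappa> R by (simp add: E_def powr_mult powr_realpow[symmetric] powr_powr)
  finally show ?thesis
    unfolding \<kappa>_def[symmetric] E_def[symmetric]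
    using \<kappa> R by (simp add: powr_minus_divide field_simps)
qed

text \<open>On the unit ball \<open>exp (\<omega> \<bullet> x)\<close> is at least
  \<open>exp (- 1)\<close>, uniformly in the direction. Nothing is assumed about the measurability
  of \<open>f\<close>; it and integrability come from \<open>w\<close> after division by
  \<open>\<epsilon>\<close>.\<close>

lemma initial_moment_lower_bound:
  fixes w f :: "'a::euclidean_space \<Rightarrow> real"
  assumes w: "integrable lebesgue w" "AE x in lebesgue. norm x > 1 \<longrightarrow> w x = 0"
    and f: "AE x in lebesgue. w x = \<epsilon> * f x" "\<And>x. 0 \<le> f x" and \<epsilon>: "0 < \<epsilon>"
  shows "integrable lebesgue f"
    and "norm \<omega> \<le> 1 \<Longrightarrow> \<epsilon> * (exp (- 1) * (LINT x|lebesgue. f x)) \<le> exp_moment \<omega> w"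
proof -
  have w_meas: "w \<in> borel_measurable lebesgue" using w(1) by simp
  have eq: "AE x in lebesgue. (1 / \<epsilon>) * w x = f x"
    using f(1) by eventually_elim (use \<epsilon> in simp)
  have f_meas: "f \<in> borel_measurable lebesgue"
    using borel_measurable_AE[OF _ eq] w_meas by simp
  show f_int: "integrable lebesgue f"
    using integrable_cong_AE[OF _ f_meas eq] w(1) w_meas by simp
  assume \<omega>: "norm \<omega> \<le> 1"
  let ?k = "\<lambda>x. exp (\<omega> \<bullet> x) * indicator (cball 0 1) x"
  have "\<epsilon> * (exp (- 1) * (LINT x|lebesgue. f x)) = (LINT x|lebesgue. exp (- 1) * (\<epsilon> * f x))"
    by (simp add: mult.left_commute)
  also have "\<dots> \<le> (LINT x|lebesgue. w x * ?k x)"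
  proof (rule integral_mono_AE)
    show "integrable lebesgue (\<lambda>x. exp (- 1) * (\<epsilon> * f x))" using f_int by simp
    show "integrable lebesgue (\<lambda>x. w x * ?k x)"
      by (rule integrable_mult_bounded[OF w(1) truncated_exp_bounds])
    show "AE x in lebesgue. exp (- 1) * (\<epsilon> * f x) \<le> w x * ?k x"
      using f(1) w(2)
    proof eventually_elim
      case (elim x)
      show ?case
      proof (cases "norm x \<le> 1")
        case True
        have "\<bar>\<omega> \<bullet> x\<bar> \<le> 1"
          using Cauchy_Schwarz_ineq2[of \<omega> x] mult_mono[OF \<omega> True] by simp
        then have "exp (- 1) * (\<epsilon> * f x) \<le> exp (\<omega> \<bullet> x) * (\<epsilon> * f x)"
          using \<epsilon> f(2)[of x] by (intro mult_right_mono) auto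
        then show ?thesis using True elim by (simp add: mult.commute)
      next
        case False
        then show ?thesis using elim by auto
      qed
    qed
  qed
  also have "\<dots> = exp_moment \<omega> w"
    by (rule exp_moment_truncate[OF w_meas w(2), symmetric])
  finally show "\<epsilon> * (exp (- 1) * (LINT x|lebesgue. f x)) \<le> exp_moment \<omega> w" .
qed

text \<open>The exponent \<open>(n - 1) * (1 - p / 2)\<close> changes sign at \<open>p = 2\<close>,
  hence the absolute value.\<close>

lemma powr_lower_bound_third:
  assumes "1 / 3 \<le> y" "y \<le> (3::real)"
  shows "3 powr (- \<bar>\<alpha>\<bar>) \<le> y powr \<alpha>"
proof (cases "0 \<le> \<alpha>")
  case True
  have "3 powr (- \<bar>\<alpha>\<bar>) = (1 / 3) powr \<alpha>" using True by (simp add: powr_minus_divide powr_divide)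
  also have "\<dots> \<le> y powr \<alpha>" using True assms by (intro powr_mono2) auto
  finally show ?thesis .
next
  case False
  then show ?thesis using assms powr_mono2'[of \<alpha> y 3] by simp
qed

text \<open>The initial data are left out: they enter only through lower bounds on moments at time
  zero, which the lemmas take as hypotheses.\<close>

locale cone_solution =
  fixes p q :: real and T :: ereal and u ut v vt :: "real \<Rightarrow> 'a::euclidean_space \<Rightarrow> real"
  assumes p: "1 < p" and q: "1 < q" and T: "0 < T"
    and sol: "weak_solution p q T u ut v vt"
    and cone: "in_cone (Ico_T T) u" "in_cone (Ico_T T) ut" "in_cone (Ico_T T) v" "in_cone (Ico_T T) vt"
begin

abbreviation "W t \<equiv> exp_moment 0 (ut t)"
abbreviation "V t \<equiv> exp_moment 0 (v t)"
abbreviation "V1 t \<equiv> exp_moment 0 (vt t)"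
abbreviation "G t \<equiv> exp_moment 0 (\<lambda>x. \<bar>v t x\<bar> powr q)"
abbreviation "H t \<equiv> exp_moment 0 (\<lambda>x. \<bar>ut t x\<bar> powr p)"

lemma regularity:
  "cont_Lr 1 (Ico_T T) u" "cont_Lr 1 (Ico_T T) ut" "cont_Lr 1 (Ico_T T) v" "cont_Lr 1 (Ico_T T) vt"
  "cont_Lr q (Ioo_T T) v" "cont_Lr p (Ioo_T T) ut" "weak_dt T u ut" "weak_dt T v vt"
  using sol by (auto simp: weak_solution_def)

lemma weak_equations:
  assumes "test_fun T \<psi>"
  shows "time_int T (\<lambda>s. pairing (\<lambda>x. \<bar>v s x\<bar> powr q) (\<lambda>x. \<psi> (s, x))) =
      time_int T (\<lambda>s. pairing (u s) (\<lambda>x. box \<psi> (s, x)))"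
    and "time_int T (\<lambda>s. pairing (\<lambda>x. \<bar>ut s x\<bar> powr p) (\<lambda>x. \<psi> (s, x))) =
      time_int T (\<lambda>s. pairing (v s) (\<lambda>x. box \<psi> (s, x)))"
  using sol assms by (auto simp: weak_solution_def)

lemma moment_continuous:
  "continuous_on (Ico_T T) (\<lambda>t. exp_moment \<omega> (u t))" "continuous_on (Ico_T T) (\<lambda>t. exp_moment \<omega> (ut t))"
  "continuous_on (Ico_T T) (\<lambda>t. exp_moment \<omega> (v t))" "continuous_on (Ico_T T) (\<lambda>t. exp_moment \<omega> (vt t))"
  by (intro exp_moment_continuous_on regularity cone)+

lemma moment_derivatives:
  assumes t: "t \<in> Ioo_T T"
  shows "((\<lambda>t. exp_moment \<omega> (u t)) has_real_derivative exp_moment \<omega> (ut t)) (at t)"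
    "((\<lambda>t. exp_moment \<omega> (ut t)) has_real_derivative
      exp_moment \<omega> (\<lambda>x. \<bar>v t x\<bar> powr q) + (\<omega> \<bullet> \<omega>) * exp_moment \<omega> (u t)) (at t)"
    "((\<lambda>t. exp_moment \<omega> (v t)) has_real_derivative exp_moment \<omega> (vt t)) (at t)"
    "((\<lambda>t. exp_moment \<omega> (vt t)) has_real_derivative
      exp_moment \<omega> (\<lambda>x. \<bar>ut t x\<bar> powr p) + (\<omega> \<bullet> \<omega>) * exp_moment \<omega> (v t)) (at t)"
proof -
  have pq: "0 < p" "0 < q" using p q by auto
  show "((\<lambda>t. exp_moment \<omega> (u t)) has_real_derivative exp_moment \<omega> (ut t)) (at t)"
    by (rule exp_moment_has_derivative(2)[OF regularity(7,1) cone(1) regularity(2) cone(2) t])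
  show "((\<lambda>t. exp_moment \<omega> (v t)) has_real_derivative exp_moment \<omega> (vt t)) (at t)"
    by (rule exp_moment_has_derivative(2)[OF regularity(8,3) cone(3) regularity(4) cone(4) t])
  show "((\<lambda>t. exp_moment \<omega> (ut t)) has_real_derivative
      exp_moment \<omega> (\<lambda>x. \<bar>v t x\<bar> powr q) + (\<omega> \<bullet> \<omega>) * exp_moment \<omega> (u t)) (at t)"
    by (rule exp_moment_has_second_derivative[OF regularity(7,1) cone(1) regularity(2) cone(2)
          regularity(5) cone(3) pq(2) weak_equations(1) t])
  show "((\<lambda>t. exp_moment \<omega> (vt t)) has_real_derivative
      exp_moment \<omega> (\<lambda>x. \<bar>ut t x\<bar> powr p) + (\<omega> \<bullet> \<omega>) * exp_moment \<omega> (v t)) (at t)"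
    by (rule exp_moment_has_second_derivative[OF regularity(8,3) cone(3) regularity(4) cone(4)
          regularity(6) cone(2) pq(1) weak_equations(2) t])
qed

lemma exp_moment_powr_nonneg: "0 \<le> exp_moment \<omega> (\<lambda>x. \<bar>w x\<bar> powr r)"
  unfolding exp_moment_def by (intro integral_nonneg_AE) auto

lemma Icc_subset: "t \<in> Ico_T T \<Longrightarrow> {0..t} \<subseteq> Ico_T T"
  by (auto simp: Ico_T_def) (metis ereal_less_eq(3) order_le_less_trans)

lemma interior_times: "t \<in> Ico_T T \<Longrightarrow> 0 < s \<Longrightarrow> s < t \<Longrightarrow> s \<in> Ioo_T T"
  by (auto simp: Ico_T_def Ioo_T_def) (metis ereal_less_eq(3) less_imp_le order_le_less_trans)

lemma nonneg_if_derivative_nonneg: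
  assumes t: "t \<in> Ico_T T" and F: "continuous_on (Ico_T T) F" "0 \<le> F 0"
    and F': "\<And>s. s \<in> Ioo_T T \<Longrightarrow> (F has_real_derivative F' s) (at s)"
      "\<And>s. s \<in> Ioo_T T \<Longrightarrow> 0 \<le> F' s"
  shows "0 \<le> F t"
  using has_derivative_lower_bound[of 0 t F F' 0] continuous_on_subset[OF F(1) Icc_subset[OF t]]
    F(2) F' interior_times[OF t] t
  by (auto simp: Ico_T_def)

lemma moments_nonneg:
  assumes t: "t \<in> Ico_T T" and init: "0 \<le> W 0" "0 \<le> V 0" "0 \<le> V1 0"
  shows "0 \<le> W t" "0 \<le> V1 t" "0 \<le> V t"
proof -
  show "0 \<le> W t"
    using moment_derivatives(2)[of _ 0] exp_moment_powr_nonneg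
    by (intro nonneg_if_derivative_nonneg[OF t moment_continuous(2) init(1), where F' = G]) auto
  have V1: "0 \<le> V1 t" if "t \<in> Ico_T T" for t
    using moment_derivatives(4)[of _ 0] exp_moment_powr_nonneg
    by (intro nonneg_if_derivative_nonneg[OF that moment_continuous(4) init(3), where F' = H]) auto
  then show "0 \<le> V1 t" using t .
  show "0 \<le> V t"
    using moment_derivatives(3)[of _ 0] V1 Ioo_T_subset_Ico_T[of T]
    by (intro nonneg_if_derivative_nonneg[OF t moment_continuous(3) init(2), where F' = V1]) auto
qed

text \<open>With \<open>A = \<langle>u, e\<^bsup>\<omega>\<cdot>x\<^esup>\<rangle>\<close> and \<open>B = \<langle>\<partial>\<^sub>t u, e\<^bsup>\<omega>\<cdot>x\<^esup>\<rangle>\<close> the equation reads \<open>A' = B\<close>, \<open>B' = A + N\<close>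
  with \<open>N \<ge> 0\<close>, so \<open>e\<^bsup>-t\<^esup>(A + B)\<close> is nondecreasing.\<close>

lemma plane_wave_moment_lower_bound:
  assumes \<omega>: "norm \<omega> = 1" and t: "t \<in> Ico_T T" "1 \<le> t"
    and m: "0 \<le> m" "m \<le> exp_moment \<omega> (u 0) + exp_moment \<omega> (ut 0)" "0 \<le> exp_moment \<omega> (ut 0)"
  shows "m / 4 \<le> exp (- t) * exp_moment \<omega> (ut t)"
proof -
  define A where "A s = exp_moment \<omega> (u s)" for s
  define B where "B s = exp_moment \<omega> (ut s)" for s
  define N where "N s = exp_moment \<omega> (\<lambda>x. \<bar>v s x\<bar> powr q)" for s
  have N: "0 \<le> N s" for s unfolding N_def by (rule exp_moment_powr_nonneg)
  have \<omega>2: "\<omega> \<bullet> \<omega> = 1" using \<omega> by (simp add: dot_square_norm)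
  have A': "(A has_real_derivative B s) (at s)" if "s \<in> Ioo_T T" for s
    using moment_derivatives(1)[OF that, of \<omega>] by (simp add: A_def[abs_def] B_def)
  have B': "(B has_real_derivative N s + A s) (at s)" if "s \<in> Ioo_T T" for s
    using moment_derivatives(2)[OF that, of \<omega>] by (simp add: A_def B_def[abs_def] N_def \<omega>2)
  have cont: "continuous_on (Ico_T T) A" "continuous_on (Ico_T T) B"
    unfolding A_def B_def by (rule moment_continuous)+
  have S: "m \<le> exp (- s) * (A s + B s)" if s: "s \<in> Ico_T T" for s
  proof -
    have "exp (- 0) * (A 0 + B 0) + 0 * (s - 0) \<le> exp (- s) * (A s + B s)"
    proof (rule has_derivative_lower_bound[where G = "\<lambda>s. exp (- s) * N s"])
      show "continuous_on {0..s} (\<lambda>s. exp (- s) * (A s + B s))"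
        by (intro continuous_intros continuous_on_subset[OF cont(1) Icc_subset[OF s]]
            continuous_on_subset[OF cont(2) Icc_subset[OF s]])
      fix r assume "0 < r" "r < s"
      then have r: "r \<in> Ioo_T T" by (rule interior_times[OF s])
      show "((\<lambda>s. exp (- s) * (A s + B s)) has_real_derivative exp (- r) * N r) (at r)"
        by (rule derivative_eq_intros A'[OF r] B'[OF r] refl)+ (simp add: algebra_simps)
      show "0 \<le> exp (- r) * N r" using N by simp
    qed (use s in \<open>auto simp: Ico_T_def\<close>)
    then show ?thesis using m(2) by (simp add: A_def B_def)
  qed
  \<comment> \<open>To pass from \<open>A + B\<close> to \<open>B\<close> alone:
    \<open>(e^s B)' = e^s (N + A + B) >= m e^(2s)\<close>, and the right side is the derivative of
    \<open>(m / 2) e^(2s)\<close>.\<close>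
  have "(exp 0 * B 0 - m / 2 * exp (2 * 0)) + 0 * (t - 0) \<le> exp t * B t - m / 2 * exp (2 * t)"
  proof (rule has_derivative_lower_bound[where F = "\<lambda>s. exp s * B s - m / 2 * exp (2 * s)" and
        G = "\<lambda>s. exp s * (N s + A s + B s) - m * exp (2 * s)"])
    show "continuous_on {0..t} (\<lambda>s. exp s * B s - m / 2 * exp (2 * s))"
      by (intro continuous_intros continuous_on_subset[OF cont(2) Icc_subset[OF t(1)]])
    fix r assume "0 < r" "r < t"
    then have r: "r \<in> Ioo_T T" by (rule interior_times[OF t(1)])
    show "((\<lambda>s. exp s * B s - m / 2 * exp (2 * s)) has_real_derivative
        exp r * (N r + A r + B r) - m * exp (2 * r)) (at r)"
      by (rule derivative_eq_intros B'[OF r] refl)+ (simp add: algebra_simps)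
    have "exp (2 * r) * m \<le> exp (2 * r) * (exp (- r) * (A r + B r))"
      using S[of r] r Ioo_T_subset_Ico_T by (intro mult_left_mono) auto
    also have "\<dots> = exp r * (A r + B r)"
      by (simp add: mult.assoc[symmetric] exp_add[symmetric])
    also have "\<dots> \<le> exp r * (N r + A r + B r)" using N[of r] by simp
    finally show "0 \<le> exp r * (N r + A r + B r) - m * exp (2 * r)" by (simp add: mult.commute)
  qed (use t in auto)
  then have "m / 2 * exp (2 * t) - m / 2 \<le> exp t * B t"
    using m(3) by (simp add: B_def)
  then have "exp (- (2 * t)) * (m / 2 * exp (2 * t) - m / 2) \<le> exp (- (2 * t)) * (exp t * B t)"
    by (intro mult_left_mono) auto
  also have "\<dots> = exp (- t) * B t"
    by (simp add: mult.assoc[symmetric] exp_add[symmetric])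
  also have "exp (- (2 * t)) * (m / 2 * exp (2 * t) - m / 2) = m / 2 * (1 - exp (- (2 * t)))"
    by (simp add: algebra_simps exp_minus)
  finally have "m / 2 * (1 - exp (- (2 * t))) \<le> exp (- t) * B t" .
  \<comment> \<open>Here \<open>1 \<le> t\<close> is used: the initial layer then costs at most a
    factor two, which turns \<open>m / 2\<close> into \<open>m / 4\<close>.\<close>
  moreover have "2 \<le> exp (2 * t)"
    using exp_ge_add_one_self[of "2 * t"] t(2) by linarith
  then have "exp (- (2 * t)) \<le> 1 / 2"
    by (simp add: exp_minus field_simps)
  then have "m / 2 * (1 / 2) \<le> m / 2 * (1 - exp (- (2 * t)))"
    using m(1) by (intro mult_left_mono) auto
  ultimately show ?thesis by (simp add: B_def)
qed

text \<open>Existence beyond \<open>2 * \<tau>\<close> bounds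
  \<open>\<epsilon>^(p(pq-1)) \<tau>^\<theta>\<close>. All constants are written out so that their
  independence of \<open>\<epsilon>\<close> and of the solution is visible. In \<open>c2\<close> the
  factor \<open>1 / 9\<close> is the square of the step \<open>\<tau> / 3\<close>, and the power of
  three compares \<open>t + 1\<close> with \<open>\<tau>\<close>.\<close>

lemma lifespan_inequality:
  fixes \<epsilon> m0 c \<tau> :: real
  defines "n \<equiv> real DIM('a)"
  defines "\<alpha> \<equiv> (n - 1) * (1 - p / 2)"
    and "cq \<equiv> 1 / (2 powr q * unit_ball_vol n powr (q - 1))"
    and "cp \<equiv> 1 / (2 powr p * unit_ball_vol n powr (p - 1))"
    and "c2 \<equiv> c * (m0 / 4) powr p * 3 powr (- \<bar>(n - 1) * (1 - p / 2)\<bar>) / 9"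
  assumes c: "0 < c" and \<epsilon>: "0 < \<epsilon>" and m0: "0 < m0"
    and init: "0 \<le> W 0" "0 \<le> V 0" "0 \<le> V1 0"
    and init_wave: "\<And>\<omega>. norm \<omega> = 1 \<Longrightarrow> \<epsilon> * m0 \<le> exp_moment \<omega> (u 0) + exp_moment \<omega> (ut 0)"
      "\<And>\<omega>. norm \<omega> = 1 \<Longrightarrow> 0 \<le> exp_moment \<omega> (ut 0)"
    and lower: "\<And>t (h :: 'a \<Rightarrow> real) X. 0 \<le> t \<Longrightarrow> h \<in> borel_measurable lebesgue \<Longrightarrow>
      (AE x in lebesgue. norm x > t + 1 \<longrightarrow> h x = 0) \<Longrightarrow> integrable lebesgue (\<lambda>x. \<bar>h x\<bar> powr p) \<Longrightarrow>
      0 \<le> X \<Longrightarrow> (\<forall>\<omega>. norm \<omega> = 1 \<longrightarrow> X \<le> exp (- t) * exp_moment \<omega> h) \<Longrightarrow>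
      c * X powr p * (t + 1) powr ((n - 1) * (1 - p / 2)) \<le> (LINT x|lebesgue. \<bar>h x\<bar> powr p)"
    and \<tau>: "3 \<le> \<tau>" "ereal (2 * \<tau>) < T"
  shows "cp * cq powr p * 3 powr (- (n * (p * q - 1))) * c2 powr (p * q - 1) *
      (\<epsilon> powr (p * (p * q - 1)) * \<tau> powr (p + 2 - ((n - 1) / 2 * p - 1) * (p * q - 1)))
    < 2 powr ((p + 2) / (p * q - 1)) * 6 powr (p + 2)"
proof -
  have pos: "0 < \<tau>" using \<tau> by simp
  have ubv: "0 < unit_ball_vol n" by (simp add: n_def)
  have cq: "0 < cq" and cp: "0 < cp" using ubv by (auto simp: cq_def cp_def)
  have c2: "0 < c2" using c m0 by (simp add: c2_def)
  have times: "s \<in> Ioo_T T" if "0 < s" "s \<le> 2 * \<tau>" for s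
    using that \<tau> by (auto simp: Ioo_T_def) (metis ereal_less_eq(3) order_le_less_trans)
  then have times': "s \<in> Ico_T T" if "0 < s" "s \<le> 2 * \<tau>" for s
    using that Ioo_T_subset_Ico_T by blast
  have odes: "moment_odes V V1 W G H a b" if "0 < a" "b \<le> 2 * \<tau>" for a b
  proof
    fix s assume "a \<le> s" "s \<le> b"
    then have s: "0 < s" "s \<le> 2 * \<tau>" using that by auto
    show "(V has_real_derivative V1 s) (at s)" by (rule moment_derivatives(3)[OF times[OF s]])
    show "(V1 has_real_derivative H s) (at s)" using moment_derivatives(4)[OF times[OF s], of 0] by simp
    show "(W has_real_derivative G s) (at s)" using moment_derivatives(2)[OF times[OF s], of 0] by simp
    show "0 \<le> V s" "0 \<le> V1 s" "0 \<le> W s" using moments_nonneg[OF times'[OF s] init] by auto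
  qed
  have H_wave: "c * (\<epsilon> * m0 / 4) powr p * (t + 1) powr \<alpha> \<le> H t" if t: "1 \<le> t" "t \<le> 2 * \<tau>" for t
  proof -
    have t': "t \<in> Ico_T T" "t \<in> Ioo_T T" using t times[of t] times'[of t] by auto
    have "c * (\<epsilon> * m0 / 4) powr p * (t + 1) powr \<alpha> \<le> (LINT x|lebesgue. \<bar>ut t x\<bar> powr p)"
      unfolding \<alpha>_def
    proof (rule lower)
      show "ut t \<in> borel_measurable lebesgue" by (rule cont_Lr_measurable[OF regularity(2) t'(1)])
      show "AE x in lebesgue. norm x > t + 1 \<longrightarrow> ut t x = 0"
        using cone(2) t'(1) by (simp add: in_cone_def)
      show "integrable lebesgue (\<lambda>x. \<bar>ut t x\<bar> powr p)"
        using regularity(6) t'(2) by (simp add: cont_Lr_def)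
      show "\<forall>\<omega>. norm \<omega> = 1 \<longrightarrow> \<epsilon> * m0 / 4 \<le> exp (- t) * exp_moment \<omega> (ut t)"
        using plane_wave_moment_lower_bound[OF _ t'(1) t(1) _ init_wave] \<epsilon> m0 by simp
    qed (use t \<epsilon> m0 in auto)
    then show ?thesis by (simp add: exp_moment_def)
  qed
  have H_W: "cp * (t + 1) powr (- (n * (p - 1))) * W t powr p \<le> H t" if t: "0 < t" "t \<le> 2 * \<tau>" for t
    unfolding cp_def n_def
  proof (rule mean_powr_bound[OF p])
    show "ut t \<in> borel_measurable lebesgue" by (rule cont_Lr_measurable[OF regularity(2) times'[OF t]])
    show "AE x in lebesgue. norm x > t + 1 \<longrightarrow> ut t x = 0"
      using cone(2) times'[OF t] by (simp add: in_cone_def)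
    show "integrable lebesgue (\<lambda>x. \<bar>ut t x\<bar> powr p)"
      using regularity(6) times[OF t] by (simp add: cont_Lr_def)
    show "0 \<le> W t" by (rule moments_nonneg(1)[OF times'[OF t] init])
  qed (use t in auto)
  have G_V: "cq * (t + 1) powr (- (n * (q - 1))) * V t powr q \<le> G t" if t: "0 < t" "t \<le> 2 * \<tau>" for t
    unfolding cq_def n_def
  proof (rule mean_powr_bound[OF q])
    show "v t \<in> borel_measurable lebesgue" by (rule cont_Lr_measurable[OF regularity(3) times'[OF t]])
    show "AE x in lebesgue. norm x > t + 1 \<longrightarrow> v t x = 0"
      using cone(3) times'[OF t] by (simp add: in_cone_def)
    show "integrable lebesgue (\<lambda>x. \<bar>v t x\<bar> powr q)"
      using regularity(5) times[OF t] by (simp add: cont_Lr_def)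
    show "0 \<le> V t" by (rule moments_nonneg(3)[OF times'[OF t] init])
  qed (use t in auto)
  define V0 where "V0 = c2 * \<epsilon> powr p * \<tau> powr (\<alpha> + 2)"
  have V0: "0 < V0" using c2 \<epsilon> pos by (simp add: V0_def)
  have V_\<tau>: "V0 \<le> V \<tau>"
  proof -
    \<comment> \<open>Since \<open>3 \<le> \<tau>\<close>, the window starts after time one, where
      the plane wave bound is valid. Two integrations over steps of length \<open>\<tau> / 3\<close>
      lead exactly to \<open>\<tau>\<close>.\<close>
    interpret moment_odes V V1 W G H "\<tau> / 3" \<tau> using \<tau> by (intro odes) auto
    define k where "k = c * (\<epsilon> * m0 / 4) powr p * (3 powr (- \<bar>\<alpha>\<bar>) * \<tau> powr \<alpha>)"
    have "k * (\<tau> / 3)\<^sup>2 \<le> V \<tau>"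
    proof (rule V_lower_bound[of "\<tau> / 3"])
      fix r assume r: "\<tau> / 3 \<le> r" "r \<le> \<tau>"
      have "3 powr (- \<bar>\<alpha>\<bar>) * \<tau> powr \<alpha> \<le> ((r + 1) / \<tau>) powr \<alpha> * \<tau> powr \<alpha>"
        using r \<tau> by (intro mult_right_mono powr_lower_bound_third) (auto simp: field_simps)
      also have "\<dots> = (r + 1) powr \<alpha>"
        using r \<tau> by (simp add: powr_mult[symmetric])
      finally have "k \<le> c * (\<epsilon> * m0 / 4) powr p * (r + 1) powr \<alpha>"
        unfolding k_def using c by (intro mult_left_mono) auto
      also have "\<dots> \<le> H r" using r \<tau> by (intro H_wave) auto
      finally show "k \<le> H r" .
    qed (use \<tau> c in \<open>auto simp: k_def\<close>)
    moreover have "k * (\<tau> / 3)\<^sup>2 = V0"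
    proof -
      have "(\<tau> / 3)\<^sup>2 = \<tau> powr 2 / 9" using pos by (simp add: powr_numeral power_divide)
      moreover have "(\<epsilon> * m0 / 4) powr p = \<epsilon> powr p * (m0 / 4) powr p"
        using \<epsilon> m0 by (simp add: powr_mult[symmetric])
      ultimately show ?thesis by (simp add: k_def V0_def c2_def \<alpha>_def powr_add)
    qed
    ultimately show ?thesis by simp
  qed
  interpret moment_odes V V1 W G H \<tau> "2 * \<tau>" using \<tau> by (intro odes) auto
  \<comment> \<open>On \<open>[\<tau>, 2 * \<tau>]\<close> the cone radius \<open>s + 1\<close> is
    at most \<open>3 * \<tau>\<close>, so the decaying coefficients may be frozen at that
    value.\<close>
  define g0 where "g0 = cq * (3 * \<tau>) powr (- (n * (q - 1)))"
  define h0 where "h0 = cp * (3 * \<tau>) powr (- (n * (p - 1)))"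
  have decay: "(3 * \<tau>) powr (- (n * (r - 1))) \<le> (s + 1) powr (- (n * (r - 1)))"
    if "\<tau> \<le> s" "s \<le> 2 * \<tau>" "1 < r" for r s
    using that \<tau> by (intro powr_mono2') (auto simp: n_def)
  have "h0 * g0 powr p * V0 powr (p * q - 1) * \<tau> powr (p + 2) < 2 powr ((p + 2) / (p * q - 1)) * 6 powr (p + 2)"
  proof (rule blow_up[OF pos refl refl p q])
    show "0 < g0" "0 < h0" using cq cp pos by (auto simp: g0_def h0_def)
    fix s assume s: "\<tau> \<le> s" "s \<le> 2 * \<tau>"
    show "V0 \<le> V s" using V_mono[of \<tau> s] V_\<tau> s by simp
    have "g0 * V s powr q \<le> cq * (s + 1) powr (- (n * (q - 1))) * V s powr q"
      unfolding g0_def using decay[OF s q] cq by (intro mult_right_mono mult_left_mono) auto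
    also have "\<dots> \<le> G s" using s pos by (intro G_V) auto
    finally show "g0 * V s powr q \<le> G s" .
    have "h0 * W s powr p \<le> cp * (s + 1) powr (- (n * (p - 1))) * W s powr p"
      unfolding h0_def using decay[OF s p] cp by (intro mult_right_mono mult_left_mono) auto
    also have "\<dots> \<le> H s" using s pos by (intro H_W) auto
    finally show "h0 * W s powr p \<le> H s" .
  qed (rule V0)
  moreover have "h0 * g0 powr p * V0 powr (p * q - 1) * \<tau> powr (p + 2) =
      cp * cq powr p * 3 powr (- (n * (p * q - 1))) * c2 powr (p * q - 1) *
      (\<epsilon> powr (p * (p * q - 1)) * \<tau> powr (p + 2 - ((n - 1) / 2 * p - 1) * (p * q - 1)))"
  proof -
    have 1: "g0 powr p = cq powr p * (3 * \<tau>) powr (- (n * (q - 1)) * p)"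
      using cq pos by (simp add: g0_def powr_mult powr_powr)
    have 2: "(3 * \<tau>) powr (- (n * (p - 1))) * (3 * \<tau>) powr (- (n * (q - 1)) * p) =
        3 powr (- (n * (p * q - 1))) * \<tau> powr (- (n * (p * q - 1)))"
      using pos by (simp add: powr_mult[symmetric] powr_add[symmetric] algebra_simps)
    have 3: "V0 powr (p * q - 1) = c2 powr (p * q - 1) * \<epsilon> powr (p * (p * q - 1)) * \<tau> powr ((\<alpha> + 2) * (p * q - 1))"
      using c2 \<epsilon> pos by (simp add: V0_def powr_mult powr_powr)
    \<comment> \<open>The term \<open>n\<close> cancels:
      \<open>\<alpha> + 2 - n = 1 - (n - 1) / 2 * p\<close>, which produces the bracket of the
      hypothesis on \<open>p\<close> and \<open>q\<close>.\<close>
    have 4: "\<tau> powr (- (n * (p * q - 1))) * \<tau> powr ((\<alpha> + 2) * (p * q - 1)) * \<tau> powr (p + 2) =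
        \<tau> powr (p + 2 - ((n - 1) / 2 * p - 1) * (p * q - 1))"
      unfolding powr_add[symmetric] \<alpha>_def
      by (rule arg_cong[where f = "\<lambda>e. \<tau> powr e"]) (simp add: field_simps)
    have "h0 * g0 powr p * V0 powr (p * q - 1) * \<tau> powr (p + 2) =
        cp * cq powr p * ((3 * \<tau>) powr (- (n * (p - 1))) * (3 * \<tau>) powr (- (n * (q - 1)) * p)) *
        V0 powr (p * q - 1) * \<tau> powr (p + 2)"
      unfolding 1 h0_def by (simp only: mult_ac)
    also have "\<dots> = cp * cq powr p * 3 powr (- (n * (p * q - 1))) * c2 powr (p * q - 1) *
        (\<epsilon> powr (p * (p * q - 1)) * (\<tau> powr (- (n * (p * q - 1))) * \<tau> powr ((\<alpha> + 2) * (p * q - 1)) * \<tau> powr (p + 2)))"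
      unfolding 2 3 by (simp only: mult_ac)
    finally show ?thesis unfolding 4 .
  qed
  ultimately show ?thesis by simp
qed

end

theorem theorem1p1:
  fixes p q :: real
    and f g f' g' :: "'a::euclidean_space \<Rightarrow> real"
  defines "n \<equiv> real DIM('a)"
  assumes n2: "DIM('a) \<ge> 2"
    and q: "q > 1"
    and p: "1 < p" "p < 2 * n / (n - 1)"
    and pq: "((n - 1) / 2 * p - 1) * (p * q - 1) < p + 2"
    and nonneg: "\<forall>x. f x \<ge> 0" "\<forall>x. g x \<ge> 0" "\<forall>x. f' x \<ge> 0" "\<forall>x. g' x \<ge> 0"
    and fg: "\<not> (AE x in lebesgue. f x + g x = 0)"
    and g': "\<not> (AE x in lebesgue. g' x = 0)"
  shows "\<exists>C1>0. \<forall>\<epsilon> (T::ereal) u ut v vt.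
     0 < \<epsilon> \<and> \<epsilon> \<le> 1 \<and> 0 < T \<and>
     weak_solution p q T u ut v vt \<and>
     (AE x in lebesgue. u 0 x = \<epsilon> * f x) \<and> (AE x in lebesgue. ut 0 x = \<epsilon> * g x) \<and>
     (AE x in lebesgue. v 0 x = \<epsilon> * f' x) \<and> (AE x in lebesgue. vt 0 x = \<epsilon> * g' x) \<and>
     (\<forall>t\<in>Ico_T T. AE x in lebesgue. norm x > t + 1 \<longrightarrow>
         u t x = 0 \<and> v t x = 0 \<and> ut t x = 0 \<and> vt t x = 0)
     \<longrightarrow> T \<le> ereal (C1 * \<epsilon> powr (- (p * (p * q - 1)) / (p + 2 - ((n - 1) / 2 * p - 1) * (p * q - 1))))"
proof -
  \<comment> \<open>Positivity of \<open>m0\<close> is postponed until a solution is given: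
    \<open>f\<close> and \<open>g\<close> are known to be integrable only through the initial values
    of that solution, and without integrability the integrals could be the default zero.\<close>
  define m0 where "m0 = exp (- 1) * (LINT x|lebesgue. f x) + exp (- 1) * (LINT x|lebesgue. g x)"
  obtain c where c: "0 < c" and
    lower: "\<And>t (h :: 'a \<Rightarrow> real) X. 0 \<le> t \<Longrightarrow> h \<in> borel_measurable lebesgue \<Longrightarrow>
      (AE x in lebesgue. norm x > t + 1 \<longrightarrow> h x = 0) \<Longrightarrow> integrable lebesgue (\<lambda>x. \<bar>h x\<bar> powr p) \<Longrightarrow>
      0 \<le> X \<Longrightarrow> (\<forall>\<omega>. norm \<omega> = 1 \<longrightarrow> X \<le> exp (- t) * exp_moment \<omega> h) \<Longrightarrow>
      c * X powr p * (t + 1) powr ((real DIM('a) - 1) * (1 - p / 2)) \<le> (LINT x|lebesgue. \<bar>h x\<bar> powr p)"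
    using powr_integral_lower_bound[OF p(1), where 'a = 'a] by blast
  define \<theta> where "\<theta> = p + 2 - ((n - 1) / 2 * p - 1) * (p * q - 1)"
  have \<theta>: "0 < \<theta>" using pq by (simp add: \<theta>_def)
  have pq1: "1 < p * q" using p q by (metis less_1_mult)
  define K where "K = 1 / (2 powr p * unit_ball_vol n powr (p - 1)) *
    (1 / (2 powr q * unit_ball_vol n powr (q - 1))) powr p * 3 powr (- (n * (p * q - 1))) *
    (c * (m0 / 4) powr p * 3 powr (- \<bar>(n - 1) * (1 - p / 2)\<bar>) / 9) powr (p * q - 1)"
  define \<Lambda> where "\<Lambda> = 2 powr ((p + 2) / (p * q - 1)) * 6 powr (p + 2)"
  \<comment> \<open>The first entry ensures \<open>3 \<le> \<tau>\<close> below, the second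
    \<open>\<Lambda> \<le> K * C powr \<theta>\<close>, the opposite of the lifespan
    inequality.\<close>
  define C where "C = max 3 ((\<Lambda> / K) powr (1 / \<theta>))"
  have \<Lambda>: "0 < \<Lambda>" by (simp add: \<Lambda>_def)
  have C: "3 \<le> C" by (simp add: C_def)
  have "T \<le> ereal (2 * C * \<epsilon> powr (- (p * (p * q - 1)) / \<theta>))"
    if \<epsilon>: "0 < \<epsilon>" "\<epsilon> \<le> 1" and T: "0 < T" and sol: "weak_solution p q T u ut v vt"
      and u0: "AE x in lebesgue. u 0 x = \<epsilon> * f x" and ut0: "AE x in lebesgue. ut 0 x = \<epsilon> * g x"
      and v0: "AE x in lebesgue. v 0 x = \<epsilon> * f' x" and vt0: "AE x in lebesgue. vt 0 x = \<epsilon> * g' x"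
      and cone: "\<forall>t\<in>Ico_T T. AE x in lebesgue. norm x > t + 1 \<longrightarrow>
         u t x = 0 \<and> v t x = 0 \<and> ut t x = 0 \<and> vt t x = 0"
    for \<epsilon> T u ut v vt
  proof (rule ccontr)
    assume contra: "\<not> ?thesis"
    interpret cone_solution p q T u ut v vt
    proof
      show "in_cone (Ico_T T) u" "in_cone (Ico_T T) ut" "in_cone (Ico_T T) v" "in_cone (Ico_T T) vt"
        using cone unfolding in_cone_def by (auto elim!: ballE elim: eventually_mono)
    qed (use p q T sol in auto)
    have 0: "0 \<in> Ico_T T" using T by (simp add: Ico_T_def zero_ereal_def)
    have L1: "integrable lebesgue (w 0)" if "cont_Lr 1 (Ico_T T) w" for w :: "real \<Rightarrow> 'a \<Rightarrow> real"
      using that 0 by (auto simp: cont_Lr_def integrable_abs_iff)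
    have supp: "AE x in lebesgue. norm x > 1 \<longrightarrow> w 0 x = 0" if "in_cone (Ico_T T) w" for w :: "real \<Rightarrow> 'a \<Rightarrow> real"
      using that 0 by (auto simp: in_cone_def)
    note u_init = initial_moment_lower_bound[OF L1[OF regularity(1)] supp[OF cone_solution.cone(1)[OF cone_solution_axioms]] u0 _ \<epsilon>(1)]
    note ut_init = initial_moment_lower_bound[OF L1[OF regularity(2)] supp[OF cone_solution.cone(2)[OF cone_solution_axioms]] ut0 _ \<epsilon>(1)]
    note v_init = initial_moment_lower_bound[OF L1[OF regularity(3)] supp[OF cone_solution.cone(3)[OF cone_solution_axioms]] v0 _ \<epsilon>(1)]
    note vt_init = initial_moment_lower_bound[OF L1[OF regularity(4)] supp[OF cone_solution.cone(4)[OF cone_solution_axioms]] vt0 _ \<epsilon>(1)]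
    have nn: "0 \<le> \<epsilon> * (exp (- 1) * (LINT x|lebesgue. k x))" if "\<forall>x. 0 \<le> k x" for k :: "'a \<Rightarrow> real"
      using that \<epsilon> by (intro mult_nonneg_nonneg integral_nonneg_AE) auto
    have init: "0 \<le> W 0" "0 \<le> V 0" "0 \<le> V1 0"
      using ut_init(2)[of 0] v_init(2)[of 0] vt_init(2)[of 0] nn[of g] nn[of f'] nn[of g'] nonneg
      by (auto intro: order_trans)
    have wave: "\<epsilon> * m0 \<le> exp_moment \<omega> (u 0) + exp_moment \<omega> (ut 0)" "0 \<le> exp_moment \<omega> (ut 0)"
      if "norm \<omega> = 1" for \<omega>
      using u_init(2)[of \<omega>] ut_init(2)[of \<omega>] nn[of g] nonneg that
      by (auto simp: m0_def distrib_left intro: order_trans)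
    have f_int: "integrable lebesgue f" and g_int: "integrable lebesgue g"
      using u_init(1) ut_init(1) nonneg by auto
    have "(LINT x|lebesgue. f x + g x) \<noteq> 0"
      using fg f_int g_int nonneg by (subst integral_nonneg_eq_0_iff_AE) auto
    moreover have "0 \<le> (LINT x|lebesgue. f x + g x)"
      using nonneg by (intro integral_nonneg_AE) auto
    moreover have "(LINT x|lebesgue. f x + g x) = (LINT x|lebesgue. f x) + (LINT x|lebesgue. g x)"
      using f_int g_int by (rule Bochner_Integration.integral_add)
    ultimately have m0: "0 < m0" by (simp add: m0_def distrib_left[symmetric])
    have "0 < unit_ball_vol n" by (simp add: n_def)
    then have K: "0 < K" using c m0 by (simp add: K_def)
    define e where "e = \<epsilon> powr (- (p * (p * q - 1)) / \<theta>)"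
    have e: "1 \<le> e"
    proof -
      have "1 powr (- (p * (p * q - 1)) / \<theta>) \<le> e"
        unfolding e_def using \<epsilon> p pq1 \<theta> by (intro powr_mono2') (auto simp: divide_nonpos_pos)
      then show ?thesis by simp
    qed
    \<comment> \<open>With this \<open>\<tau>\<close> the powers of \<open>\<epsilon>\<close>
      cancel. If \<open>T\<close> exceeded the claimed bound \<open>2 * \<tau>\<close>, the solution
      would exist on the whole blow-up window, which explains the factor two in the final
      constant.\<close>
    define \<tau> where "\<tau> = C * e"
    have \<tau>: "3 \<le> \<tau>" using mult_mono[of 3 C 1 e] C e by (simp add: \<tau>_def)
    have \<tau>T: "ereal (2 * \<tau>) < T" using contra by (simp add: \<tau>_def e_def not_le mult.assoc)
    have "K * (\<epsilon> powr (p * (p * q - 1)) * \<tau> powr \<theta>) < \<Lambda>"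
      unfolding K_def \<Lambda>_def \<theta>_def n_def
      by (rule lifespan_inequality[OF c \<epsilon>(1) m0 init wave lower \<tau> \<tau>T])
    moreover have "\<epsilon> powr (p * (p * q - 1)) * \<tau> powr \<theta> = C powr \<theta>"
    proof -
      have e_powr: "e powr \<theta> = \<epsilon> powr (- (p * (p * q - 1)))"
        using \<theta> by (simp add: e_def powr_powr)
      have "\<epsilon> powr (p * (p * q - 1)) * e powr \<theta> = 1"
        using \<epsilon> by (simp only: e_powr powr_add[symmetric]) simp
      moreover have "\<tau> powr \<theta> = C powr \<theta> * e powr \<theta>"
        using C e by (simp add: \<tau>_def powr_mult)
      ultimately show ?thesis by (metis mult.left_commute mult.right_neutral)
    qed
    moreover have "\<Lambda> / K \<le> C powr \<theta>"
    proof -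
      have "\<Lambda> / K = ((\<Lambda> / K) powr (1 / \<theta>)) powr \<theta>"
        using \<theta> \<Lambda> K by (simp add: powr_powr)
      also have "\<dots> \<le> C powr \<theta>" using \<theta> by (intro powr_mono2) (auto simp: C_def)
      finally show ?thesis .
    qed
    ultimately show False using K by (simp add: field_simps)
  qed
  then show ?thesis
    using C by (intro exI[of _ "2 * C"]) (auto simp: \<theta>_def)
qed

end
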